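(* Let $\delta=\prod_{1\le i<j\le n}\dfrac{e^{\frac12\varepsilon_{ij}}+e^{-\frac12\varepsilon_{ij}}}{e^{\frac12\varepsilon_{ij}}-e^{-\frac12\varepsilon_{ij}}}=\prod_{1\le i<j\le n}\dfrac{x_i+x_j}{x_i-x_j}$, where $\varepsilon_{ij}=\varepsilon_i-\varepsilon_j$ and $x_i=e^{\varepsilon_i}$. Then: i) $\delta^{-1}\Omega_3\,\delta=\sum_{i=1}^n\partial_i^3-\bigl(\sum_{i=1}^n\partial_i\bigr)^2$ (composition of operators, $\delta^{\pm1}$ acting by multiplication). ii) The polynomials $Q_\lambda(x_1,\dots,x_n)$, $\lambda$ a strict partition, are common eigenfunctions of the operators $\Omega_k$ for $k=1,3,5,\dots$. iii) Let $P(x_1,\dots,x_n)$ be a polynomial that is symmetric in $x_1,\dots,x_n$ and such that after the substitution $x_i=t$, $x_j=-t$ ($i\neq j$) it becomes independent of $t$. If $P$ is an eigenfunction of all the operators $\Omega_k$, $k=1,3,5,\dots$, then, up to a scalar multiple, $P$ coincides with one of the $Q_\lambda$.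
   Context: Ground field $\mathbb C$. Let $x_1,\dots,x_n$ be indeterminates, $\partial_i=x_i\frac{\partial}{\partial x_i}$; write $x_i=e^{\varepsilon_i}$. **Operators.** Define differential operators with coefficients in $\mathbb C(x_1,\dots,x_n)$: $\partial_i^{(1)}=\partial_i$ and, for $k\ge2$, $$\partial_i^{(k)}=\partial_i\partial_i^{(k-1)}+\sum_{j\ne i}\frac{2x_ix_j}{x_i^2-x_j^2}\bigl(\partial_i^{(k-1)}-\partial_j^{(k-1)}\bigr)\quad(k\text{ odd}),$$ $$\partial_i^{(k)}=(\partial_i-1)\partial_i^{(k-1)}+\sum_{j\ne i}\Bigl(\frac{2x_ix_j}{x_i^2-x_j^2}\partial_i^{(k-1)}-\frac{2x_i^2}{x_i^2-x_j^2}\partial_j^{(k-1)}\Bigr)\quad(k\text{ even}).$$ For $k$ odd, $\Omega_k=\sum_{i=1}^n\partial_i^{(k)}$. **Polynomials $Q_\lambda$.** Define $q_k(x_1,\dots,x_n)$ by $\sum_{k\ge0}q_kt^k=\prod_i\frac{1+x_it}{1-x_it}$, and $Q_{k,l}=q_kq_l+2\sum_{p=1}^{l}(-1)^pq_{k+p}q_{l-p}$; one has $Q_{k,0}=q_k$ and $Q_{k,l}=-Q_{l,k}$ for $k+l>0$. For a strict partition $\lambda=(\lambda_1>\dots>\lambda_m>0)$ with $m$ even, $Q_\lambda$ is the Pfaffian of the skew-symmetric matrix $(Q_{\lambda_i,\lambda_j})_{i,j\le m}$; for $m$ odd, $Q_\lambda$ is the same Pfaffian for the sequence $(\lambda_1,\dots,\lambda_m,0)$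 (zero diagonal entries). The empty partition ($m=0$) is allowed, with $Q_\emptyset=1$. "Eigenfunction" means $\Omega_kf=c_kf$ for some scalar $c_k$ (nonzero $f$ in iii). *)

theory Defs
  imports
    Complex_Main
    "HOL-Library.Poly_Mapping"
    "HOL-Combinatorics.Permutations"
    "HOL-Computational_Algebra.Computational_Algebra"
begin

section \<open>Polynomials and rational functions in the variables indexed by a finite type\<close>

text \<open>
  The variables are indexed by a finite linearly ordered type \<open>'n\<close>, so the number of
  variables is \<open>n = CARD('n)\<close>. A polynomial maps exponent vectors to coefficients. The order
  on \<open>'n\<close> makes the polynomials an integral domain and fixes the sign of \<open>delta\<close> below.
\<close>

type_synonym 'n mpoly = "('n \<Rightarrow>\<^sub>0 nat) \<Rightarrow>\<^sub>0 complex"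
type_synonym 'n ratfun = "(('n \<Rightarrow>\<^sub>0 nat) \<Rightarrow>\<^sub>0 complex) fract"


definition Const :: "complex \<Rightarrow> 'n mpoly"
  where "Const c = Poly_Mapping.single 0 c"

definition Var :: "'n \<Rightarrow> 'n mpoly"
  where "Var i = Poly_Mapping.single (Poly_Mapping.single i 1) 1"

text \<open>
  The value of a polynomial under the substitution \<open>x\<^sub>i \<mapsto> f i\<close>, where \<open>h\<close> embeds the scalars
  into the target ring.
\<close>

definition subst ::
  "(complex \<Rightarrow> 'b) \<Rightarrow> ('n \<Rightarrow> 'b) \<Rightarrow> 'n::finite mpoly \<Rightarrow> 'b::comm_ring_1"
  where "subst h f p =
    (\<Sum>m\<in>Poly_Mapping.keys p. h (Poly_Mapping.lookup p m) *
      (\<Prod>i\<in>UNIV. f i ^ Poly_Mapping.lookup m i))"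

definition symmetric_mpoly :: "'n::finite mpoly \<Rightarrow> bool"
  where "symmetric_mpoly p \<longleftrightarrow>
    (\<forall>\<pi>. bij \<pi> \<longrightarrow> subst Const (\<lambda>i. Var (\<pi> i)) p = p)"

text \<open>
  After the substitution \<open>x\<^sub>i = t\<close>, \<open>x\<^sub>j = -t\<close> a polynomial is viewed as a polynomial in the fresh
  variable \<open>t\<close> whose coefficients are polynomials in the remaining variables.
\<close>

definition cancellation_property :: "'n::finite mpoly \<Rightarrow> bool"
  where "cancellation_property p \<longleftrightarrow>
    (\<forall>i j. i \<noteq> j \<longrightarrow>
      degree (subst (\<lambda>c. [:Const c:])
        (\<lambda>l. if l = i then [:0, 1:] else if l = j then - [:0, 1:] else [:Var l:]) p) = 0)"

section \<open>The derivations \<open>x\<^sub>i \<partial>/\<partial>x\<^sub>i\<close>\<close>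

lift_definition partial_mpoly :: "'n \<Rightarrow> 'n mpoly \<Rightarrow> 'n mpoly" is
  "\<lambda>i (p :: ('n \<Rightarrow>\<^sub>0 nat) \<Rightarrow> complex) m.
     of_nat (Poly_Mapping.lookup m i + 1) * p (m + Poly_Mapping.single i 1)"
proof -
  fix i :: 'n and p :: "('n \<Rightarrow>\<^sub>0 nat) \<Rightarrow> complex"
  let ?s = "Poly_Mapping.single i 1 :: 'n \<Rightarrow>\<^sub>0 nat"
  assume fin: "finite {m. p m \<noteq> 0}"
  have "{m. of_nat (Poly_Mapping.lookup m i + 1) * p (m + ?s) \<noteq> 0}
      \<subseteq> (\<lambda>m. m - ?s) ` {m. p m \<noteq> 0}"
  proof
    fix m assume "m \<in> {m. of_nat (Poly_Mapping.lookup m i + 1) * p (m + ?s) \<noteq> 0}"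
    then have "m + ?s \<in> {m. p m \<noteq> 0}" by auto
    moreover have "m = (m + ?s) - ?s" by simp
    ultimately show "m \<in> (\<lambda>m. m - ?s) ` {m. p m \<noteq> 0}" by blast
  qed
  then show "finite {m. of_nat (Poly_Mapping.lookup m i + 1) * p (m + ?s) \<noteq> 0}"
    using fin finite_subset by blast
qed

lemma partial_mpoly_add: "partial_mpoly i (p + q) = partial_mpoly i p + partial_mpoly i q"
  by (rule poly_mapping_eqI)
    (simp add: partial_mpoly.rep_eq lookup_add distrib_left)

lemma partial_mpoly_0 [simp]: "partial_mpoly i 0 = 0"
  by (rule poly_mapping_eqI) (simp add: partial_mpoly.rep_eq)

lemma partial_mpoly_sum: "partial_mpoly i (sum f A) = (\<Sum>a\<in>A. partial_mpoly i (f a))"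
  by (induction A rule: infinite_finite_induct) (simp_all add: partial_mpoly_add)

lemma partial_mpoly_single:
  "partial_mpoly i (Poly_Mapping.single m c) =
    Poly_Mapping.single (m - Poly_Mapping.single i 1) (of_nat (Poly_Mapping.lookup m i) * c)"
proof (rule poly_mapping_eqI)
  fix k
  let ?s = "Poly_Mapping.single i 1 :: 'a \<Rightarrow>\<^sub>0 nat"
  show "Poly_Mapping.lookup (partial_mpoly i (Poly_Mapping.single m c)) k =
    Poly_Mapping.lookup
      (Poly_Mapping.single (m - ?s) (of_nat (Poly_Mapping.lookup m i) * c)) k"
  proof (cases "m = k + ?s")
    case True
    then show ?thesis
      by (simp add: partial_mpoly.rep_eq lookup_add)
  next
    case False
    have "Poly_Mapping.lookup m i = 0" if "m - ?s = k"
    proof (rule ccontr)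
      assume "Poly_Mapping.lookup m i \<noteq> 0"
      then have "m = (m - ?s) + ?s"
        by (intro poly_mapping_eqI) (auto simp: lookup_add lookup_minus lookup_single when_def)
      with that False show False by simp
    qed
    with False show ?thesis
      by (auto simp: partial_mpoly.rep_eq lookup_single when_def)
  qed
qed

lemma mpoly_sum_monomials:
  fixes p :: "'n mpoly"
  shows "p = (\<Sum>m\<in>Poly_Mapping.keys p. Poly_Mapping.single m (Poly_Mapping.lookup p m))"
  by (rule poly_mapping_eqI)
    (auto simp: lookup_sum lookup_single when_def in_keys_iff)

lemma partial_mpoly_mult_single:
  "partial_mpoly i (Poly_Mapping.single m a * Poly_Mapping.single k b) =
    partial_mpoly i (Poly_Mapping.single m a) * Poly_Mapping.single k b +
    Poly_Mapping.single m a * partial_mpoly i (Poly_Mapping.single k b)"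
proof -
  let ?s = "Poly_Mapping.single i 1 :: 'a \<Rightarrow>\<^sub>0 nat"
  let ?l = "Poly_Mapping.lookup m i" and ?r = "Poly_Mapping.lookup k i"
  have "m + k - ?s = (m - ?s) + k" if "?l \<noteq> 0"
    using that
    by (intro poly_mapping_eqI) (auto simp: lookup_add lookup_minus lookup_single when_def)
  then have 1: "Poly_Mapping.single (m + k - ?s) (of_nat ?l * a * b) =
      Poly_Mapping.single ((m - ?s) + k) (of_nat ?l * a * b)"
    by (cases "?l = 0") auto
  have "m + k - ?s = m + (k - ?s)" if "?r \<noteq> 0"
    using that
    by (intro poly_mapping_eqI) (auto simp: lookup_add lookup_minus lookup_single when_def)
  then have 2: "Poly_Mapping.single (m + k - ?s) (a * (of_nat ?r * b)) =
      Poly_Mapping.single (m + (k - ?s)) (a * (of_nat ?r * b))"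
    by (cases "?r = 0") auto
  have "of_nat (?l + ?r) * (a * b) = of_nat ?l * a * b + a * (of_nat ?r * b)"
    by (simp add: algebra_simps)
  then show ?thesis
    unfolding mult_single partial_mpoly_single lookup_add
    using 1 2 by (simp only: single_add)
qed

lemma partial_mpoly_mult:
  "partial_mpoly i (p * q) = partial_mpoly i p * q + p * partial_mpoly i q"
proof -
  let ?S = "\<lambda>r::'a mpoly. \<lambda>m. Poly_Mapping.single m (Poly_Mapping.lookup r m)"
  let ?K = "\<lambda>r::'a mpoly. Poly_Mapping.keys r"
  have "partial_mpoly i ((\<Sum>m\<in>?K p. ?S p m) * (\<Sum>k\<in>?K q. ?S q k)) =
      (\<Sum>m\<in>?K p. partial_mpoly i (?S p m)) * (\<Sum>k\<in>?K q. ?S q k) +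
      (\<Sum>m\<in>?K p. ?S p m) * (\<Sum>k\<in>?K q. partial_mpoly i (?S q k))"
    by (simp add: sum_product partial_mpoly_sum partial_mpoly_mult_single sum.distrib)
  then show ?thesis
    unfolding partial_mpoly_sum[symmetric] mpoly_sum_monomials[symmetric] .
qed

lemma partial_quotient_rule_well_defined:
  fixes a b c d :: "'n::linorder mpoly"
  assumes "b \<noteq> 0" "d \<noteq> 0" "Fract a b = Fract c d"
  shows "Fract (partial_mpoly i a * b - a * partial_mpoly i b) (b * b) =
    Fract (partial_mpoly i c * d - c * partial_mpoly i d) (d * d)"
proof -
  have e: "a * d = c * b"
    using assms by (simp add: eq_fract)
  have "partial_mpoly i (a * d) = partial_mpoly i (c * b)"
    using e by simp
  then have e': "partial_mpoly i a * d =
      partial_mpoly i c * b + c * partial_mpoly i b - a * partial_mpoly i d"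
    by (simp add: partial_mpoly_mult algebra_simps)
  have "(partial_mpoly i a * b - a * partial_mpoly i b) * (d * d) =
      (partial_mpoly i a * d) * (b * d) - (a * d) * (partial_mpoly i b * d)"
    by (simp add: algebra_simps)
  also have "\<dots> =
      partial_mpoly i c * b * (b * d) + c * partial_mpoly i b * (b * d) -
      (a * d) * (partial_mpoly i d * b) - (a * d) * (partial_mpoly i b * d)"
    unfolding e' by (simp add: algebra_simps)
  also have "\<dots> = (partial_mpoly i c * d - c * partial_mpoly i d) * (b * b)"
    unfolding e by (simp add: algebra_simps)
  finally show ?thesis
    using assms by (simp add: eq_fract)
qed

definition partial :: "'n::linorder \<Rightarrow> 'n ratfun \<Rightarrow> 'n ratfun"
  where "partial i f = (THE g. \<exists>a b. b \<noteq> 0 \<and> f = Fract a b \<and>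
    g = Fract (partial_mpoly i a * b - a * partial_mpoly i b) (b * b))"

lemma partial_Fract:
  assumes "b \<noteq> 0"
  shows "partial i (Fract a b) = Fract (partial_mpoly i a * b - a * partial_mpoly i b) (b * b)"
  unfolding partial_def
proof (rule the_equality)
  show "\<exists>a' b'. b' \<noteq> 0 \<and> Fract a b = Fract a' b' \<and>
      Fract (partial_mpoly i a * b - a * partial_mpoly i b) (b * b) =
      Fract (partial_mpoly i a' * b' - a' * partial_mpoly i b') (b' * b')"
    using assms by blast
next
  fix g
  assume "\<exists>a' b'. b' \<noteq> 0 \<and> Fract a b = Fract a' b' \<and>
      g = Fract (partial_mpoly i a' * b' - a' * partial_mpoly i b') (b' * b')"
  then show "g = Fract (partial_mpoly i a * b - a * partial_mpoly i b) (b * b)"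
    using partial_quotient_rule_well_defined[OF assms] by metis
qed

lemma partial_to_fract: "partial i (to_fract p) = to_fract (partial_mpoly i p)"
proof -
  have "partial_mpoly i (1 :: 'a mpoly) = 0"
    using partial_mpoly_mult[of i 1 1] by simp
  then show ?thesis by (simp add: to_fract_def partial_Fract)
qed

definition X :: "'n::linorder \<Rightarrow> 'n ratfun"
  where "X i = to_fract (Var i)"

definition euler :: "'n::linorder \<Rightarrow> 'n ratfun \<Rightarrow> 'n ratfun"
  where "euler i f = X i * partial i f"

section \<open>The operators \<open>\<Omega>\<^sub>k\<close> and the factor \<open>\<delta>\<close>\<close>

text \<open>
  The value at \<open>k = 0\<close> is a dummy; it is not used by the recursion.
\<close>

fun dop :: "nat \<Rightarrow> 'n \<Rightarrow> 'n::{finite,linorder} ratfun \<Rightarrow> 'n ratfun" where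
  "dop 0 i f = f"
| "dop (Suc 0) i f = euler i f"
| "dop (Suc (Suc k)) i f =
    (if odd (Suc (Suc k)) then
       euler i (dop (Suc k) i f) +
       (\<Sum>j\<in>UNIV - {i}. 2 * X i * X j / ((X i)\<^sup>2 - (X j)\<^sup>2) *
          (dop (Suc k) i f - dop (Suc k) j f))
     else
       (euler i (dop (Suc k) i f) - dop (Suc k) i f) +
       (\<Sum>j\<in>UNIV - {i}. 2 * X i * X j / ((X i)\<^sup>2 - (X j)\<^sup>2) * dop (Suc k) i f -
          2 * (X i)\<^sup>2 / ((X i)\<^sup>2 - (X j)\<^sup>2) * dop (Suc k) j f))"

definition Omega :: "nat \<Rightarrow> 'n::{finite,linorder} ratfun \<Rightarrow> 'n ratfun"
  where "Omega k f = (\<Sum>i\<in>UNIV. dop k i f)"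

definition eigenfunction ::
  "('n::{finite,linorder} ratfun \<Rightarrow> 'n ratfun) \<Rightarrow> 'n ratfun \<Rightarrow> bool"
  where "eigenfunction T f \<longleftrightarrow> (\<exists>c. T f = to_fract (Const c) * f)"

definition delta :: "'n::{finite,linorder} ratfun"
  where "delta = (\<Prod>(i, j)\<in>{(i, j). i < j}. (X i + X j) / (X i - X j))"

text \<open>
  With \<open>y\<^sub>i = exp (\<epsilon>\<^sub>i / 2)\<close>, that is \<open>y\<^sub>i\<^sup>2 = x\<^sub>i\<close>, in any field containing such square roots, the factors
  of \<open>delta\<close> take the hyperbolic form \<open>coth (\<epsilon>\<^sub>i\<^sub>j / 2)\<close>.
\<close>

lemma delta_factor_exponential_form:
  fixes y :: "'n \<Rightarrow> 'a::field"
  assumes "y i \<noteq> 0" "y j \<noteq> 0"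
  shows "(y i / y j + y j / y i) / (y i / y j - y j / y i) =
    ((y i)\<^sup>2 + (y j)\<^sup>2) / ((y i)\<^sup>2 - (y j)\<^sup>2)"
proof -
  have "y i / y j + y j / y i = ((y i)\<^sup>2 + (y j)\<^sup>2) / (y i * y j)"
    "y i / y j - y j / y i = ((y i)\<^sup>2 - (y j)\<^sup>2) / (y i * y j)"
    using assms by (simp_all add: field_simps power2_eq_square)
  then show ?thesis using assms by simp
qed

section \<open>Schur's Q-polynomials\<close>

text \<open>
  Polynomials have no division, so \<open>1 / (1 - x\<^sub>i t)\<close> is written with the inverse of power series
  over a ring, given the inverse of the constant coefficient.
\<close>

definition q_gen :: "'n::{finite,linorder} mpoly fps"
  where "q_gen = (\<Prod>i\<in>UNIV. (1 + fps_const (Var i) * fps_X) *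
    fps_right_inverse (1 - fps_const (Var i) * fps_X) 1)"

lemma q_gen_mult:
  "(q_gen :: 'n::{finite,linorder} mpoly fps) * (\<Prod>i\<in>UNIV. 1 - fps_const (Var i) * fps_X) =
    (\<Prod>i\<in>UNIV. 1 + fps_const (Var i) * fps_X)"
proof -
  have "(1 - fps_const (Var i) * fps_X) *
      fps_right_inverse (1 - fps_const (Var i) * fps_X) 1 = 1" for i :: 'n
    by (rule fps_right_inverse) simp
  then show ?thesis
    unfolding q_gen_def prod.distrib[symmetric]
    by (simp add: mult.assoc mult.commute[of "fps_right_inverse _ _"])
qed

definition q_poly :: "nat \<Rightarrow> 'n::{finite,linorder} mpoly"
  where "q_poly k = fps_nth q_gen k"

definition Q_pair :: "nat \<Rightarrow> nat \<Rightarrow> 'n::{finite,linorder} mpoly"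
  where "Q_pair k l = q_poly k * q_poly l + 2 * (\<Sum>p=1..l. (-1) ^ p * q_poly (k + p) * q_poly (l - p))"

text \<open>
  The Pfaffian of a skew-symmetric matrix with rows and columns indexed by \<open>0, \<dots>, 2m - 1\<close>, as the
  signed sum over perfect matchings; each matching
  \<open>{{\<pi> 0, \<pi> 1}, {\<pi> 2, \<pi> 3}, \<dots>}\<close> is represented by its unique normalized permutation.
\<close>

definition pfaffian :: "nat \<Rightarrow> (nat \<Rightarrow> nat \<Rightarrow> 'a::comm_ring_1) \<Rightarrow> 'a"
  where "pfaffian m A =
    (\<Sum>\<pi> | \<pi> permutes {..<2 * m} \<and> (\<forall>i<m. \<pi> (2 * i) < \<pi> (2 * i + 1)) \<and>
        (\<forall>i<m. \<forall>j<i. \<pi> (2 * j) < \<pi> (2 * i)).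
      of_int (sign \<pi>) * (\<Prod>i<m. A (\<pi> (2 * i)) (\<pi> (2 * i + 1))))"

definition strict_partition :: "nat list \<Rightarrow> bool"
  where "strict_partition lam \<longleftrightarrow> sorted_wrt (>) lam \<and> (\<forall>k\<in>set lam. k > 0)"

definition even_padding :: "nat list \<Rightarrow> nat list"
  where "even_padding lam = (if even (length lam) then lam else lam @ [0])"

definition Q_poly :: "nat list \<Rightarrow> 'n::{finite,linorder} mpoly"
  where "Q_poly lam = (let mu = even_padding lam in
    pfaffian (length mu div 2) (\<lambda>i j. if i = j then 0 else Q_pair (mu ! i) (mu ! j)))"

lemma Q_poly_Nil: "Q_poly [] = 1"
proof -
  have "{\<pi>. \<pi> permutes {..<0::nat}} = {id}" by (auto simp: permutes_empty)
  then show ?thesis by (simp add: Q_poly_def even_padding_def pfaffian_def)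
qed

end

theory Submission
  imports Defs
begin

text \<open>
  Conjugation by \<open>\<delta>\<close> turns \<open>\<Omega>\<^sub>k\<close> into an operator with constant coefficients: suitable combinations in
  the conjugated recursion stay regular along every divisor \<open>x\<^sub>r = \<plusminus> x\<^sub>s\<close>, so a monomial is mapped to a
  polynomial multiple of itself, and this multiple is homogeneous of degree \<open>0\<close>, hence constant. The
  constant is read off in the limit \<open>x\<^sub>1 \<gg> x\<^sub>2 \<gg> \<dots>\<close>; the generating function of these eigenvalues is
  a product over the variables, which makes them polynomials in the sums
  \<open>\<Sum>\<^sub>i (l\<^sub>i (l\<^sub>i - 1)) ^ j - (l\<^sub>i (l\<^sub>i + 1)) ^ j\<close>. A pair of opposite exponents contributes \<open>0\<close> to each
  of these sums. By Schur's Pfaffian, \<open>\<delta>\<^sup>-\<^sup>1 Q\<^sub>\<lambda>\<close> is a sum of monomials with the exponents \<open>\<lambda>\<close> times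
  products of functions of disjoint quotients \<open>x\<^sub>i / x\<^sub>j\<close> of the other variables, so it is a common
  eigenfunction. Conversely, the leading exponent of an eigenfunction determines its eigenvalues, the
  cancellation property makes the positive leading exponents distinct, and the eigenvalues determine
  the exponents up to order; hence subtracting a multiple of \<open>Q\<^sub>\<lambda>\<close> that removes the leading
  monomial leaves \<open>0\<close>.
\<close>

section \<open>Derivations of the field of rational functions\<close>

text \<open>Two obstacles shape the proof. First, the intermediate operators do have poles, and
  along x_r = -x_s even their sum may have one after an even number of steps. An induction on
  regularity alone therefore fails: the invariant must record how the poles of components r and s
  match, together with one condition modulo the local equation that controls the poles of the next
  step. Second, the product of \<open>Q_poly lam\<close> with the inverse of \<open>delta\<close> is
  in general not a polynomial, so eigenvalues on monomials cannot be applied to it. They are carried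
  over by Newton's identities: checked on monomials, these hold as identities of differential
  operators on all rational functions and express each conjugated operator through the operators
  \<open>pow_op\<close>. The latter are sums of one-variable operators and can be applied directly.
  Writing D for \<open>euler i\<close>, the change of D into -D exchanges D(D - 1) and D(D + 1);
  this is why two variables that enter only through their quotient cancel in
  \<open>pow_op\<close>.\<close>

instance fract :: ("{idom, ring_char_0}") ring_char_0
proof
  have "of_nat n = to_fract (of_nat n :: 'a)" for n
    by (induction n) auto
  then show "inj (of_nat :: nat \<Rightarrow> 'a fract)"
    by (auto simp: inj_def)
qed

instance fract :: ("{idom, ring_char_0}") field_char_0 ..

lemma to_fract_prod: "to_fract (\<Prod>a\<in>A. f a) = (\<Prod>a\<in>A. to_fract (f a))"
  by (induction A rule: infinite_finite_induct) auto

lemma to_fract_power: "to_fract (p ^ k) = to_fract p ^ k"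
  by (induction k) auto

text \<open>Abstract, because the same rules serve \<open>euler i\<close>, the sums and differences
  of two such operators, and \<open>total_euler\<close>.\<close>

locale derivation =
  fixes d :: "'a::field_char_0 \<Rightarrow> 'a"
  assumes add: "d (x + y) = d x + d y"
    and mult: "d (x * y) = d x * y + x * d y"
begin

lemma zero [simp]: "d 0 = 0"
  using add[of 0 0] by simp

lemma one [simp]: "d 1 = 0"
  using mult[of 1 1] by simp

lemma minus: "d (- x) = - d x"
  using add[of x "- x"] by (simp add: eq_neg_iff_add_eq_0 add.commute)

lemma diff: "d (x - y) = d x - d y"
  using add[of x "- y"] by (simp add: minus)

lemma sum: "d (\<Sum>a\<in>A. f a) = (\<Sum>a\<in>A. d (f a))"
  by (induction A rule: infinite_finite_induct) (simp_all add: add)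

lemma of_nat [simp]: "d (of_nat n) = 0"
  by (induction n) (simp_all add: add)

lemma numeral [simp]: "d (numeral n) = 0"
  using of_nat[of "numeral n"] by simp

lemma divide:
  assumes "y \<noteq> 0"
  shows "d (x / y) = (d x * y - x * d y) / y\<^sup>2"
proof -
  have "d x = d (x / y) * y + x / y * d y"
    using mult[of "x / y" y] assms by simp
  then have "d x * y - x * d y = d (x / y) * y\<^sup>2"
    using assms by (simp add: field_simps power2_eq_square)
  then show ?thesis
    using assms by simp
qed

end

lemma lookup_single_mult:
  fixes p :: "'n::linorder mpoly"
  shows "Poly_Mapping.lookup (Poly_Mapping.single m c * p) (m + k) = c * Poly_Mapping.lookup p k"
proof -
  have "Poly_Mapping.single m c * p =
      (\<Sum>l\<in>Poly_Mapping.keys p. Poly_Mapping.single (m + l) (c * Poly_Mapping.lookup p l))"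
    by (subst mpoly_sum_monomials[of p]) (simp add: sum_distrib_left mult_single)
  then show ?thesis
    by (auto simp: lookup_sum lookup_single when_def in_keys_iff)
qed

text \<open>Unlike \<open>partial_mpoly\<close> this operator is diagonal on monomials.\<close>

definition euler_mpoly :: "'n \<Rightarrow> 'n mpoly \<Rightarrow> 'n mpoly"
  where "euler_mpoly i p = Var i * partial_mpoly i p"

lemma euler_mpoly_single:
  "euler_mpoly i (Poly_Mapping.single m c) =
    Poly_Mapping.single m (of_nat (Poly_Mapping.lookup m i) * c)"
proof (cases "Poly_Mapping.lookup m i = 0")
  case False
  then have "Poly_Mapping.single i 1 + (m - Poly_Mapping.single i 1) = m"
    by (intro poly_mapping_eqI) (auto simp: lookup_add lookup_minus lookup_single when_def)
  then show ?thesis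
    by (simp add: euler_mpoly_def Var_def partial_mpoly_single mult_single)
qed (simp add: euler_mpoly_def Var_def partial_mpoly_single)

lemma euler_mpoly_add: "euler_mpoly i (p + q) = euler_mpoly i p + euler_mpoly i q"
  by (simp add: euler_mpoly_def partial_mpoly_add distrib_left)

lemma euler_mpoly_sum: "euler_mpoly i (sum f A) = (\<Sum>a\<in>A. euler_mpoly i (f a))"
  by (simp add: euler_mpoly_def partial_mpoly_sum sum_distrib_left)

lemma lookup_euler_mpoly:
  "Poly_Mapping.lookup (euler_mpoly i p) m =
    of_nat (Poly_Mapping.lookup m i) * Poly_Mapping.lookup p m"
proof -
  have "euler_mpoly i p = (\<Sum>k\<in>Poly_Mapping.keys p.
      Poly_Mapping.single k (of_nat (Poly_Mapping.lookup k i) * Poly_Mapping.lookup p k))"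
    by (subst mpoly_sum_monomials[of p]) (simp add: euler_mpoly_sum euler_mpoly_single)
  then show ?thesis
    by (auto simp: lookup_sum lookup_single when_def in_keys_iff)
qed

lemma euler_to_fract: "euler i (to_fract p) = to_fract (euler_mpoly i p)"
  by (simp add: euler_def X_def partial_to_fract euler_mpoly_def)

lemma fract_cases:
  fixes f :: "'a::idom fract"
  obtains a b where "b \<noteq> 0" "f = to_fract a / to_fract b"
  by (cases f) (auto simp: Fract_conv_to_fract)

lemma euler_quotient:
  assumes "b \<noteq> 0"
  shows "euler i (to_fract a / to_fract b) =
    to_fract (euler_mpoly i a * b - a * euler_mpoly i b) / to_fract (b * b)"
proof -
  have "euler i (to_fract a / to_fract b) =
      X i * (to_fract (partial_mpoly i a * b - a * partial_mpoly i b) / to_fract (b * b))"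
    unfolding euler_def using partial_Fract[OF assms, of i a] by (simp add: Fract_conv_to_fract)
  also have "\<dots> = to_fract (Var i * (partial_mpoly i a * b - a * partial_mpoly i b)) / to_fract (b * b)"
    by (simp add: X_def)
  also have "Var i * (partial_mpoly i a * b - a * partial_mpoly i b) =
      euler_mpoly i a * b - a * euler_mpoly i b"
    by (simp add: euler_mpoly_def algebra_simps)
  finally show ?thesis .
qed

lemma euler_mpoly_mult: "euler_mpoly i (p * q) = euler_mpoly i p * q + p * euler_mpoly i q"
  by (simp add: euler_mpoly_def partial_mpoly_mult algebra_simps)

interpretation euler: derivation "euler i :: 'n::linorder ratfun \<Rightarrow> 'n ratfun" for i
proof
  fix x y :: "'n ratfun"
  obtain a b where x: "b \<noteq> 0" "x = to_fract a / to_fract b"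
    by (rule fract_cases)
  obtain c e where y: "e \<noteq> 0" "y = to_fract c / to_fract e"
    by (rule fract_cases)
  have s: "x + y = to_fract (a * e + c * b) / to_fract (b * e)"
    using x y by (simp add: field_simps)
  have p: "x * y = to_fract (a * c) / to_fract (b * e)"
    using x y by (simp add: field_simps)
  have be: "b * e \<noteq> 0" "to_fract b \<noteq> 0" "to_fract e \<noteq> 0"
    using x y by simp_all
  show "euler i (x + y) = euler i x + euler i y"
    unfolding s euler_quotient[OF be(1)] unfolding x(2) y(2) euler_quotient[OF x(1)] euler_quotient[OF y(1)]
    using be by (simp add: euler_mpoly_mult euler_mpoly_add field_simps)
  show "euler i (x * y) = euler i x * y + x * euler i y"
    unfolding p euler_quotient[OF be(1)] unfolding x(2) y(2) euler_quotient[OF x(1)] euler_quotient[OF y(1)]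
    using be by (simp add: euler_mpoly_mult euler_mpoly_add field_simps)
qed

text \<open>The quotient rule extends the agreement from polynomials to their fractions.\<close>

lemma derivation_eqI:
  fixes d e :: "'n::linorder ratfun \<Rightarrow> 'n ratfun"
  assumes "derivation d" "derivation e" "\<And>p. d (to_fract p) = e (to_fract p)"
  shows "d f = e f"
proof (cases f rule: fract_cases)
  case (1 a b)
  interpret d: derivation d by fact
  interpret e: derivation e by fact
  show ?thesis
    using 1 by (simp add: d.divide e.divide assms(3))
qed

text \<open>The commutator of two derivations is a derivation.\<close>

lemma euler_commute: "euler i (euler j f) = euler j (euler i f)"
proof -
  have "euler i (euler j f) - euler j (euler i f) = 0"
  proof (rule derivation_eqI[where d = "\<lambda>f. euler i (euler j f) - euler j (euler i f)" and e = "\<lambda>f. 0"])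
    show "derivation (\<lambda>f. euler i (euler j f) - euler j (euler i f))"
      by unfold_locales (simp_all add: euler.add euler.mult algebra_simps)
    show "derivation (\<lambda>f :: 'a ratfun. 0)"
      by unfold_locales simp_all
    show "euler i (euler j (to_fract p)) - euler j (euler i (to_fract p)) = 0" for p
      by (simp add: euler_to_fract flip: to_fract_diff)
        (rule poly_mapping_eqI, simp add: lookup_euler_mpoly)
  qed
  then show ?thesis by simp
qed

definition scalar :: "complex \<Rightarrow> 'n::linorder ratfun"
  where "scalar c = to_fract (Const c)"

lemma Const_add: "Const (a + b) = Const a + Const b"
  by (simp add: Const_def single_add)

lemma Const_mult: "Const (a * b) = (Const a * Const b :: 'n::linorder mpoly)"
  by (simp add: Const_def mult_single)

lemma Const_0 [simp]: "Const 0 = 0" and Const_1 [simp]: "Const 1 = 1"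
  by (simp_all add: Const_def)

lemma scalar_add: "scalar (a + b) = scalar a + scalar b"
  by (simp add: scalar_def Const_add)

lemma scalar_mult: "scalar (a * b) = scalar a * scalar b"
  by (simp add: scalar_def Const_mult)

lemma scalar_0 [simp]: "scalar 0 = 0" and scalar_1 [simp]: "scalar 1 = 1"
  by (simp_all add: scalar_def)

lemma scalar_minus: "scalar (- a) = - scalar a"
  using scalar_add[of a "- a"] by (simp add: eq_neg_iff_add_eq_0 add.commute)

lemma scalar_diff: "scalar (a - b) = scalar a - scalar b"
  using scalar_add[of a "- b"] by (simp add: scalar_minus)

lemma scalar_of_nat [simp]: "scalar (of_nat n) = of_nat n"
  by (induction n) (simp_all add: scalar_add)

lemma scalar_numeral [simp]: "scalar (numeral n) = numeral n"
  using scalar_of_nat[of "numeral n"] by simp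

lemma scalar_sum: "scalar (\<Sum>a\<in>A. f a) = (\<Sum>a\<in>A. scalar (f a))"
  by (induction A rule: infinite_finite_induct) (simp_all add: scalar_add)

lemma scalar_power: "scalar (c ^ k) = scalar c ^ k"
  by (induction k) (simp_all add: scalar_mult)

lemma scalar_eq_iff [simp]: "scalar a = scalar b \<longleftrightarrow> a = b"
  by (simp add: scalar_def Const_def) (metis lookup_single_eq)

lemma euler_scalar [simp]: "euler i (scalar c) = 0"
  by (simp add: scalar_def euler_to_fract Const_def euler_mpoly_single)

lemma euler_scalar_mult: "euler i (scalar c * f) = scalar c * euler i f"
  by (simp add: euler.mult)

definition Mon :: "('n::linorder \<Rightarrow>\<^sub>0 nat) \<Rightarrow> 'n ratfun"
  where "Mon m = to_fract (Poly_Mapping.single m 1)"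

lemma Mon_nonzero [simp]: "Mon m \<noteq> 0"
  by (simp add: Mon_def) (metis lookup_single_eq lookup_zero zero_neq_one)

lemma Mon_0 [simp]: "Mon 0 = 1"
  by (simp add: Mon_def)

lemma Mon_add: "Mon (m + k) = Mon m * Mon k"
  by (simp add: Mon_def mult_single flip: to_fract_mult)

lemma Mon_single: "Mon (Poly_Mapping.single i k) = X i ^ k"
proof (induction k)
  case (Suc k)
  have "Mon (Poly_Mapping.single i (Suc k)) = Mon (Poly_Mapping.single i 1 + Poly_Mapping.single i k)"
    by (simp flip: single_add)
  also have "\<dots> = X i ^ Suc k"
    unfolding Mon_add Suc by (simp add: Mon_def X_def Var_def)
  finally show ?case .
qed simp

lemma Mon_sum: "Mon (\<Sum>a\<in>A. f a) = (\<Prod>a\<in>A. Mon (f a))"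
  by (induction A rule: infinite_finite_induct) (simp_all add: Mon_add)

lemma euler_Mon: "euler i (Mon m) = of_nat (Poly_Mapping.lookup m i) * Mon m"
proof -
  have "euler i (Mon m) = scalar (of_nat (Poly_Mapping.lookup m i)) * Mon m"
    unfolding scalar_def Mon_def to_fract_mult[symmetric]
    by (simp add: euler_to_fract euler_mpoly_single Const_def mult_single del: single_of_nat)
  then show ?thesis
    by simp
qed

lemma euler_Mon_mult:
  "euler i (Mon m * f) = Mon m * (euler i f + of_nat (Poly_Mapping.lookup m i) * f)"
  by (simp add: euler.mult euler_Mon algebra_simps)

lemma to_fract_sum_Mon:
  "to_fract p = (\<Sum>m\<in>Poly_Mapping.keys p. scalar (Poly_Mapping.lookup p m) * Mon m)"
  by (subst mpoly_sum_monomials[of p])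
    (simp add: scalar_def Mon_def Const_def mult_single flip: to_fract_mult)

lemma euler_X: "euler i (X j) = (if i = j then X j else 0)"
  using euler_Mon[of i "Poly_Mapping.single j 1"] Mon_single[of j 1]
  by (auto simp: lookup_single when_def)

lemma X_nonzero [simp]: "X i \<noteq> 0"
  by (metis Mon_nonzero Mon_single power_one_right)

lemma lookup_Var: "Poly_Mapping.lookup (Var i) m = (if m = Poly_Mapping.single i 1 then 1 else 0)"
  by (auto simp: Var_def lookup_single when_def)

lemma single_exponent_eq_iff:
  "(Poly_Mapping.single i (Suc 0) = Poly_Mapping.single j (Suc 0)) \<longleftrightarrow> i = j"
  by (metis lookup_single_eq lookup_single_not_eq Zero_not_Suc)

lemma X_add_nonzero [simp]: "X i + X j \<noteq> 0"
proof
  assume "X i + X j = (0 :: 'a ratfun)"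
  then have "Var i + Var j = (0 :: 'a mpoly)"
    by (simp add: X_def flip: to_fract_add)
  from arg_cong[OF this, of "\<lambda>p. Poly_Mapping.lookup p (Poly_Mapping.single i 1)"]
  show False by (auto simp: lookup_add lookup_Var split: if_splits)
qed

lemma X_eq_iff [simp]: "X i = X j \<longleftrightarrow> i = j"
proof
  assume "X i = (X j :: 'a ratfun)"
  then have "Var i = (Var j :: 'a mpoly)"
    by (simp add: X_def)
  from arg_cong[OF this, of "\<lambda>p. Poly_Mapping.lookup p (Poly_Mapping.single i 1)"]
  show "i = j" by (auto simp: lookup_Var single_exponent_eq_iff split: if_splits)
qed simp

lemma X_square_eq_iff [simp]: "(X i)\<^sup>2 = (X j)\<^sup>2 \<longleftrightarrow> i = j"
  by (metis X_add_nonzero X_eq_iff power2_eq_iff add.right_inverse)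

section \<open>Conjugation by \<open>delta\<close>\<close>

text \<open>In terms of u = log x_i - log x_j, \<open>coef_a i j\<close> is 1 / sinh u and
  \<open>coef_b i j\<close> is 1 + coth u.\<close>

definition coef_a :: "'n::linorder \<Rightarrow> 'n \<Rightarrow> 'n ratfun"
  where "coef_a i j = 2 * X i * X j / ((X i)\<^sup>2 - (X j)\<^sup>2)"

definition coef_b :: "'n::linorder \<Rightarrow> 'n \<Rightarrow> 'n ratfun"
  where "coef_b i j = 2 * (X i)\<^sup>2 / ((X i)\<^sup>2 - (X j)\<^sup>2)"

definition step_a ::
  "('n \<Rightarrow> 'n ratfun \<Rightarrow> 'n ratfun) \<Rightarrow> ('n \<Rightarrow> 'n ratfun) \<Rightarrow> 'n \<Rightarrow> 'n::{finite,linorder} ratfun"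
  where "step_a e u i = e i (u i) - (\<Sum>j\<in>UNIV - {i}. coef_a i j * u j)"

definition step_b ::
  "('n \<Rightarrow> 'n ratfun \<Rightarrow> 'n ratfun) \<Rightarrow> ('n \<Rightarrow> 'n ratfun) \<Rightarrow> 'n \<Rightarrow> 'n::{finite,linorder} ratfun"
  where "step_b e u i = e i (u i) - u i - (\<Sum>j\<in>UNIV - {i}. coef_b i j * u j)"

text \<open>
  With \<open>e = euler\<close> this is the recursion for \<open>dop\<close> conjugated by \<open>delta\<close>; with \<open>e i = euler i + m\<^sub>i\<close>
  it is conjugated by the monomial \<open>x\<^sup>m\<close> as well.
\<close>

primrec chain ::
  "('n \<Rightarrow> 'n ratfun \<Rightarrow> 'n ratfun) \<Rightarrow> nat \<Rightarrow> 'n ratfun \<Rightarrow> 'n \<Rightarrow> 'n::{finite,linorder} ratfun" where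
  "chain e 0 f = (\<lambda>i. f)"
| "chain e (Suc k) f = (if even k then step_a else step_b) e (chain e k f)"

definition conj_Omega :: "nat \<Rightarrow> 'n ratfun \<Rightarrow> 'n::{finite,linorder} ratfun"
  where "conj_Omega k f = (\<Sum>i\<in>UNIV. chain euler k f i)"

lemma (in derivation) prod:
  assumes "finite A" "\<And>a. a \<in> A \<Longrightarrow> f a \<noteq> 0"
  shows "d (\<Prod>a\<in>A. f a) = (\<Sum>a\<in>A. d (f a) / f a) * (\<Prod>a\<in>A. f a)"
  using assms
proof (induction A rule: finite_induct)
  case (insert x F)
  have "d (\<Prod>a\<in>insert x F. f a) = d (f x) * (\<Prod>a\<in>F. f a) + f x * ((\<Sum>a\<in>F. d (f a) / f a) * (\<Prod>a\<in>F. f a))"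
    using insert by (simp add: mult)
  also have "\<dots> = (d (f x) / f x + (\<Sum>a\<in>F. d (f a) / f a)) * (f x * (\<Prod>a\<in>F. f a))"
    using insert.prems[of x] by (simp add: field_simps)
  finally show ?case
    using insert by simp
qed simp

lemma (in derivation) log_quotient:
  assumes "x + y \<noteq> 0" "x - y \<noteq> 0"
  shows "d ((x + y) / (x - y)) / ((x + y) / (x - y)) = 2 * (x * d y - y * d x) / (x\<^sup>2 - y\<^sup>2)"
proof -
  have "d ((x + y) / (x - y)) = 2 * (x * d y - y * d x) / (x - y)\<^sup>2"
    using assms by (simp add: divide add diff algebra_simps)
  moreover have "x\<^sup>2 - y\<^sup>2 = (x + y) * (x - y)"
    by (simp add: algebra_simps power2_eq_square)
  ultimately show ?thesis
    using assms by (simp add: power2_eq_square)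
qed

lemma euler_delta_factor:
  assumes "a \<noteq> b"
  shows "euler i ((X a + X b) / (X a - X b)) / ((X a + X b) / (X a - X b)) =
    - (if i = a then coef_a a b else if i = b then coef_a b a else 0)"
proof -
  have m: "2 * X b * X a / ((X b)\<^sup>2 - (X a)\<^sup>2) = - (2 * X a * X b / ((X a)\<^sup>2 - (X b)\<^sup>2))"
    by (metis (no_types, opaque_lifting) minus_diff_eq minus_divide_right mult.assoc mult.commute)
  show ?thesis
    by (subst euler.log_quotient) (use assms m in \<open>auto simp: euler_X coef_a_def\<close>)
qed

lemma delta_nonzero [simp]: "delta \<noteq> 0"
  unfolding delta_def by (auto simp: case_prod_beta)

text \<open>Logarithmic derivative: a factor of \<open>delta\<close> containing x_i and x_j
  contributes \<open>- coef_a i j\<close> in either order of i and j. The sum is the diagonal part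
  of both recursions for \<open>dop\<close>, which conjugation therefore removes.\<close>

lemma euler_delta:
  "euler i (delta :: 'n::{finite,linorder} ratfun) = - (\<Sum>j\<in>UNIV - {i}. coef_a i j) * delta"
proof -
  let ?P = "{(a, b). a < (b::'n)}"
  let ?g = "\<lambda>(a, b). - (if i = a then coef_a a b else if i = b then coef_a b a else 0)"
  have "euler i delta = (\<Sum>p\<in>?P. euler i (case p of (a, b) \<Rightarrow> (X a + X b) / (X a - X b)) /
      (case p of (a, b) \<Rightarrow> (X a + X b) / (X a - X b))) * delta"
    unfolding delta_def by (rule euler.prod) auto
  also have "(\<Sum>p\<in>?P. euler i (case p of (a, b) \<Rightarrow> (X a + X b) / (X a - X b)) /
      (case p of (a, b) \<Rightarrow> (X a + X b) / (X a - X b))) = (\<Sum>p\<in>?P. ?g p)"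
  proof (rule sum.cong[OF refl], clarify)
    fix a b :: 'n
    assume "a < b"
    then have "a \<noteq> b" by simp
    then show "euler i ((X a + X b) / (X a - X b)) / ((X a + X b) / (X a - X b)) =
        - (if i = a then coef_a a b else if i = b then coef_a b a else 0)"
      by (rule euler_delta_factor)
  qed
  \<comment> \<open>The factors that depend on x_i are indexed by the other member j of the ordered
    pair.\<close>
  also have "\<dots> = (\<Sum>p\<in>(\<lambda>j. (min i j, max i j)) ` (UNIV - {i}). ?g p)"
  proof (rule sum.mono_neutral_right)
    show "(\<lambda>j. (min i j, max i j)) ` (UNIV - {i}) \<subseteq> ?P"
      by (auto simp: min_def max_def)
    have "(a, b) \<in> (\<lambda>j. (min i j, max i j)) ` (UNIV - {i})" if "a < b" "i = a \<or> i = b" for a b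
      using that by (auto simp: image_iff min_def max_def not_le intro: bexI[of _ a] bexI[of _ b])
    then show "\<forall>p\<in>?P - (\<lambda>j. (min i j, max i j)) ` (UNIV - {i}). ?g p = 0"
      by fastforce
  qed simp
  also have "\<dots> = (\<Sum>j\<in>UNIV - {i}. ?g (min i j, max i j))"
    by (subst sum.reindex) (auto simp: inj_on_def min_def max_def split: if_splits)
  also have "\<dots> = (\<Sum>j\<in>UNIV - {i}. - coef_a i j)"
    by (rule sum.cong) (auto simp: min_def max_def)
  finally show ?thesis
    by (simp add: sum_negf)
qed

text \<open>The diagonal terms cancel against the derivative of \<open>delta\<close>. The first
  operator fits the pattern because the odd step applied to a constant vector has vanishing
  differences.\<close>

lemma dop_conj_delta: "dop (Suc k) i (delta * f) = delta * chain euler (Suc k) f i"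
proof (induction k arbitrary: i)
  case 0
  then show ?case
    by (simp add: step_a_def euler.mult euler_delta algebra_simps sum_distrib_left)
next
  case (Suc k)
  let ?c = "chain euler (Suc k) f"
  have e: "euler i (delta * ?c i) = delta * euler i (?c i) - delta * (\<Sum>j\<in>UNIV - {i}. coef_a i j * ?c i)"
    by (simp add: euler.mult euler_delta algebra_simps sum_distrib_left)
  have dop: "dop (Suc (Suc k)) i (delta * f) =
    (if odd (Suc (Suc k)) then
       euler i (delta * ?c i) + (\<Sum>j\<in>UNIV - {i}. coef_a i j * (delta * ?c i - delta * ?c j))
     else
       euler i (delta * ?c i) - delta * ?c i +
       (\<Sum>j\<in>UNIV - {i}. coef_a i j * (delta * ?c i) - coef_b i j * (delta * ?c j)))"
    by (simp only: dop.simps Suc.IH coef_a_def coef_b_def)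
  show ?case
  proof (cases "even (Suc k)")
    case True
    have s: "(\<Sum>j\<in>UNIV - {i}. coef_a i j * (delta * ?c i - delta * ?c j)) =
      delta * (\<Sum>j\<in>UNIV - {i}. coef_a i j * ?c i) - delta * (\<Sum>j\<in>UNIV - {i}. coef_a i j * ?c j)"
      by (simp add: sum_distrib_left sum_subtractf algebra_simps)
    have c: "chain euler (Suc (Suc k)) f i = step_a euler ?c i"
      using True by (simp del: chain.simps(2) add: chain.simps(2)[of _ "Suc k"])
    show ?thesis
      unfolding dop e s c step_a_def using True by (simp add: algebra_simps del: chain.simps)
  next
    case False
    have s: "(\<Sum>j\<in>UNIV - {i}. coef_a i j * (delta * ?c i) - coef_b i j * (delta * ?c j)) =
      delta * (\<Sum>j\<in>UNIV - {i}. coef_a i j * ?c i) - delta * (\<Sum>j\<in>UNIV - {i}. coef_b i j * ?c j)"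
      by (simp add: sum_distrib_left sum_subtractf algebra_simps)
    have c: "chain euler (Suc (Suc k)) f i = step_b euler ?c i"
      using False by (simp del: chain.simps(2) add: chain.simps(2)[of _ "Suc k"])
    show ?thesis
      unfolding dop e s c step_b_def using False by (simp add: algebra_simps del: chain.simps)
  qed
qed

lemma Omega_conj_delta:
  assumes "odd k"
  shows "Omega k (delta * f) = delta * conj_Omega k f"
proof -
  obtain l where "k = Suc l"
    using assms by (cases k) auto
  then show ?thesis
    by (simp only: Omega_def conj_Omega_def dop_conj_delta sum_distrib_left)
qed

lemma chain_euler_Mon:
  "chain euler k (Mon m * f) =
    (\<lambda>i. Mon m * chain (\<lambda>i f. euler i f + of_nat (Poly_Mapping.lookup m i) * f) k f i)"
proof (induction k)
  case (Suc k)
  let ?e = "\<lambda>i f. euler i f + of_nat (Poly_Mapping.lookup m i) * f"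
  have s: "(\<Sum>j\<in>J. c j * (Mon m * u j)) = Mon m * (\<Sum>j\<in>J. c j * u j)" for J :: "'a set" and c u
    unfolding sum_distrib_left by (rule sum.cong) (auto simp: mult.left_commute)
  have a: "step_a euler (\<lambda>i. Mon m * u i) = (\<lambda>i. Mon m * step_a ?e u i)" for u
    by (rule ext) (simp only: step_a_def euler_Mon_mult s right_diff_distrib)
  have b: "step_b euler (\<lambda>i. Mon m * u i) = (\<lambda>i. Mon m * step_b ?e u i)" for u
    by (rule ext) (simp only: step_b_def euler_Mon_mult s right_diff_distrib)
  show ?case
  proof (cases "even k")
    case True
    show ?thesis
      unfolding chain.simps(2) if_P[OF True] Suc.IH by (rule a)
  next
    case False
    show ?thesis
      unfolding chain.simps(2) if_not_P[OF False] Suc.IH by (rule b)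
  qed
qed simp

section \<open>Differential operators in the sense of Grothendieck\<close>

text \<open>
  The order is defined through iterated commutators with multiplication operators. A differential
  operator is determined by its values on monomials, so identities between operators can be
  verified on monomials.
\<close>

primrec diff_order :: "nat \<Rightarrow> ('n::linorder ratfun \<Rightarrow> 'n ratfun) \<Rightarrow> bool" where
  "diff_order 0 T \<longleftrightarrow> (\<forall>f. T f = 0)"
| "diff_order (Suc k) T \<longleftrightarrow> (\<forall>f g. T (f + g) = T f + T g) \<and>
    (\<forall>b. diff_order k (\<lambda>f. T (b * f) - b * T f))"

text \<open>For f = a / b the commutator with b has lower order and still kills polynomials, so b *
  T f = T a = 0 by induction.\<close>

lemma diff_order_vanish:
  assumes "diff_order k T" "\<And>p. T (to_fract p) = 0"
  shows "T f = 0"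
  using assms
proof (induction k arbitrary: T f)
  case (Suc k)
  obtain a b where f: "b \<noteq> 0" "f = to_fract a / to_fract b"
    by (rule fract_cases)
  have "T (to_fract b * f) - to_fract b * T f = 0"
  proof (rule Suc.IH[of "\<lambda>f. T (to_fract b * f) - to_fract b * T f" f])
    show "diff_order k (\<lambda>f. T (to_fract b * f) - to_fract b * T f)"
      using Suc.prems(1) by simp
    show "T (to_fract b * to_fract p) - to_fract b * T (to_fract p) = 0" for p
      using Suc.prems(2) by (simp flip: to_fract_mult)
  qed
  then show ?case
    using f Suc.prems(2)[of a] by simp
qed simp

lemma diff_order_zero: "diff_order k (\<lambda>f. 0)"
  by (induction k) simp_all

lemma diff_order_additive: "diff_order k T \<Longrightarrow> T (f + g) = T f + T g"
  by (cases k) simp_all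

lemma diff_order_add: "diff_order k T \<Longrightarrow> diff_order k S \<Longrightarrow> diff_order k (\<lambda>f. T f + S f)"
proof (induction k arbitrary: T S)
  case (Suc k)
  have "diff_order k (\<lambda>f. (T (b * f) - b * T f) + (S (b * f) - b * S f))" for b
    using Suc by simp
  moreover have "(\<lambda>f. (T (b * f) - b * T f) + (S (b * f) - b * S f)) =
      (\<lambda>f. (T (b * f) + S (b * f)) - b * (T f + S f))" for b
    by (auto simp: algebra_simps)
  ultimately show ?case
    using Suc.prems by (simp add: algebra_simps)
qed simp

lemma diff_order_mult: "diff_order k T \<Longrightarrow> diff_order k (\<lambda>f. c * T f)"
proof (induction k arbitrary: T)
  case (Suc k)
  have "diff_order k (\<lambda>f. c * (T (b * f) - b * T f))" for b
    using Suc by simp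
  moreover have "(\<lambda>f. c * (T (b * f) - b * T f)) = (\<lambda>f. c * T (b * f) - b * (c * T f))" for b
    by (auto simp: algebra_simps)
  ultimately show ?case
    using Suc.prems by (simp add: algebra_simps)
qed simp

lemma diff_order_Suc: "diff_order k T \<Longrightarrow> diff_order (Suc k) T"
proof (induction k arbitrary: T)
  case (Suc k)
  have "diff_order (Suc k) (\<lambda>f. T (b * f) - b * T f)" for b
    by (rule Suc.IH) (use Suc.prems in simp)
  moreover have "T (f + g) = T f + T g" for f g
    using Suc.prems by simp
  ultimately show ?case
    unfolding diff_order.simps(2)[of "Suc k"] by blast
qed simp

lemma diff_order_mono:
  assumes "diff_order k T" "k \<le> l"
  shows "diff_order l T"
  using assms(2,1) by (induction l rule: dec_induct) (auto intro: diff_order_Suc simp del: diff_order.simps)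

text \<open>The commutator of the composition with b is \<open>euler i\<close> after the commutator
  of T, plus T multiplied by \<open>euler i b\<close>.\<close>

lemma diff_order_euler: "diff_order k T \<Longrightarrow> diff_order (Suc k) (\<lambda>f. euler i (T f))"
proof (induction k arbitrary: T)
  case (Suc k)
  have T: "T (f + g) = T f + T g" for f g
    using diff_order_additive[OF Suc.prems] .
  have "diff_order (Suc k) (\<lambda>f. euler i (T (b * f) - b * T f) + euler i b * T f)" for b
    by (intro diff_order_add Suc.IH diff_order_mult Suc.prems) (use Suc.prems in simp)
  moreover have "(\<lambda>f. euler i (T (b * f) - b * T f) + euler i b * T f) =
      (\<lambda>f. euler i (T (b * f)) - b * euler i (T f))" for b
    by (auto simp: euler.diff euler.mult)
  ultimately show ?case
    unfolding diff_order.simps(2)[of "Suc k"] by (simp only: T euler.add simp_thms)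
qed simp

text \<open>Linearity over the scalars is a separate condition: \<open>diff_order\<close> alone
  would admit derivations that act on the complex coefficients, and these are not determined by
  their values on monomials.\<close>

definition diff_op :: "('n::linorder ratfun \<Rightarrow> 'n ratfun) \<Rightarrow> bool"
  where "diff_op T \<longleftrightarrow> (\<exists>k. diff_order k T) \<and> (\<forall>c f. T (scalar c * f) = scalar c * T f)"

lemma diff_op_id: "diff_op (\<lambda>f. f)"
  unfolding diff_op_def by (auto intro!: exI[of _ "Suc 0"])

lemma diff_op_add:
  assumes "diff_op T" "diff_op S"
  shows "diff_op (\<lambda>f. T f + S f)"
proof -
  obtain k l where "diff_order k T" "diff_order l S"
    using assms unfolding diff_op_def by blast
  then have "diff_order (max k l) (\<lambda>f. T f + S f)"
    by (intro diff_order_add) (auto intro: diff_order_mono)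
  moreover have "T (scalar c * f) + S (scalar c * f) = scalar c * (T f + S f)" for c f
    using assms by (simp add: diff_op_def distrib_left)
  ultimately show ?thesis
    unfolding diff_op_def by blast
qed

lemma diff_op_mult:
  assumes "diff_op T"
  shows "diff_op (\<lambda>f. c * T f)"
proof -
  obtain k where "diff_order k T"
    using assms unfolding diff_op_def by blast
  then have "diff_order k (\<lambda>f. c * T f)"
    by (rule diff_order_mult)
  moreover have "c * T (scalar a * f) = scalar a * (c * T f)" for a f
    using assms by (simp add: diff_op_def mult.left_commute)
  ultimately show ?thesis
    unfolding diff_op_def by blast
qed

lemma diff_op_euler:
  assumes "diff_op T"
  shows "diff_op (\<lambda>f. euler i (T f))"
proof -
  obtain k where "diff_order k T"
    using assms unfolding diff_op_def by blast
  then have "diff_order (Suc k) (\<lambda>f. euler i (T f))"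
    by (rule diff_order_euler)
  moreover have "euler i (T (scalar a * f)) = scalar a * euler i (T f)" for a f
    using assms by (simp add: diff_op_def euler_scalar_mult)
  ultimately show ?thesis
    unfolding diff_op_def by blast
qed

lemma diff_op_zero: "diff_op (\<lambda>f. 0)"
  unfolding diff_op_def using diff_order_zero[of 0] by (auto simp del: diff_order.simps)

lemma diff_op_diff:
  assumes "diff_op T" "diff_op S"
  shows "diff_op (\<lambda>f. T f - S f)"
  using diff_op_add[OF assms(1) diff_op_mult[OF assms(2), of "- 1"]] by simp

lemma diff_op_sum:
  assumes "\<And>a. a \<in> A \<Longrightarrow> diff_op (T a)"
  shows "diff_op (\<lambda>f. \<Sum>a\<in>A. T a f)"
  using assms by (induction A rule: infinite_finite_induct) (simp_all add: diff_op_zero diff_op_add)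

lemmas diff_op_intros = diff_op_id diff_op_zero diff_op_add diff_op_diff diff_op_mult diff_op_euler diff_op_sum

lemma diff_op_chain: "diff_op (\<lambda>f. chain euler k f i)"
  by (induction k arbitrary: i) (auto simp: step_a_def step_b_def intro!: diff_op_intros)

lemma diff_op_conj_Omega: "diff_op (conj_Omega k)"
  unfolding conj_Omega_def[abs_def] by (intro diff_op_intros diff_op_chain)

lemma diff_op_scalar: "diff_op T \<Longrightarrow> T (scalar c * f) = scalar c * T f"
  by (simp add: diff_op_def)

lemma diff_op_plus: "diff_op T \<Longrightarrow> T (f + g) = T f + T g"
  unfolding diff_op_def by (auto intro: diff_order_additive simp del: diff_order.simps)

lemma diff_op_setsum:
  assumes "diff_op T"
  shows "T (\<Sum>a\<in>A. f a) = (\<Sum>a\<in>A. T (f a))"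
proof -
  have "T 0 = 0"
    using diff_op_plus[OF assms, of 0 0] by simp
  then show ?thesis
    by (induction A rule: infinite_finite_induct) (simp_all add: diff_op_plus[OF assms])
qed

text \<open>Scalar linearity leads from monomials to polynomials, and
  \<open>diff_order_vanish\<close> from there to rational functions.\<close>

lemma diff_op_eqI:
  assumes "diff_op T" "diff_op S" "\<And>m. T (Mon m) = S (Mon m)"
  shows "T f = S f"
proof -
  have d: "diff_op (\<lambda>f. T f - S f)"
    by (rule diff_op_diff) fact+
  then obtain k where "diff_order k (\<lambda>f. T f - S f)"
    unfolding diff_op_def by blast
  moreover have "T (to_fract p) - S (to_fract p) = 0" for p
    by (simp add: to_fract_sum_Mon diff_op_setsum[OF assms(1)] diff_op_setsum[OF assms(2)]
        diff_op_scalar[OF assms(1)] diff_op_scalar[OF assms(2)] assms(3))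
  ultimately show ?thesis
    using diff_order_vanish[of k "\<lambda>f. T f - S f" f] by simp
qed

section \<open>Regularity along the divisors \<open>x\<^sub>r = \<plusminus> x\<^sub>s\<close>\<close>

text \<open>
  \<open>t\<close> is a local equation of the divisor, \<open>R\<close> the ring of functions regular along it, and \<open>P\<close>, \<open>M\<close>
  stand for \<open>euler r + euler s\<close> and \<open>euler r - euler s\<close>.
\<close>

locale divisor =
  P: derivation P + M: derivation M for P M :: "'a::field_char_0 \<Rightarrow> 'a" +
  fixes R :: "'a set" and t :: 'a
  assumes R_one: "1 \<in> R"
    and R_half: "1 / 2 \<in> R"
    and R_add: "x \<in> R \<Longrightarrow> y \<in> R \<Longrightarrow> x + y \<in> R"
    and R_mult: "x \<in> R \<Longrightarrow> y \<in> R \<Longrightarrow> x * y \<in> R"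
    and R_minus: "x \<in> R \<Longrightarrow> - x \<in> R"
    and P_R: "x \<in> R \<Longrightarrow> P x \<in> R"
    and M_R: "x \<in> R \<Longrightarrow> M x \<in> R"
    and PM: "P (M x) = M (P x)"
    and t_R: "t \<in> R"
    and t_nz: "t \<noteq> 0"
    and P_t: "P t = 0"
    and M_t: "M t = 1 - t\<^sup>2"
begin

lemma R_diff: "x \<in> R \<Longrightarrow> y \<in> R \<Longrightarrow> x - y \<in> R"
  using R_add[OF _ R_minus] by simp

lemma R_zero: "0 \<in> R"
  using R_diff[OF R_one R_one] by simp

lemma R_sum: "(\<And>a. a \<in> A \<Longrightarrow> f a \<in> R) \<Longrightarrow> sum f A \<in> R"
  by (induction A rule: infinite_finite_induct) (simp_all add: R_zero R_add)

lemma R_divide2: "x \<in> R \<Longrightarrow> x / 2 \<in> R"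
  using R_mult[OF _ R_half] by simp

lemma R_power2: "x \<in> R \<Longrightarrow> x\<^sup>2 \<in> R"
  by (simp add: power2_eq_square R_mult)

lemma R_two: "2 \<in> R"
  using R_add[OF R_one R_one] by simp

lemmas R_intros = R_one R_zero R_two R_half R_add R_mult R_minus R_diff R_divide2 R_power2 P_R M_R t_R

definition I :: "'a set"
  where "I = {t * g | g. g \<in> R}"

lemma I_obtain:
  assumes "x \<in> I"
  obtains g where "g \<in> R" "x = t * g"
  using assms by (auto simp: I_def)

lemma I_I: "g \<in> R \<Longrightarrow> x = t * g \<Longrightarrow> x \<in> I"
  by (auto simp: I_def)

lemma I_zero: "0 \<in> I"
  using I_I[OF R_zero] by simp

lemma I_add: "x \<in> I \<Longrightarrow> y \<in> I \<Longrightarrow> x + y \<in> I"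
  by (metis I_I I_obtain R_add distrib_left)

lemma I_mult: "x \<in> I \<Longrightarrow> y \<in> R \<Longrightarrow> x * y \<in> I"
  by (metis I_I I_obtain R_mult mult.assoc)

lemma I_sum: "(\<And>a. a \<in> A \<Longrightarrow> f a \<in> I) \<Longrightarrow> sum f A \<in> I"
  by (induction A rule: infinite_finite_induct) (simp_all add: I_zero I_add)

lemma P_div_t: "P (x / t) = P x / t"
  by (simp add: P.divide t_nz P_t power2_eq_square)

lemma M_div_t: "M (x / t) = M x / t - x * (1 - t\<^sup>2) / t\<^sup>2"
  using t_nz by (simp add: M.divide M_t power2_eq_square diff_divide_distrib)

lemma P_mult_t: "P (t * x) = t * P x"
  by (simp add: P.mult P_t)

lemma M_mult_t: "M (t * x) = (1 - t\<^sup>2) * x + t * M x"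
  by (simp add: M.mult M_t)

text \<open>Used along x_r = x_s, where y and z have opposite simple poles. Differentiation makes
  them double, and the terms 1 / (2 * t) of \<alpha> and \<beta> cancel the double poles in the sum.
  The simple pole left there has residue proportional to \<open>M (t * (y - z))\<close>, which
  vanishes on the divisor. The parameters k and c let one computation cover both kinds of
  steps.\<close>

lemma step_equal:
  fixes y z \<alpha> \<beta> \<rho> \<rho>' k c Y Z
  assumes S: "y + z \<in> R" and D: "t * (y - z) \<in> R" and MD: "M (t * (y - z)) \<in> I"
    and \<alpha>: "\<alpha> = 1 / (2 * t) + \<rho>" and \<beta>: "\<beta> = - 1 / (2 * t) + \<rho>'"
    and \<rho>: "\<rho> - \<rho>' \<in> I" "\<rho> + \<rho>' = of_nat c"
    and YZ: "Y + Z \<in> R" "Y - Z \<in> I"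
    and y': "y' = (P y + M y) / 2 - of_nat k * y - \<alpha> * z - Y"
    and z': "z' = (P z - M z) / 2 - of_nat k * z - \<beta> * y - Z"
  shows "y' + z' \<in> R" "t * (y' - z') \<in> R" "M (t * (y' - z')) \<in> I"
proof -
  define s d where "s = y + z" and "d = t * (y - z)"
  have y: "y = (s + d / t) / 2" and z: "z = (s - d / t) / 2"
    using t_nz by (simp_all add: s_def d_def)
  have sd: "s \<in> R" "d \<in> R"
    using S D by (simp_all add: s_def d_def)
  have nat_R: "of_nat n \<in> R" for n
    by (induction n) (simp_all add: R_zero R_add R_one)
  obtain g1 where g1: "g1 \<in> R" "M d = t * g1"
    using MD I_obtain unfolding d_def by blast
  obtain g2 where g2: "g2 \<in> R" "\<rho> - \<rho>' = t * g2"
    using \<rho>(1) I_obtain by blast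
  obtain g3 where g3: "g3 \<in> R" "Y - Z = t * g3"
    using YZ(2) I_obtain by blast
  have r: "\<rho> = (of_nat c + t * g2) / 2" "\<rho>' = (of_nat c - t * g2) / 2"
    using g2(2) \<rho>(2) by (simp_all add: field_simps)
  have half: "P (x / 2) = P x / 2" "M (x / 2) = M x / 2" for x
    by (simp_all add: P.divide M.divide power2_eq_square)
  have Py: "P y = (P s + P d / t) / 2" "P z = (P s - P d / t) / 2"
    unfolding y z half P.add P.diff P_div_t by simp_all
  have My: "M y = (M s + (g1 - d * (1 - t\<^sup>2) / t\<^sup>2)) / 2" "M z = (M s - (g1 - d * (1 - t\<^sup>2) / t\<^sup>2)) / 2"
    unfolding y z half M.add M.diff M_div_t g1(2) using t_nz by simp_all
  have s': "y' + z' = P s / 2 + g1 / 2 + d / 2 - of_nat k * s - of_nat c * s / 2 + g2 * d / 2 - (Y + Z)"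
    unfolding y' z' unfolding Py My unfolding \<alpha> \<beta> r y z using t_nz
    by (simp add: field_simps power2_eq_square)
  show "y' + z' \<in> R"
    unfolding s' by (intro R_intros sd g1 g2 nat_R YZ)
  have D': "y' - z' = (M s + P d / t) / 2 - of_nat k * d / t - s / (2 * t) - t * g2 * s / 2 + of_nat c * d / (2 * t) - (Y - Z)"
    unfolding y' z' unfolding Py My unfolding \<alpha> \<beta> r y z using t_nz
    by (simp add: field_simps power2_eq_square)
  have d': "t * (y' - z') = (t * M s) / 2 + P d / 2 - of_nat k * d - s / 2 - t * (t * (g2 * s)) / 2 + of_nat c * d / 2 - t * (t * g3)"
    unfolding D' g3(2) using t_nz by (simp add: field_simps power2_eq_square)
  show "t * (y' - z') \<in> R"
    unfolding d' by (intro R_intros sd g1 g2 g3 nat_R YZ)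
  \<comment> \<open>On the divisor the derivative of - s / 2 cancels that of (t * M s) / 2. Moreover
    M (P d) = P (M d) stays divisible by t because P kills t.\<close>
  have "M (t * (y' - z')) = t * (- t * M s / 2 + M (M s) / 2 + P g1 / 2 - of_nat k * g1 -
      (1 - t\<^sup>2) * (g2 * s) - t * M (g2 * s) / 2 + of_nat c * g1 / 2 - 2 * (1 - t\<^sup>2) * g3 - t * M g3)"
    unfolding d'
    by (simp only: half M.add M.diff M_mult_t M.mult[of "of_nat _"] M.of_nat PM[symmetric] g1(2) P_mult_t)
      (simp add: field_simps power2_eq_square)
  then show "M (t * (y' - z')) \<in> I"
    by (rule I_I[rotated]) (intro R_intros sd g1 g2 g3 nat_R YZ)
qed

text \<open>Used along x_r = -x_s. With s = t * (y + z) and d = y - z, the polar part of y' + z' is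
  (P s - d) / (2 * t), which \<open>SD\<close> makes regular; in y' - z' the double poles cancel
  identically. Sum and difference thus exchange roles, and the congruence reappears in the exchanged
  form.\<close>

lemma step_opposite_a:
  fixes y z \<alpha> Y Z
  assumes S: "t * (y + z) \<in> R" and D: "y - z \<in> R" and SD: "(y - z) - P (t * (y + z)) \<in> I"
    and \<alpha>: "\<alpha> = (t\<^sup>2 - 1) / (2 * t)"
    and YZ: "Y + Z \<in> I" "Y - Z \<in> R"
    and y': "y' = (P y + M y) / 2 - \<alpha> * z - Y"
    and z': "z' = (P z - M z) / 2 + \<alpha> * y - Z"
  shows "y' + z' \<in> R" "t * (y' - z') \<in> R" "(y' + z') - P (t * (y' - z')) \<in> I"
proof -
  define s d where "s = t * (y + z)" and "d = y - z"
  have y: "y = (s / t + d) / 2" and z: "z = (s / t - d) / 2"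
    using t_nz by (simp_all add: s_def d_def)
  have sd: "s \<in> R" "d \<in> R"
    using S D by (simp_all add: s_def d_def)
  obtain g where g: "g \<in> R" "d - P s = t * g"
    using SD I_obtain unfolding s_def d_def by blast
  obtain h where h: "h \<in> R" "Y + Z = t * h"
    using YZ(1) I_obtain by blast
  have half: "P (x / 2) = P x / 2" "M (x / 2) = M x / 2" for x
    by (simp_all add: P.divide M.divide power2_eq_square)
  have Ps: "P s = d - t * g"
    using g(2) by (simp add: algebra_simps)
  have Py: "P y = ((d - t * g) / t + P d) / 2" "P z = ((d - t * g) / t - P d) / 2"
    unfolding y z half P.add P.diff P_div_t Ps by simp_all
  have My: "M y = (M s / t - s * (1 - t\<^sup>2) / t\<^sup>2 + M d) / 2" "M z = (M s / t - s * (1 - t\<^sup>2) / t\<^sup>2 - M d) / 2"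
    unfolding y z half M.add M.diff M_div_t by simp_all
  have s': "y' + z' = - g / 2 + M d / 2 + t * d / 2 - t * h"
    unfolding h(2)[symmetric] y' z' unfolding Py My unfolding \<alpha> y z using t_nz
    by (simp add: field_simps power2_eq_square)
  show "y' + z' \<in> R"
    unfolding s' by (intro R_intros sd g h)
  have d': "t * (y' - z') = M s / 2 + t * P d / 2 - t * (Y - Z)"
    unfolding y' z' unfolding Py My unfolding \<alpha> y z using t_nz
    by (simp add: field_simps power2_eq_square)
  show "t * (y' - z') \<in> R"
    unfolding d' by (intro R_intros sd g YZ)
  have Md: "M d = M (P s) + (1 - t\<^sup>2) * g + t * M g"
  proof -
    have "d = P s + t * g"
      using g(2) by (simp add: algebra_simps)
    then have "M d = M (P s + t * g)"
      by simp
    then show ?thesis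
      by (simp add: M.add M_mult_t add.assoc)
  qed
  have P': "P (t * (y' - z')) = M (P s) / 2 + t * P (P d) / 2 - t * P (Y - Z)"
    unfolding d' by (simp add: half P.add P.diff P_mult_t PM)
  have "(y' + z') - P (t * (y' - z')) =
      t * (- t * g / 2 + M g / 2 + d / 2 - h - P (P d) / 2 + P (Y - Z))"
    unfolding P' s' Md by (simp add: field_simps power2_eq_square)
  then show "(y' + z') - P (t * (y' - z')) \<in> I"
    by (rule I_I[rotated]) (intro R_intros sd g h YZ)
qed

text \<open>The roles exchanged by \<open>step_opposite_a\<close> are exchanged back. The extra term
  - (y - z) has a pole in the difference; it is compensated by the 2 * y that comes from the
  coefficient 2 - \<alpha>.\<close>

lemma step_opposite_b:
  fixes y z \<alpha> Y Z
  assumes S: "y + z \<in> R" and D: "t * (y - z) \<in> R" and SD: "(y + z) - P (t * (y - z)) \<in> I"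
    and \<alpha>: "\<alpha> = (1 + t\<^sup>2) / (2 * t) + 1"
    and YZ: "Y + Z \<in> R" "Y - Z \<in> I"
    and y': "y' = (P y + M y) / 2 - y - \<alpha> * z - Y"
    and z': "z' = (P z - M z) / 2 - z - (2 - \<alpha>) * y - Z"
  shows "t * (y' + z') \<in> R" "y' - z' \<in> R" "(y' - z') - P (t * (y' + z')) \<in> I"
proof -
  define s d where "s = y + z" and "d = t * (y - z)"
  have y: "y = (s + d / t) / 2" and z: "z = (s - d / t) / 2"
    using t_nz by (simp_all add: s_def d_def)
  have sd: "s \<in> R" "d \<in> R"
    using S D by (simp_all add: s_def d_def)
  obtain g where g: "g \<in> R" "s - P d = t * g"
    using SD I_obtain unfolding s_def d_def by blast
  obtain h where h: "h \<in> R" "Y - Z = t * h"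
    using YZ(2) I_obtain by blast
  have half: "P (x / 2) = P x / 2" "M (x / 2) = M x / 2" for x
    by (simp_all add: P.divide M.divide power2_eq_square)
  have Pd: "P d = s - t * g"
    using g(2) by (simp add: algebra_simps)
  have Py: "P y = (P s + (s - t * g) / t) / 2" "P z = (P s - (s - t * g) / t) / 2"
    unfolding y z half P.add P.diff P_div_t Pd by simp_all
  have My: "M y = (M s + (M d / t - d * (1 - t\<^sup>2) / t\<^sup>2)) / 2" "M z = (M s - (M d / t - d * (1 - t\<^sup>2) / t\<^sup>2)) / 2"
    unfolding y z half M.add M.diff M_div_t by simp_all
  have s': "t * (y' + z') = t * (P s / 2 - 2 * s) + M d / 2 + t * d - t * (Y + Z)"
    unfolding y' z' unfolding Py My unfolding \<alpha> y z using t_nz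
    by (simp add: field_simps power2_eq_square)
  show "t * (y' + z') \<in> R"
    unfolding s' by (intro R_intros sd g YZ)
  have d': "y' - z' = M s / 2 - g / 2 - t * s / 2 - t * h"
    unfolding h(2)[symmetric] y' z' unfolding Py My unfolding \<alpha> y z using t_nz
    by (simp add: field_simps power2_eq_square)
  show "y' - z' \<in> R"
    unfolding d' by (intro R_intros sd g h)
  have Ms: "M s = M (P d) + (1 - t\<^sup>2) * g + t * M g"
  proof -
    have "s = P d + t * g"
      using g(2) by (simp add: algebra_simps)
    then have "M s = M (P d + t * g)"
      by simp
    then show ?thesis
      by (simp add: M.add M_mult_t add.assoc)
  qed
  have P': "P (t * (y' + z')) = t * P (P s / 2 - 2 * s) + M (P d) / 2 + t * P d - t * P (Y + Z)"
    unfolding s' by (simp only: half P.add P.diff P_mult_t PM)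
  have "(y' - z') - P (t * (y' + z')) =
      t * (- t * g / 2 + M g / 2 - s / 2 - h - P (P s / 2 - 2 * s) - P d + P (Y + Z))"
    unfolding P' d' Ms by (simp add: field_simps power2_eq_square)
  then show "(y' - z') - P (t * (y' + z')) \<in> I"
    by (rule I_I[rotated]) (intro R_intros sd g h YZ)
qed

text \<open>The poles of y and z are opposite, so coefficients that agree on the divisor make them
  cancel.\<close>

lemma combination_difference:
  assumes "a \<in> R" "b \<in> R" "a - b \<in> I" "y + z \<in> R" "t * (y - z) \<in> R"
  shows "a * y + b * z \<in> R"
proof -
  obtain g where g: "g \<in> R" "a - b = t * g"
    using assms(3) I_obtain by blast
  have "a * y + b * z = (a + b) * (y + z) / 2 + (a - b) * (y - z) / 2"
    by (simp add: field_simps)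
  also have "\<dots> = (a + b) * (y + z) / 2 + g * (t * (y - z)) / 2"
    by (simp add: g)
  finally show ?thesis
    using assms g by (auto intro!: R_intros)
qed

text \<open>Here the poles of y and z are equal, so the coefficients must be opposite on the
  divisor.\<close>

lemma combination_sum:
  assumes "a \<in> R" "b \<in> R" "a + b \<in> I" "t * (y + z) \<in> R" "y - z \<in> R"
  shows "a * y + b * z \<in> R"
proof -
  obtain g where g: "g \<in> R" "a + b = t * g"
    using assms(3) I_obtain by blast
  have "a * y + b * z = (a + b) * (y + z) / 2 + (a - b) * (y - z) / 2"
    by (simp add: field_simps)
  also have "\<dots> = g * (t * (y + z)) / 2 + (a - b) * (y - z) / 2"
    by (simp add: g)
  finally show ?thesis
    using assms g by (auto intro!: R_intros)
qed

end

section \<open>Substitution\<close>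

lemma subst_superset:
  assumes "finite A" "Poly_Mapping.keys p \<subseteq> A" "h 0 = 0"
  shows "subst h f p = (\<Sum>m\<in>A. h (Poly_Mapping.lookup p m) * (\<Prod>i\<in>UNIV. f i ^ Poly_Mapping.lookup m i))"
  unfolding subst_def using assms by (intro sum.mono_neutral_left) (auto simp: in_keys_iff)

locale scalar_hom =
  fixes h :: "complex \<Rightarrow> 'b::comm_ring_1"
  assumes h_0: "h 0 = 0" and h_1: "h 1 = 1"
    and h_add: "h (a + b) = h a + h b" and h_mult: "h (a * b) = h a * h b"
begin

lemma subst_add: "subst h f (p + q) = subst h f p + subst h f q"
proof -
  let ?A = "Poly_Mapping.keys p \<union> Poly_Mapping.keys q \<union> Poly_Mapping.keys (p + q)"
  have A: "finite ?A" "Poly_Mapping.keys p \<subseteq> ?A" "Poly_Mapping.keys q \<subseteq> ?A"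
    "Poly_Mapping.keys (p + q) \<subseteq> ?A"
    by auto
  show ?thesis
    by (simp only: subst_superset[where h = h, OF A(1,2) h_0] subst_superset[where h = h, OF A(1,3) h_0]
        subst_superset[where h = h, OF A(1,4) h_0] lookup_add h_add distrib_right sum.distrib)
qed

lemma subst_0 [simp]: "subst h f 0 = 0"
  by (simp add: subst_def)

lemma subst_sum: "subst h f (\<Sum>a\<in>A. p a) = (\<Sum>a\<in>A. subst h f (p a))"
  by (induction A rule: infinite_finite_induct) (simp_all add: subst_add)

lemma subst_single:
  "subst h f (Poly_Mapping.single m c) = h c * (\<Prod>i\<in>UNIV. f i ^ Poly_Mapping.lookup m i)"
  by (subst subst_superset[where A = "{m}"]) (auto simp: h_0)

lemma subst_mult: "subst h f (p * q) = subst h f p * subst h f q"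
proof -
  let ?S = "\<lambda>r m. Poly_Mapping.single m (Poly_Mapping.lookup r m) :: _ mpoly"
  have "subst h f ((\<Sum>m\<in>Poly_Mapping.keys p. ?S p m) * (\<Sum>m\<in>Poly_Mapping.keys q. ?S q m)) =
      subst h f (\<Sum>m\<in>Poly_Mapping.keys p. ?S p m) * subst h f (\<Sum>m\<in>Poly_Mapping.keys q. ?S q m)"
    by (simp add: sum_product subst_sum mult_single subst_single lookup_add power_add prod.distrib h_mult)
      (simp add: mult_ac)
  then show ?thesis
    unfolding mpoly_sum_monomials[symmetric] .
qed

lemma subst_Const [simp]: "subst h f (Const c) = h c"
  by (simp add: Const_def subst_single)

lemma subst_Var [simp]: "subst h f (Var i) = f i"
proof -
  have "(\<Prod>j\<in>UNIV. f j ^ Poly_Mapping.lookup (Poly_Mapping.single i 1) j) =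
      (\<Prod>j\<in>UNIV. if j = i then f j else 1)"
    by (rule prod.cong) (auto simp: lookup_single when_def)
  then show ?thesis
    by (simp add: Var_def subst_single h_1)
qed

lemma subst_1 [simp]: "subst h f 1 = 1"
  using subst_Const[of f 1] by (simp add: h_1)

lemma subst_minus: "subst h f (- p) = - subst h f p"
  using subst_add[of f p "- p"] by (simp add: eq_neg_iff_add_eq_0 add.commute)

lemma subst_diff: "subst h f (p - q) = subst h f p - subst h f q"
  using subst_add[of f p "- q"] by (simp add: subst_minus)

lemma subst_power: "subst h f (p ^ k) = subst h f p ^ k"
  by (induction k) (simp_all add: subst_mult)

lemma subst_prod: "subst h f (\<Prod>a\<in>A. p a) = (\<Prod>a\<in>A. subst h f (p a))"
  by (induction A rule: infinite_finite_induct) (simp_all add: subst_mult)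

end

interpretation Const: scalar_hom "Const :: complex \<Rightarrow> 'n::linorder mpoly"
  by unfold_locales (simp_all add: Const_add Const_mult)

lemma single_eq_prod_Var:
  fixes m :: "'n::{finite,linorder} \<Rightarrow>\<^sub>0 nat"
  shows "Poly_Mapping.single m 1 = (\<Prod>i\<in>UNIV. Var i ^ Poly_Mapping.lookup m i)"
proof -
  have "to_fract (\<Prod>i\<in>UNIV. Var i ^ Poly_Mapping.lookup m i) =
      (\<Prod>i\<in>UNIV. Mon (Poly_Mapping.single i (Poly_Mapping.lookup m i)))"
    by (simp add: to_fract_prod to_fract_power Mon_single X_def)
  also have "\<dots> = Mon (\<Sum>i\<in>UNIV. Poly_Mapping.single i (Poly_Mapping.lookup m i))"
    by (simp add: Mon_sum)
  also have "(\<Sum>i\<in>UNIV. Poly_Mapping.single i (Poly_Mapping.lookup m i)) = m"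
    by (rule poly_mapping_eqI) (simp add: lookup_sum lookup_single when_def)
  finally show ?thesis
    by (simp add: Mon_def)
qed

lemma mpoly_induct [case_names Const Var add mult]:
  fixes p :: "'n::{finite,linorder} mpoly"
  assumes "\<And>c. Q (Const c)" "\<And>i. Q (Var i)"
    "\<And>p q. Q p \<Longrightarrow> Q q \<Longrightarrow> Q (p + q)" "\<And>p q. Q p \<Longrightarrow> Q q \<Longrightarrow> Q (p * q)"
  shows "Q p"
proof -
  have pow: "Q (Var i ^ k)" for i k
    using assms(1)[of 1] assms(2,4) by (induction k) auto
  have prod: "Q (\<Prod>i\<in>A. Var i ^ k i)" for A k
    using assms(1)[of 1] pow assms(4) by (induction A rule: infinite_finite_induct) auto
  have sum: "Q (\<Sum>m\<in>A. f m)" if "\<And>m. Q (f m)" for A and f :: "_ \<Rightarrow> 'n mpoly"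
    using assms(1)[of 0] assms(3) that by (induction A rule: infinite_finite_induct) auto
  have "subst Const Var p = p"
    unfolding subst_def single_eq_prod_Var[symmetric]
    by (subst (3) mpoly_sum_monomials[of p]) (simp add: Const_def mult_single)
  moreover have "Q (subst Const Var p)"
    unfolding subst_def by (intro sum assms(4) assms(1) prod)
  ultimately show ?thesis
    by simp
qed

section \<open>Polynomiality of the conjugated operators\<close>

text \<open>The sign selects the divisor x_s = \<epsilon> x_r; both signs together account for all
  factors of the denominators of the coefficients.\<close>

locale two_variables =
  fixes r s :: "'n::{finite,linorder}" and \<epsilon> :: complex
  assumes rs: "r \<noteq> s" and \<epsilon>: "\<epsilon> = 1 \<or> \<epsilon> = - 1"
begin

definition spec :: "'n mpoly \<Rightarrow> 'n mpoly"
  where "spec = subst Const (\<lambda>i. if i = s then Const \<epsilon> * Var r else Var i)"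

lemma eps_square: "\<epsilon> * \<epsilon> = 1"
  using \<epsilon> by auto

lemma scalar_eps_square: "scalar \<epsilon> * scalar \<epsilon> = 1"
  by (simp add: eps_square flip: scalar_mult)

lemma spec_mult: "spec (p * q) = spec p * spec q"
  and spec_add: "spec (p + q) = spec p + spec q"
  and spec_diff: "spec (p - q) = spec p - spec q"
  and spec_1: "spec 1 = 1"
  and spec_Const: "spec (Const c) = Const c"
  by (simp_all add: spec_def Const.subst_mult Const.subst_add Const.subst_diff)

lemma spec_Var: "spec (Var i) = (if i = s then Const \<epsilon> * Var r else Var i)"
  by (simp add: spec_def)

text \<open>The factor theorem for a hyperplane, by structural induction on polynomials: sums and
  products respect the congruence.\<close>

lemma spec_divides: "\<exists>q. p - spec p = (Var s - Const \<epsilon> * Var r) * q"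
proof (induction p rule: mpoly_induct)
  case (Const c)
  show ?case by (rule exI[of _ 0]) (simp add: spec_Const)
next
  case (Var i)
  show ?case
    by (rule exI[of _ "if i = s then 1 else 0"]) (simp add: spec_Var)
next
  case (add p q)
  then obtain a b where "p - spec p = (Var s - Const \<epsilon> * Var r) * a"
    "q - spec q = (Var s - Const \<epsilon> * Var r) * b"
    by blast
  moreover have "p + q - spec (p + q) = (p - spec p) + (q - spec q)"
    by (simp add: spec_add)
  ultimately show ?case
    by (intro exI[of _ "a + b"]) (simp add: distrib_left)
next
  case (mult p q)
  then obtain a b where a: "p - spec p = (Var s - Const \<epsilon> * Var r) * a"
    and b: "q - spec q = (Var s - Const \<epsilon> * Var r) * b"
    by blast
  have "p * q - spec (p * q) = (p - spec p) * q + spec p * (q - spec q)"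
    by (simp add: spec_mult algebra_simps)
  also have "\<dots> = (Var s - Const \<epsilon> * Var r) * (a * q + spec p * b)"
    unfolding a b by (simp add: algebra_simps)
  finally show ?case ..
qed

text \<open>The localization of the polynomial ring at the prime ideal of the hyperplane x_s =
  \<epsilon> x_r, which is the kernel of \<open>spec\<close>.\<close>

definition regular :: "'n ratfun set"
  where "regular = {f. \<exists>a b. f = to_fract a / to_fract b \<and> spec b \<noteq> 0}"

lemma regular_I: "spec b \<noteq> 0 \<Longrightarrow> f = to_fract a / to_fract b \<Longrightarrow> f \<in> regular"
  by (auto simp: regular_def)

lemma regular_E:
  assumes "f \<in> regular"
  obtains a b where "f = to_fract a / to_fract b" "spec b \<noteq> 0" "b \<noteq> 0"
proof -
  have "b \<noteq> 0" if "spec b \<noteq> 0" for b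
    using that spec_diff[of 0 0] by auto
  then show ?thesis
    using assms that by (auto simp: regular_def)
qed

lemma regular_to_fract: "to_fract p \<in> regular"
  by (rule regular_I[of 1]) (simp_all add: spec_1)

lemma regular_add: "f \<in> regular \<Longrightarrow> g \<in> regular \<Longrightarrow> f + g \<in> regular"
proof (elim regular_E)
  fix a b c d
  assume *: "f = to_fract a / to_fract b" "spec b \<noteq> 0" "b \<noteq> 0" "g = to_fract c / to_fract d" "spec d \<noteq> 0" "d \<noteq> 0"
  show ?thesis
    by (rule regular_I[of "b * d" _ "a * d + c * b"]) (use * in \<open>simp_all add: spec_mult field_simps\<close>)
qed

lemma regular_mult: "f \<in> regular \<Longrightarrow> g \<in> regular \<Longrightarrow> f * g \<in> regular"
proof (elim regular_E)
  fix a b c d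
  assume *: "f = to_fract a / to_fract b" "spec b \<noteq> 0" "b \<noteq> 0" "g = to_fract c / to_fract d" "spec d \<noteq> 0" "d \<noteq> 0"
  show ?thesis
    by (rule regular_I[of "b * d" _ "a * c"]) (use * in \<open>simp_all add: spec_mult field_simps\<close>)
qed

lemma regular_euler: "f \<in> regular \<Longrightarrow> euler i f \<in> regular"
proof (elim regular_E)
  fix a b
  assume *: "f = to_fract a / to_fract b" "spec b \<noteq> 0" "b \<noteq> 0"
  show ?thesis
    by (rule regular_I[of "b * b" _ "euler_mpoly i a * b - a * euler_mpoly i b"])
      (use * in \<open>simp_all add: spec_mult euler_quotient\<close>)
qed

lemma regular_minus: "f \<in> regular \<Longrightarrow> - f \<in> regular"
  using regular_mult[OF regular_to_fract[of "- 1"]] by simp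

lemma regular_scalar: "scalar c \<in> regular"
  unfolding scalar_def by (rule regular_to_fract)

lemma regular_X: "X i \<in> regular"
  unfolding X_def by (rule regular_to_fract)

text \<open>With u = log x_r - log x_s this is tanh (u / 2) for \<epsilon> = 1 and coth (u / 2) for
  \<epsilon> = -1. Both solve the same differential equation \<open>M_t\<close>, so both divisors
  fit one locale.\<close>

definition loc :: "'n ratfun"
  where "loc = (X r - scalar \<epsilon> * X s) / (X r + scalar \<epsilon> * X s)"

lemma lin_nonzero: "X r - scalar \<epsilon> * X s \<noteq> 0" "X r + scalar \<epsilon> * X s \<noteq> 0"
  using \<epsilon> rs X_add_nonzero[of r s] by (auto simp: scalar_minus simp del: X_add_nonzero)

lemma spec_lin: "spec (Var r + Const \<epsilon> * Var s) = 2 * Var r"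
  using rs by (simp add: spec_add spec_mult spec_Const spec_Var eps_square
      flip: Const_mult mult.assoc)

lemma Var_nonzero: "Var i \<noteq> (0 :: 'n mpoly)"
  using X_nonzero[of i] unfolding X_def by (metis to_fract_0)

sublocale divisor "\<lambda>f. euler r f + euler s f" "\<lambda>f. euler r f - euler s f" regular loc
proof
  show "1 \<in> regular"
    using regular_scalar[of 1] by simp
  have "scalar (1 / 2) = (1 / 2 :: 'n ratfun)"
    using scalar_mult[of "1 / 2" 2] by (simp add: eq_divide_eq)
  then show "1 / 2 \<in> regular"
    using regular_scalar[of "1 / 2"] by (simp only:)
  show "euler r (euler r x - euler s x) + euler s (euler r x - euler s x) =
      euler r (euler r x + euler s x) - euler s (euler r x + euler s x)" for x
    by (simp add: euler.add euler.diff euler_commute[of r s])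
  show "loc \<noteq> 0"
    using lin_nonzero by (simp add: loc_def)
  show "loc \<in> regular"
    by (rule regular_I[of "Var r + Const \<epsilon> * Var s" _ "Var r - Const \<epsilon> * Var s"])
      (simp_all add: spec_lin Var_nonzero loc_def X_def scalar_def)
  have nz: "X r + scalar \<epsilon> * X s \<noteq> 0"
    by (rule lin_nonzero)
  show "euler r loc + euler s loc = 0"
    unfolding loc_def using rs nz
    by (simp add: euler.divide euler.add euler.diff euler_scalar_mult euler_X)
      (simp add: field_simps power2_eq_square)
  have "1 - (p / q)\<^sup>2 = (q\<^sup>2 - p\<^sup>2) / q\<^sup>2" if "q \<noteq> 0" for p q :: "'n ratfun"
    using that by (simp add: field_simps)
  from this[OF nz] have "1 - loc\<^sup>2 = ((X r + scalar \<epsilon> * X s)\<^sup>2 - (X r - scalar \<epsilon> * X s)\<^sup>2) / (X r + scalar \<epsilon> * X s)\<^sup>2"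
    by (simp only: loc_def)
  then show "euler r loc - euler s loc = 1 - loc\<^sup>2"
    unfolding loc_def using rs nz
    by (simp add: euler.divide euler.add euler.diff euler_scalar_mult euler_X diff_divide_distrib[symmetric])
      (simp add: algebra_simps power2_eq_square)
qed (auto simp: euler.add euler.diff euler.mult algebra_simps intro!: regular_add regular_mult regular_euler
    regular_minus regular_add[OF _ regular_minus, simplified])

end

lemma coef_a_antisym: "coef_a j i = - coef_a i j"
  unfolding coef_a_def by (metis (no_types, opaque_lifting) minus_diff_eq minus_divide_right mult.assoc mult.commute)

lemma coef_b_swap:
  assumes "i \<noteq> j"
  shows "coef_b j i = 2 - coef_b i j"
proof -
  define d where "d = (X i)\<^sup>2 - (X j)\<^sup>2"
  have d: "d \<noteq> 0" "(X j)\<^sup>2 - (X i)\<^sup>2 = - d" "(X j)\<^sup>2 = (X i)\<^sup>2 - d"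
    using assms by (simp_all add: d_def)
  show ?thesis
    unfolding coef_b_def d_def[symmetric] d(2) unfolding d(3) using d(1) by (simp add: field_simps)
qed

lemma sum_two:
  fixes f :: "'n::finite \<Rightarrow> 'b::comm_monoid_add"
  assumes "r \<noteq> s" "i \<noteq> r" "i \<noteq> s"
  shows "(\<Sum>j\<in>UNIV - {i}. f j) = f r + f s + (\<Sum>j\<in>UNIV - {i, r, s}. f j)"
proof -
  have "UNIV - {i} = insert r (insert s (UNIV - {i, r, s}))"
    using assms by auto
  moreover have "sum f (insert r (insert s (UNIV - {i, r, s}))) = f r + (f s + (\<Sum>j\<in>UNIV - {i, r, s}. f j))"
    using assms by (subst sum.insert) auto
  ultimately show ?thesis
    by (simp add: add.assoc)
qed

lemma sum_one:
  fixes f :: "'n::finite \<Rightarrow> 'b::comm_monoid_add"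
  assumes "r \<noteq> s"
  shows "(\<Sum>j\<in>UNIV - {r}. f j) = f s + (\<Sum>j\<in>UNIV - {r, s}. f j)"
proof -
  have "UNIV - {r} = insert s (UNIV - {r, s})"
    using assms by auto
  then show ?thesis
    by simp
qed

section \<open>The coefficients near a divisor\<close>

context two_variables
begin

abbreviation "P f \<equiv> euler r f + euler s f"
abbreviation "M f \<equiv> euler r f - euler s f"

lemma regular_inverse:
  assumes "spec b \<noteq> 0"
  shows "1 / to_fract b \<in> regular"
  by (rule regular_I[OF assms, of _ 1]) simp

lemma regular_diff_square:
  assumes "i \<noteq> j" "{i, j} \<noteq> {r, s}"
  shows "1 / ((X i)\<^sup>2 - (X j)\<^sup>2) \<in> regular"
proof -
  let ?f = "\<lambda>i. if i = s then r else i"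
  have sq: "spec (Var i * Var i) = Var (?f i) * Var (?f i)" for i
  proof -
    have "Const \<epsilon> * Var r * (Const \<epsilon> * Var r) = Const (\<epsilon> * \<epsilon>) * (Var r * Var r)"
      by (simp add: Const_mult mult_ac)
    then show ?thesis
      by (simp add: spec_mult spec_Var eps_square)
  qed
  have "?f i \<noteq> ?f j"
    using assms by (auto split: if_splits)
  then have "(X (?f i))\<^sup>2 \<noteq> (X (?f j))\<^sup>2"
    by simp
  then have "Var (?f i) * Var (?f i) \<noteq> (Var (?f j) * Var (?f j) :: 'n mpoly)"
    unfolding X_def power2_eq_square by (metis to_fract_mult)
  then have "spec (Var i * Var i - Var j * Var j) \<noteq> 0"
    by (simp add: spec_diff sq)
  from regular_inverse[OF this] show ?thesis
    by (simp add: X_def power2_eq_square)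
qed

lemma coef_a_regular:
  assumes "i \<noteq> j" "{i, j} \<noteq> {r, s}"
  shows "coef_a i j \<in> regular"
  unfolding coef_a_def
  using R_mult[OF R_mult[OF R_mult[OF R_two regular_X[of i]] regular_X[of j]] regular_diff_square[OF assms]]
  by simp

lemma coef_b_regular:
  assumes "i \<noteq> j" "{i, j} \<noteq> {r, s}"
  shows "coef_b i j \<in> regular"
  unfolding coef_b_def
  using R_mult[OF R_mult[OF R_two R_power2[OF regular_X[of i]]] regular_diff_square[OF assms]]
  by simp

lemma diff_square_factor: "(X r)\<^sup>2 - (X s)\<^sup>2 = (X r - scalar \<epsilon> * X s) * (X r + scalar \<epsilon> * X s)"
proof -
  have "(X r - scalar \<epsilon> * X s) * (X r + scalar \<epsilon> * X s) = (X r)\<^sup>2 - (scalar \<epsilon> * scalar \<epsilon>) * (X s)\<^sup>2"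
    by (simp add: power2_eq_square algebra_simps)
  then show ?thesis
    by (simp only: scalar_eps_square mult_1_left)
qed

lemma lin_I: "g \<in> regular \<Longrightarrow> (X r - scalar \<epsilon> * X s) * g \<in> I"
  by (rule I_I[of "(X r + scalar \<epsilon> * X s) * g"])
    (use lin_nonzero in \<open>auto simp: loc_def intro!: R_intros regular_X regular_scalar\<close>)

text \<open>\<open>coef_a\<close> is odd in its first variable, so passing from x_r to x_s =
  \<epsilon> x_r costs the factor \<epsilon>.\<close>

lemma coef_a_I:
  assumes "j \<noteq> r" "j \<noteq> s"
  shows "coef_a r j - scalar \<epsilon> * coef_a s j \<in> I"
proof -
  define A B where "A = (X r)\<^sup>2 - (X j)\<^sup>2" and "B = (X s)\<^sup>2 - (X j)\<^sup>2"
  have nz: "A \<noteq> 0" "B \<noteq> 0"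
    using assms by (auto simp: A_def B_def)
  have reg: "1 / A \<in> regular" "1 / B \<in> regular"
    unfolding A_def B_def using assms rs by (auto intro!: regular_diff_square)
  have num: "X r * B - scalar \<epsilon> * X s * A =
      (X r - scalar \<epsilon> * X s) * (- scalar \<epsilon> * X r * X s - (X j)\<^sup>2)"
  proof -
    have "(X r - scalar \<epsilon> * X s) * (- scalar \<epsilon> * X r * X s - (X j)\<^sup>2) =
        X r * ((scalar \<epsilon> * scalar \<epsilon>) * (X s)\<^sup>2 - (X j)\<^sup>2) - scalar \<epsilon> * X s * A"
      unfolding A_def by (simp add: power2_eq_square algebra_simps)
    then show ?thesis
      by (simp only: scalar_eps_square mult_1_left B_def)
  qed
  have "coef_a r j - scalar \<epsilon> * coef_a s j = 2 * X j * (X r * B - scalar \<epsilon> * X s * A) * (1 / A * (1 / B))"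
    unfolding coef_a_def A_def[symmetric] B_def[symmetric] using nz by (simp add: field_simps)
  also have "\<dots> = (X r - scalar \<epsilon> * X s) *
      (2 * X j * (- scalar \<epsilon> * X r * X s - (X j)\<^sup>2) * (1 / A * (1 / B)))"
    unfolding num by (simp only: mult_ac)
  also have "\<dots> \<in> I"
    by (intro lin_I R_intros regular_X regular_scalar reg)
  finally show ?thesis .
qed

text \<open>\<open>coef_b\<close> is even in its first variable, hence no sign appears.\<close>

lemma coef_b_I:
  assumes "j \<noteq> r" "j \<noteq> s"
  shows "coef_b r j - coef_b s j \<in> I"
proof -
  define A B where "A = (X r)\<^sup>2 - (X j)\<^sup>2" and "B = (X s)\<^sup>2 - (X j)\<^sup>2"
  have nz: "A \<noteq> 0" "B \<noteq> 0"
    using assms by (auto simp: A_def B_def)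
  have reg: "1 / A \<in> regular" "1 / B \<in> regular"
    unfolding A_def B_def using assms rs by (auto intro!: regular_diff_square)
  have num: "(X r)\<^sup>2 * B - (X s)\<^sup>2 * A = - (X j)\<^sup>2 * ((X r)\<^sup>2 - (X s)\<^sup>2)"
    unfolding A_def B_def by (simp add: algebra_simps)
  have "coef_b r j - coef_b s j = 2 * ((X r)\<^sup>2 * B - (X s)\<^sup>2 * A) * (1 / A * (1 / B))"
    unfolding coef_b_def A_def[symmetric] B_def[symmetric] using nz by (simp add: field_simps)
  also have "\<dots> = (X r - scalar \<epsilon> * X s) *
      (2 * (- (X j)\<^sup>2 * (X r + scalar \<epsilon> * X s)) * (1 / A * (1 / B)))"
    unfolding num diff_square_factor by (simp only: mult_ac)
  also have "\<dots> \<in> I"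
    by (intro lin_I R_intros regular_X regular_scalar reg)
  finally show ?thesis .
qed

lemma I_minus: "x \<in> I \<Longrightarrow> - x \<in> I"
  using I_mult[OF _ R_minus[OF R_one]] by simp

lemma coef_a_I':
  assumes "j \<noteq> r" "j \<noteq> s"
  shows "coef_a j r - scalar \<epsilon> * coef_a j s \<in> I"
  using I_minus[OF coef_a_I[OF assms]] by (simp add: coef_a_antisym[of j])

lemma coef_b_I':
  assumes "j \<noteq> r" "j \<noteq> s"
  shows "coef_b j r - coef_b j s \<in> I"
  using I_minus[OF coef_b_I[OF assms]] assms by (simp add: coef_b_swap[of r j] coef_b_swap[of s j])

text \<open>The double-angle formula for coth, which has the same form in terms of tanh and of
  coth.\<close>

lemma coef_b_loc: "coef_b r s = (1 + loc\<^sup>2) / (2 * loc) + 1"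
proof -
  define p q where "p = X r - scalar \<epsilon> * X s" and "q = X r + scalar \<epsilon> * X s"
  have nz: "p \<noteq> 0" "q \<noteq> 0"
    using lin_nonzero by (simp_all add: p_def q_def)
  have "coef_b r s = 2 * ((p + q) / 2)\<^sup>2 / (p * q)"
    unfolding coef_b_def diff_square_factor by (simp add: p_def q_def)
  also have "\<dots> = (1 + (p / q)\<^sup>2) / (2 * (p / q)) + 1"
    using nz by (simp add: field_simps power2_eq_square)
  finally show ?thesis
    by (simp add: loc_def p_def q_def)
qed

text \<open>The double-angle formula for 1 / sinh, which changes sign when tanh is replaced by
  coth.\<close>

lemma coef_a_loc: "coef_a r s = scalar \<epsilon> * ((1 - loc\<^sup>2) / (2 * loc))"
proof -
  define p q where "p = X r - scalar \<epsilon> * X s" and "q = X r + scalar \<epsilon> * X s"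
  have nz: "p \<noteq> 0" "q \<noteq> 0"
    using lin_nonzero by (simp_all add: p_def q_def)
  have s: "X s = scalar \<epsilon> * ((q - p) / 2)"
  proof -
    have "(q - p) / 2 = scalar \<epsilon> * X s"
      by (simp add: p_def q_def)
    then show ?thesis
      by (simp only: scalar_eps_square mult.assoc[symmetric] mult_1_left)
  qed
  have "coef_a r s = 2 * ((p + q) / 2) * (scalar \<epsilon> * ((q - p) / 2)) / (p * q)"
    unfolding coef_a_def diff_square_factor s[symmetric] by (simp add: p_def q_def)
  also have "\<dots> = scalar \<epsilon> * ((1 - (p / q)\<^sup>2) / (2 * (p / q)))"
    using nz by (simp add: field_simps power2_eq_square)
  finally show ?thesis
    by (simp add: loc_def p_def q_def)
qed

section \<open>Invariants of the recursion along a divisor\<close>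

definition others :: "('n \<Rightarrow> 'n ratfun) \<Rightarrow> bool"
  where "others u \<longleftrightarrow> (\<forall>j. j \<noteq> r \<longrightarrow> j \<noteq> s \<longrightarrow> u j \<in> regular)"

lemma euler_PM: "euler r f = (P f + M f) / 2" "euler s f = (P f - M f) / 2"
  by simp_all

lemma step_a_rs:
  "step_a euler u r = (P (u r) + M (u r)) / 2 - coef_a r s * u s - (\<Sum>j\<in>UNIV - {r, s}. coef_a r j * u j)"
  "step_a euler u s = (P (u s) - M (u s)) / 2 - coef_a s r * u r - (\<Sum>j\<in>UNIV - {r, s}. coef_a s j * u j)"
  unfolding step_a_def euler_PM[symmetric] sum_one[OF rs] sum_one[OF rs[symmetric]] insert_commute[of s r "{}"]
  by (simp_all only: diff_diff_eq add.assoc)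

lemma step_b_rs:
  "step_b euler u r = (P (u r) + M (u r)) / 2 - u r - coef_b r s * u s - (\<Sum>j\<in>UNIV - {r, s}. coef_b r j * u j)"
  "step_b euler u s = (P (u s) - M (u s)) / 2 - u s - coef_b s r * u r - (\<Sum>j\<in>UNIV - {r, s}. coef_b s j * u j)"
  unfolding step_b_def euler_PM[symmetric] sum_one[OF rs] sum_one[OF rs[symmetric]] insert_commute[of s r "{}"]
  by (simp_all only: diff_diff_eq add.assoc)

lemma others_step_a:
  assumes "others u" "\<And>j. j \<noteq> r \<Longrightarrow> j \<noteq> s \<Longrightarrow> coef_a j r * u r + coef_a j s * u s \<in> regular"
  shows "others (step_a euler u)"
  unfolding others_def
proof (intro allI impI)
  fix j assume j: "j \<noteq> r" "j \<noteq> s"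
  have "(\<Sum>i\<in>UNIV - {j, r, s}. coef_a j i * u i) \<in> regular"
    using assms(1) j by (intro R_sum R_mult coef_a_regular) (auto simp: others_def doubleton_eq_iff)
  then show "step_a euler u j \<in> regular"
    unfolding step_a_def sum_two[OF rs j] using assms j
    by (intro R_diff regular_euler R_add[of "_ + _"]) (auto simp: others_def)
qed

lemma others_step_b:
  assumes "others u" "\<And>j. j \<noteq> r \<Longrightarrow> j \<noteq> s \<Longrightarrow> coef_b j r * u r + coef_b j s * u s \<in> regular"
  shows "others (step_b euler u)"
  unfolding others_def
proof (intro allI impI)
  fix j assume j: "j \<noteq> r" "j \<noteq> s"
  have "(\<Sum>i\<in>UNIV - {j, r, s}. coef_b j i * u i) \<in> regular"
    using assms(1) j by (intro R_sum R_mult coef_b_regular) (auto simp: others_def doubleton_eq_iff)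
  then show "step_b euler u j \<in> regular"
    unfolding step_b_def sum_two[OF rs j] using assms j
    by (intro R_diff regular_euler R_add[of "_ + _"]) (auto simp: others_def)
qed

lemma sum_a_R:
  assumes "others u"
  shows "(\<Sum>j\<in>UNIV - {r, s}. coef_a r j * u j) \<in> regular" "(\<Sum>j\<in>UNIV - {r, s}. coef_a s j * u j) \<in> regular"
  using assms rs by (auto intro!: R_sum R_mult coef_a_regular simp: others_def doubleton_eq_iff)

lemma sum_b_R:
  assumes "others u"
  shows "(\<Sum>j\<in>UNIV - {r, s}. coef_b r j * u j) \<in> regular" "(\<Sum>j\<in>UNIV - {r, s}. coef_b s j * u j) \<in> regular"
  using assms rs by (auto intro!: R_sum R_mult coef_b_regular simp: others_def doubleton_eq_iff)

lemma sum_a_I: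
  assumes "others u"
  shows "(\<Sum>j\<in>UNIV - {r, s}. coef_a r j * u j) - scalar \<epsilon> * (\<Sum>j\<in>UNIV - {r, s}. coef_a s j * u j) \<in> I"
proof -
  have "(\<Sum>j\<in>UNIV - {r, s}. coef_a r j * u j) - scalar \<epsilon> * (\<Sum>j\<in>UNIV - {r, s}. coef_a s j * u j) =
      (\<Sum>j\<in>UNIV - {r, s}. (coef_a r j - scalar \<epsilon> * coef_a s j) * u j)"
    by (simp add: sum_distrib_left sum_subtractf left_diff_distrib mult.assoc)
  also have "\<dots> \<in> I"
    using assms by (intro I_sum I_mult coef_a_I) (auto simp: others_def)
  finally show ?thesis .
qed

lemma sum_b_I:
  assumes "others u"
  shows "(\<Sum>j\<in>UNIV - {r, s}. coef_b r j * u j) - (\<Sum>j\<in>UNIV - {r, s}. coef_b s j * u j) \<in> I"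
proof -
  have "(\<Sum>j\<in>UNIV - {r, s}. coef_b r j * u j) - (\<Sum>j\<in>UNIV - {r, s}. coef_b s j * u j) =
      (\<Sum>j\<in>UNIV - {r, s}. (coef_b r j - coef_b s j) * u j)"
    by (simp add: sum_subtractf left_diff_distrib)
  also have "\<dots> \<in> I"
    using assms by (intro I_sum I_mult coef_b_I) (auto simp: others_def)
  finally show ?thesis .
qed

text \<open>The pole condition of \<open>step_equal\<close> on components r and s; for \<epsilon> =
  1 both kinds of steps preserve it.\<close>

definition admissible_equal :: "('n \<Rightarrow> 'n ratfun) \<Rightarrow> bool"
  where "admissible_equal u \<longleftrightarrow> others u \<and> u r + u s \<in> regular \<and>
    loc * (u r - u s) \<in> regular \<and> M (loc * (u r - u s)) \<in> I"

lemma admissible_equal_step_a: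
  assumes "\<epsilon> = 1" "admissible_equal u"
  shows "admissible_equal (step_a euler u)"
proof -
  have u: "others u" "u r + u s \<in> regular" "loc * (u r - u s) \<in> regular" "M (loc * (u r - u s)) \<in> I"
    using assms(2) by (auto simp: admissible_equal_def)
  have al: "coef_a r s = 1 / (2 * loc) + - loc / 2" "coef_a s r = - 1 / (2 * loc) + loc / 2"
    using coef_a_loc t_nz assms(1) coef_a_antisym[of s r]
    by (simp_all add: field_simps power2_eq_square)
  have rho: "- loc / 2 - loc / 2 \<in> I" "- loc / 2 + loc / 2 = of_nat 0"
    by (auto intro!: I_I[of "- 1"] R_intros)
  have YZ: "(\<Sum>j\<in>UNIV - {r, s}. coef_a r j * u j) + (\<Sum>j\<in>UNIV - {r, s}. coef_a s j * u j) \<in> regular"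
    "(\<Sum>j\<in>UNIV - {r, s}. coef_a r j * u j) - (\<Sum>j\<in>UNIV - {r, s}. coef_a s j * u j) \<in> I"
    using R_add[OF sum_a_R[OF u(1)]] sum_a_I[OF u(1)] assms(1) by simp_all
  note step = step_equal[OF u(2-4) al rho YZ, of "step_a euler u r" 0 "step_a euler u s"]
  have "others (step_a euler u)"
    by (intro others_step_a combination_difference u coef_a_regular)
      (use rs coef_a_I' assms(1) in \<open>auto simp: doubleton_eq_iff\<close>)
  then show ?thesis
    unfolding admissible_equal_def using step by (simp add: step_a_rs)
qed

lemma admissible_equal_step_b:
  assumes "\<epsilon> = 1" "admissible_equal u"
  shows "admissible_equal (step_b euler u)"
proof -
  have u: "others u" "u r + u s \<in> regular" "loc * (u r - u s) \<in> regular" "M (loc * (u r - u s)) \<in> I"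
    using assms(2) by (auto simp: admissible_equal_def)
  \<comment> \<open>The remainders add up to 2, since \<open>coef_b r s + coef_b s r = 2\<close>;
    this is the parameter c of \<open>step_equal\<close>, which is 0 for
    \<open>coef_a\<close>.\<close>
  have al: "coef_b r s = 1 / (2 * loc) + (loc / 2 + 1)" "coef_b s r = - 1 / (2 * loc) + (- loc / 2 + 1)"
    unfolding coef_b_swap[OF rs] coef_b_loc using t_nz
    by (simp_all add: field_simps power2_eq_square)
  have rho: "(loc / 2 + 1) - (- loc / 2 + 1) \<in> I" "(loc / 2 + 1) + (- loc / 2 + 1) = of_nat 2"
    by (auto intro!: I_I[of 1] R_intros)
  have YZ: "(\<Sum>j\<in>UNIV - {r, s}. coef_b r j * u j) + (\<Sum>j\<in>UNIV - {r, s}. coef_b s j * u j) \<in> regular"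
    "(\<Sum>j\<in>UNIV - {r, s}. coef_b r j * u j) - (\<Sum>j\<in>UNIV - {r, s}. coef_b s j * u j) \<in> I"
    using R_add[OF sum_b_R[OF u(1)]] sum_b_I[OF u(1)] by simp_all
  note step = step_equal[OF u(2-4) al rho YZ, of "step_b euler u r" 1 "step_b euler u s"]
  have "others (step_b euler u)"
    by (intro others_step_b combination_difference u coef_b_regular)
      (use rs coef_b_I' in \<open>auto simp: doubleton_eq_iff\<close>)
  then show ?thesis
    unfolding admissible_equal_def using step by (simp add: step_b_rs)
qed

text \<open>For \<epsilon> = -1 the invariant alternates: this form holds after an even number of
  steps, \<open>admissible_odd\<close> after an odd number.\<close>

definition admissible_even :: "('n \<Rightarrow> 'n ratfun) \<Rightarrow> bool"
  where "admissible_even u \<longleftrightarrow> others u \<and> loc * (u r + u s) \<in> regular \<and>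
    u r - u s \<in> regular \<and> (u r - u s) - P (loc * (u r + u s)) \<in> I"

definition admissible_odd :: "('n \<Rightarrow> 'n ratfun) \<Rightarrow> bool"
  where "admissible_odd u \<longleftrightarrow> others u \<and> u r + u s \<in> regular \<and>
    loc * (u r - u s) \<in> regular \<and> (u r + u s) - P (loc * (u r - u s)) \<in> I"

lemma admissible_odd_step_a:
  assumes "\<epsilon> = - 1" "admissible_even u"
  shows "admissible_odd (step_a euler u)"
proof -
  have u: "others u" "loc * (u r + u s) \<in> regular" "u r - u s \<in> regular" "(u r - u s) - P (loc * (u r + u s)) \<in> I"
    using assms(2) by (auto simp: admissible_even_def)
  have al: "coef_a r s = (loc\<^sup>2 - 1) / (2 * loc)"
    using coef_a_loc assms(1) by (simp add: scalar_minus flip: minus_divide_left)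
  have YZ: "(\<Sum>j\<in>UNIV - {r, s}. coef_a r j * u j) + (\<Sum>j\<in>UNIV - {r, s}. coef_a s j * u j) \<in> I"
    "(\<Sum>j\<in>UNIV - {r, s}. coef_a r j * u j) - (\<Sum>j\<in>UNIV - {r, s}. coef_a s j * u j) \<in> regular"
    using R_diff[OF sum_a_R[OF u(1)]] sum_a_I[OF u(1)] assms(1) by (simp_all add: scalar_minus)
  note step = step_opposite_a[OF u(2-4) al YZ, of "step_a euler u r" "step_a euler u s"]
  have "others (step_a euler u)"
    by (intro others_step_a combination_sum u coef_a_regular)
      (use rs coef_a_I' assms(1) in \<open>auto simp: doubleton_eq_iff scalar_minus\<close>)
  then show ?thesis
    unfolding admissible_odd_def using step by (simp add: step_a_rs coef_a_antisym[of s r])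
qed

lemma admissible_even_step_b:
  assumes "admissible_odd u"
  shows "admissible_even (step_b euler u)"
proof -
  have u: "others u" "u r + u s \<in> regular" "loc * (u r - u s) \<in> regular" "(u r + u s) - P (loc * (u r - u s)) \<in> I"
    using assms by (auto simp: admissible_odd_def)
  have YZ: "(\<Sum>j\<in>UNIV - {r, s}. coef_b r j * u j) + (\<Sum>j\<in>UNIV - {r, s}. coef_b s j * u j) \<in> regular"
    "(\<Sum>j\<in>UNIV - {r, s}. coef_b r j * u j) - (\<Sum>j\<in>UNIV - {r, s}. coef_b s j * u j) \<in> I"
    using R_add[OF sum_b_R[OF u(1)]] sum_b_I[OF u(1)] by simp_all
  note step = step_opposite_b[OF u(2-4) coef_b_loc YZ, of "step_b euler u r" "step_b euler u s"]
  have "others (step_b euler u)"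
    by (intro others_step_b combination_difference u coef_b_regular)
      (use rs coef_b_I' in \<open>auto simp: doubleton_eq_iff\<close>)
  then show ?thesis
    unfolding admissible_even_def using step by (simp add: step_b_rs coef_b_swap[OF rs])
qed

lemma conj_Omega_eq: "conj_Omega k f = chain euler k f r + chain euler k f s + (\<Sum>j\<in>UNIV - {r, s}. chain euler k f j)"
proof -
  have "UNIV = insert r (insert s (UNIV - {r, s}))"
    by auto
  then have "conj_Omega k f = sum (chain euler k f) (insert r (insert s (UNIV - {r, s})))"
    by (simp add: conj_Omega_def)
  then show ?thesis
    using rs by (simp add: add.assoc)
qed

text \<open>The sum of components r and s is regular in \<open>admissible_equal\<close> and in
  \<open>admissible_odd\<close>, whereas \<open>admissible_even\<close> allows it a pole; hence k
  must be odd.\<close>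

lemma conj_Omega_regular:
  assumes "odd k" "f \<in> regular"
  shows "conj_Omega k f \<in> regular"
proof -
  have base: "others (\<lambda>i. f)"
    using assms(2) by (simp add: others_def)
  have "others (chain euler k f) \<and> chain euler k f r + chain euler k f s \<in> regular"
  proof (cases "\<epsilon> = 1")
    case True
    have "admissible_equal (chain euler k f)" for k
    proof (induction k)
      case 0
      show ?case
        using base assms(2) by (simp add: admissible_equal_def R_intros I_zero)
    qed (use True admissible_equal_step_a admissible_equal_step_b in auto)
    then show ?thesis
      by (auto simp: admissible_equal_def)
  next
    case False
    then have e: "\<epsilon> = - 1"
      using \<epsilon> by auto
    have "if even k then admissible_even (chain euler k f) else admissible_odd (chain euler k f)" for k
    proof (induction k)
      case 0
      \<comment> \<open>The constant vector has difference 0, and P passes \<open>loc\<close>, so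
        the congruence of \<open>admissible_even\<close> holds at the start.\<close>
      have "- P (loc * (f + f)) = loc * (- P (f + f))"
        by (simp only: P_mult_t mult_minus_right)
      then have "- P (loc * (f + f)) \<in> I"
        using assms(2) by (intro I_I[of "- P (f + f)"] R_intros regular_euler) auto
      then show ?case
        using base assms(2) by (simp add: admissible_even_def R_intros)
    qed (use e admissible_odd_step_a admissible_even_step_b in \<open>auto split: if_splits\<close>)
    from this[of k] show ?thesis
      using assms(1) by (auto simp: admissible_odd_def)
  qed
  then show ?thesis
    unfolding conj_Omega_eq by (intro R_add[of "_ + _"] R_sum) (auto simp: others_def)
qed

end

lemma two_variables_I: "r \<noteq> s \<Longrightarrow> e = 1 \<or> e = - 1 \<Longrightarrow> two_variables r s e"
  by (simp add: two_variables_def)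

section \<open>Removal of denominators\<close>

definition everywhere_regular :: "'n::{finite,linorder} ratfun \<Rightarrow> bool"
  where "everywhere_regular f \<longleftrightarrow>
    (\<forall>r s e. two_variables r s e \<longrightarrow> f \<in> two_variables.regular r s e)"

text \<open>Stated for one denominator at a time, so that the linear factors can be removed one
  after another without unique factorization.\<close>

definition removable :: "'n::{finite,linorder} mpoly \<Rightarrow> bool"
  where "removable q \<longleftrightarrow>
    (\<forall>f. everywhere_regular f \<longrightarrow> f * to_fract q \<in> range to_fract \<longrightarrow> f \<in> range to_fract)"

lemma everywhere_regular_to_fract_mult:
  "everywhere_regular f \<Longrightarrow> everywhere_regular (f * to_fract q)"
  unfolding everywhere_regular_def
  by (auto intro: two_variables.regular_mult two_variables.regular_to_fract)

lemma removable_1: "removable 1"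
  by (simp add: removable_def)

lemma removable_mult:
  assumes "removable p" "removable q"
  shows "removable (p * q)"
  unfolding removable_def
proof (intro allI impI)
  fix f :: "'a ratfun"
  assume f: "everywhere_regular f" "f * to_fract (p * q) \<in> range to_fract"
  have "(f * to_fract p) * to_fract q \<in> range to_fract"
    using f(2) by (simp add: mult.assoc)
  then have "f * to_fract p \<in> range to_fract"
    using assms(2) everywhere_regular_to_fract_mult[OF f(1)] unfolding removable_def by blast
  then show "f \<in> range to_fract"
    using assms(1) f(1) unfolding removable_def by blast
qed

lemma removable_power: "removable p \<Longrightarrow> removable (p ^ k)"
  by (induction k) (auto simp: removable_1 intro: removable_mult)

lemma removable_prod: "(\<And>a. a \<in> A \<Longrightarrow> removable (f a)) \<Longrightarrow> removable (\<Prod>a\<in>A. f a)"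
  by (induction A rule: infinite_finite_induct) (auto simp: removable_1 intro: removable_mult)

text \<open>If f * h is a polynomial n and f is regular along h = 0, then n vanishes there and is
  divisible by h by \<open>spec_divides\<close>.\<close>

lemma removable_linear:
  assumes "r \<noteq> s" "e = 1 \<or> e = - 1"
  shows "removable (Var s - Const e * Var r)"
  unfolding removable_def
proof (intro allI impI)
  interpret two_variables r s e
    using assms by (rule two_variables_I)
  let ?h = "Var s - Const e * Var r :: 'a mpoly"
  fix f :: "'a ratfun"
  assume f: "everywhere_regular f" "f * to_fract ?h \<in> range to_fract"
  obtain n where n: "f * to_fract ?h = to_fract n"
    using f(2) by auto
  have "f \<in> regular"
    using f(1) two_variables_axioms unfolding everywhere_regular_def by blast
  then obtain a b where ab: "f = to_fract a / to_fract b" "spec b \<noteq> 0" "b \<noteq> 0"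
    by (rule regular_E)
  have "to_fract (n * b) = to_fract (a * ?h)"
    unfolding to_fract_mult n[symmetric] using ab by simp
  then have "spec n * spec b = spec a * spec ?h"
    unfolding to_fract_eq_iff by (metis spec_mult)
  moreover have "spec ?h = 0"
    using rs by (simp add: spec_diff spec_mult spec_Const spec_Var)
  ultimately have "spec n = 0"
    using ab by simp
  then obtain q where "n = ?h * q"
    using spec_divides[of n] by auto
  then have "f * to_fract ?h = to_fract q * to_fract ?h"
    using n by (simp add: mult.commute)
  moreover have "to_fract ?h \<noteq> 0"
    using two_variables.lin_nonzero(1)[OF two_variables_I[of s r e]] assms
    by (simp add: X_def scalar_def del: to_fract_eq_0_iff)
  ultimately have "f = to_fract q"
    by (metis mult_right_cancel)
  then show "f \<in> range to_fract"
    by simp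
qed

definition disc :: "'n::{finite,linorder} mpoly"
  where "disc = (\<Prod>(i, j)\<in>{(i, j). i < j}. Var i * Var i - Var j * Var j)"

lemma removable_disc: "removable ((disc :: 'n::{finite,linorder} mpoly) ^ k)"
proof (intro removable_power)
  have "removable ((Var i - Const (- 1) * Var j) * (Var i - Const 1 * Var j))" if "i < j" for i j :: 'n
    using that by (intro removable_mult removable_linear) auto
  moreover have "(Var i - Const (- 1) * Var j) * (Var i - Const 1 * Var j) = Var i * Var i - Var j * Var j" for i j :: 'n
  proof -
    have "Const (- 1) = (- 1 :: 'n mpoly)"
      using Const_add[of 1 "- 1"] by (simp add: eq_neg_iff_add_eq_0 add.commute)
    then show ?thesis
      by (simp add: algebra_simps)
  qed
  ultimately have "removable (Var i * Var i - Var j * Var j)" if "i < j" for i j :: 'n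
    using that by metis
  then show "removable (disc :: 'n mpoly)"
    unfolding disc_def by (intro removable_prod) auto
qed

text \<open>The localization at the powers of \<open>disc\<close>. It contains the coefficients of
  the recursion and is stable under \<open>euler\<close>, so no denominators other than powers of
  \<open>disc\<close> arise.\<close>

definition disc_ring :: "'n::{finite,linorder} ratfun set"
  where "disc_ring = {f. \<exists>k. f * to_fract disc ^ k \<in> range to_fract}"

lemma disc_ring_mono:
  assumes "f * to_fract disc ^ k \<in> range to_fract" "k \<le> l"
  shows "f * to_fract disc ^ l \<in> range to_fract"
proof -
  obtain p where "f * to_fract disc ^ k = to_fract p"
    using assms(1) by auto
  moreover have "f * to_fract disc ^ l = f * to_fract disc ^ k * to_fract disc ^ (l - k)"
    using assms(2) by (simp add: mult.assoc flip: power_add)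
  ultimately have "f * to_fract disc ^ l = to_fract (p * disc ^ (l - k))"
    by (simp add: to_fract_power)
  then show ?thesis
    by (metis rangeI)
qed

lemma disc_ring_add:
  assumes "f \<in> disc_ring" "g \<in> disc_ring"
  shows "f + g \<in> disc_ring"
proof -
  obtain k l where "f * to_fract disc ^ k \<in> range to_fract" "g * to_fract disc ^ l \<in> range to_fract"
    using assms unfolding disc_ring_def by blast
  then have "f * to_fract disc ^ (max k l) \<in> range to_fract" "g * to_fract disc ^ (max k l) \<in> range to_fract"
    by (auto intro: disc_ring_mono)
  then obtain p q where "f * to_fract disc ^ (max k l) = to_fract p" "g * to_fract disc ^ (max k l) = to_fract q"
    by blast
  then have "(f + g) * to_fract disc ^ (max k l) = to_fract (p + q)"
    by (simp add: distrib_right)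
  then show ?thesis
    unfolding disc_ring_def by blast
qed

lemma disc_ring_mult:
  assumes "f \<in> disc_ring" "g \<in> disc_ring"
  shows "f * g \<in> disc_ring"
proof -
  obtain k l p q where "f * to_fract disc ^ k = to_fract p" "g * to_fract disc ^ l = to_fract q"
    using assms unfolding disc_ring_def by blast
  then have "(f * g) * to_fract disc ^ (k + l) = to_fract (p * q)"
    by (simp add: power_add mult.assoc mult.left_commute[of g])
  then show ?thesis
    unfolding disc_ring_def by blast
qed

lemma disc_ring_to_fract: "to_fract p \<in> disc_ring"
  unfolding disc_ring_def by (auto intro!: exI[of _ 0])

lemma disc_ring_minus: "f \<in> disc_ring \<Longrightarrow> - f \<in> disc_ring"
  using disc_ring_mult[OF disc_ring_to_fract[of "- 1"]] by simp

lemma disc_ring_diff: "f \<in> disc_ring \<Longrightarrow> g \<in> disc_ring \<Longrightarrow> f - g \<in> disc_ring"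
  using disc_ring_add[OF _ disc_ring_minus] by simp

lemma disc_ring_sum: "(\<And>a. a \<in> A \<Longrightarrow> f a \<in> disc_ring) \<Longrightarrow> sum f A \<in> disc_ring"
  using disc_ring_to_fract[of 0]
  by (induction A rule: infinite_finite_induct) (auto intro: disc_ring_add)

lemma disc_ring_euler:
  assumes "f \<in> disc_ring"
  shows "euler i f \<in> disc_ring"
proof -
  obtain k p where p: "f * to_fract disc ^ k = to_fract p"
    using assms unfolding disc_ring_def by blast
  let ?q = "to_fract disc ^ k"
  have "euler i f * ?q * ?q = euler i (to_fract p) * ?q - to_fract p * euler i ?q"
    unfolding p[symmetric] euler.mult by (simp add: algebra_simps)
  also have "\<dots> = to_fract (euler_mpoly i p * disc ^ k - p * euler_mpoly i (disc ^ k))"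
    by (simp add: euler_to_fract flip: to_fract_power)
  finally have "euler i f * to_fract disc ^ (k + k) =
      to_fract (euler_mpoly i p * disc ^ k - p * euler_mpoly i (disc ^ k))"
    by (simp only: power_add mult.assoc)
  then have "euler i f * to_fract disc ^ (k + k) \<in> range to_fract"
    by (metis rangeI)
  then show ?thesis
    unfolding disc_ring_def by blast
qed

lemma disc_ring_inverse:
  assumes "i \<noteq> j"
  shows "1 / ((X i)\<^sup>2 - (X j)\<^sup>2) \<in> disc_ring"
proof -
  have lt: "1 / ((X i)\<^sup>2 - (X j)\<^sup>2) \<in> disc_ring" if "i < j" for i j :: 'a
  proof -
    let ?A = "{(i, j). i < (j::'a)}"
    have e: "disc = (Var i * Var i - Var j * Var j) * (\<Prod>(i, j)\<in>?A - {(i, j)}. Var i * Var i - Var j * Var j)"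
      unfolding disc_def using that by (subst prod.remove[of _ "(i, j)"]) auto
    have d: "to_fract disc = ((X i)\<^sup>2 - (X j)\<^sup>2) * to_fract (\<Prod>(i, j)\<in>?A - {(i, j)}. Var i * Var i - Var j * Var j)"
      unfolding e to_fract_mult to_fract_diff X_def power2_eq_square ..
    have "1 / ((X i)\<^sup>2 - (X j)\<^sup>2) * to_fract disc ^ 1 = to_fract (\<Prod>(i, j)\<in>?A - {(i, j)}. Var i * Var i - Var j * Var j)"
      unfolding d using that by simp
    then show ?thesis
      unfolding disc_ring_def by blast
  qed
  show ?thesis
  proof (cases "i < j")
    case False
    then have "1 / ((X j)\<^sup>2 - (X i)\<^sup>2) \<in> disc_ring"
      using lt[of j i] assms by simp
    from disc_ring_minus[OF this] show ?thesis
      by (simp add: minus_divide_right)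
  qed (rule lt)
qed

lemma disc_ring_coef:
  assumes "i \<noteq> j"
  shows "coef_a i j \<in> disc_ring" "coef_b i j \<in> disc_ring"
proof -
  have "to_fract (2 * Var i * Var j) * (1 / ((X i)\<^sup>2 - (X j)\<^sup>2)) \<in> disc_ring"
    by (intro disc_ring_mult disc_ring_to_fract disc_ring_inverse assms)
  moreover have "to_fract 2 = (2 :: 'a ratfun)"
    using to_fract_add[of 1 "1 :: 'a mpoly"] by simp
  ultimately show "coef_a i j \<in> disc_ring"
    by (simp add: coef_a_def X_def)
  have "to_fract (2 * (Var i * Var i)) * (1 / ((X i)\<^sup>2 - (X j)\<^sup>2)) \<in> disc_ring"
    by (intro disc_ring_mult disc_ring_to_fract disc_ring_inverse assms)
  then show "coef_b i j \<in> disc_ring"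
    using \<open>to_fract 2 = (2 :: 'a ratfun)\<close> by (simp add: coef_b_def X_def power2_eq_square)
qed

abbreviation shifted_euler :: "('n \<Rightarrow>\<^sub>0 nat) \<Rightarrow> 'n::linorder \<Rightarrow> 'n ratfun \<Rightarrow> 'n ratfun"
  where "shifted_euler m \<equiv> (\<lambda>i f. euler i f + of_nat (Poly_Mapping.lookup m i) * f)"

lemma disc_ring_chain:
  assumes "f \<in> disc_ring"
  shows "chain (shifted_euler m) k f i \<in> disc_ring"
proof (induction k arbitrary: i)
  case (Suc k)
  have "of_nat n \<in> disc_ring" for n
    using disc_ring_to_fract[of "Const (of_nat n)"] by (simp flip: scalar_def)
  then show ?case
    using Suc by (auto simp: step_a_def step_b_def
        intro!: disc_ring_diff disc_ring_add disc_ring_mult disc_ring_sum disc_ring_euler disc_ring_coef)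
qed (simp add: assms)

section \<open>Homogeneity of degree 0\<close>

definition total_euler :: "'n::{finite,linorder} ratfun \<Rightarrow> 'n ratfun"
  where "total_euler f = (\<Sum>i\<in>UNIV. euler i f)"

interpretation total: derivation "total_euler :: 'n::{finite,linorder} ratfun \<Rightarrow> 'n ratfun"
  by unfold_locales
    (simp_all add: total_euler_def euler.add euler.mult sum.distrib sum_distrib_left sum_distrib_right)

lemma total_euler_X: "total_euler (X i) = X i"
  by (simp add: total_euler_def euler_X)

lemma total_euler_coef:
  assumes "i \<noteq> j"
  shows "total_euler (coef_a i j) = 0" "total_euler (coef_b i j) = 0"
proof -
  have "(X i)\<^sup>2 - (X j)\<^sup>2 \<noteq> 0"
    using assms by simp
  then show "total_euler (coef_a i j) = 0" "total_euler (coef_b i j) = 0"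
    unfolding coef_a_def coef_b_def
    by (simp_all add: total.divide total.mult total.diff total_euler_X power2_eq_square algebra_simps)
qed

lemma total_euler_commute: "total_euler (euler i f) = euler i (total_euler f)"
  by (simp add: total_euler_def euler.sum euler_commute[of i])

text \<open>The degree operator kills the coefficients and commutes with \<open>euler i\<close>, so
  each step preserves homogeneity of degree 0.\<close>

lemma total_euler_chain:
  assumes "total_euler f = 0"
  shows "total_euler (chain (shifted_euler m) k f i) = 0"
proof (induction k arbitrary: i)
  case (Suc k)
  have "total_euler (\<Sum>j\<in>UNIV - {i}. coef_a i j * chain (shifted_euler m) k f j) = 0"
    "total_euler (\<Sum>j\<in>UNIV - {i}. coef_b i j * chain (shifted_euler m) k f j) = 0"
    unfolding total.sum by (intro sum.neutral; simp add: total.mult Suc total_euler_coef)+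
  then show ?case
    by (simp add: step_a_def step_b_def total.diff total.add total.mult total_euler_commute Suc)
qed (simp add: assms)

lemma total_euler_polynomial:
  assumes "total_euler (to_fract p) = 0"
  shows "\<exists>c. to_fract p = scalar c"
proof -
  have "to_fract (\<Sum>i\<in>UNIV. euler_mpoly i p) = 0"
    using assms by (simp add: total_euler_def euler_to_fract)
  then have z: "(\<Sum>i\<in>UNIV. euler_mpoly i p) = 0"
    by (simp only: to_fract_eq_0_iff)
  have "Poly_Mapping.lookup p m = 0" if "m \<noteq> 0" for m
  proof -
    have "(\<Sum>i\<in>UNIV. of_nat (Poly_Mapping.lookup m i) * Poly_Mapping.lookup p m) = 0"
      using arg_cong[OF z, of "\<lambda>q. Poly_Mapping.lookup q m"] by (simp add: lookup_sum lookup_euler_mpoly)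
    then have "of_nat (\<Sum>i\<in>UNIV. Poly_Mapping.lookup m i) * Poly_Mapping.lookup p m = 0"
      by (simp add: sum_distrib_right)
    moreover have "(\<Sum>i\<in>UNIV. Poly_Mapping.lookup m i) \<noteq> 0"
      using that by (auto simp: poly_mapping_eq_iff fun_eq_iff)
    ultimately show ?thesis
      by (simp del: of_nat_sum)
  qed
  then have "p = Const (Poly_Mapping.lookup p 0)"
    by (intro poly_mapping_eqI) (auto simp: Const_def lookup_single when_def)
  then show ?thesis
    unfolding scalar_def by metis
qed

context two_variables
begin

lemma regular_Mon_inverse: "1 / Mon m \<in> regular"
proof -
  have "spec (Poly_Mapping.single m 1) =
      (\<Prod>i\<in>UNIV. spec (Var i) ^ Poly_Mapping.lookup m i)"
    unfolding single_eq_prod_Var by (simp add: spec_def Const.subst_prod Const.subst_power)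
  moreover have "Const \<epsilon> \<noteq> (0 :: 'n mpoly)"
    using \<epsilon> scalar_eq_iff[of \<epsilon> 0] by (auto simp: scalar_def simp del: scalar_eq_iff)
  then have "spec (Var i) \<noteq> 0" for i
    by (simp add: spec_Var Var_nonzero)
  ultimately have "spec (Poly_Mapping.single m 1) \<noteq> 0"
    by simp
  then show ?thesis
    unfolding Mon_def by (rule regular_inverse)
qed

end

text \<open>The multiplier of the monomial is everywhere regular with a power of \<open>disc\<close>
  as denominator, hence a polynomial; being homogeneous of degree 0 it is constant.\<close>

theorem conj_Omega_Mon:
  assumes "odd k"
  shows "\<exists>c. conj_Omega k (Mon m) = scalar c * Mon m"
proof -
  let ?c = "\<Sum>i\<in>UNIV. chain (shifted_euler m) k 1 i"
  have eq: "conj_Omega k (Mon m) = Mon m * ?c"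
    using chain_euler_Mon[of k m 1] by (simp add: conj_Omega_def sum_distrib_left)
  have "everywhere_regular ?c"
    unfolding everywhere_regular_def
  proof (intro allI impI)
    fix r s :: 'a and e
    assume "two_variables r s e"
    then interpret two_variables r s e .
    \<comment> \<open>Regularity was proved for \<open>chain euler\<close> only. It passes to the
      shifted chain because monomials are units along each divisor.\<close>
    have "conj_Omega k (Mon m) * (1 / Mon m) \<in> regular"
      by (intro regular_mult conj_Omega_regular assms regular_Mon_inverse)
        (simp add: Mon_def regular_to_fract)
    then show "?c \<in> regular"
      unfolding eq by simp
  qed
  moreover have "?c \<in> disc_ring"
    using disc_ring_to_fract[of 1] by (intro disc_ring_sum disc_ring_chain) simp
  ultimately have "?c \<in> range to_fract"
    using removable_disc unfolding disc_ring_def removable_def to_fract_power[symmetric] by blast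
  then obtain p where p: "?c = to_fract p"
    by auto
  have "total_euler ?c = 0"
    unfolding total.sum by (intro sum.neutral ballI total_euler_chain) simp
  then obtain c where "?c = scalar c"
    unfolding p using total_euler_polynomial by blast
  then show ?thesis
    unfolding eq by (auto simp: mult.commute)
qed

section \<open>Eigenvalues from the limit \<open>x\<^sub>1 \<gg> x\<^sub>2 \<gg> \<dots>\<close>\<close>

text \<open>The order of exponents is compatible with addition, so only the two top exponents can
  add up to \<mu> + \<nu>.\<close>

lemma lookup_mult_top:
  fixes p q :: "'n::linorder mpoly"
  assumes p: "\<forall>m>\<mu>. Poly_Mapping.lookup p m = 0" and q: "\<forall>m>\<nu>. Poly_Mapping.lookup q m = 0"
  shows "\<forall>m>\<mu> + \<nu>. Poly_Mapping.lookup (p * q) m = 0"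
    and "Poly_Mapping.lookup (p * q) (\<mu> + \<nu>) = Poly_Mapping.lookup p \<mu> * Poly_Mapping.lookup q \<nu>"
proof -
  let ?t = "\<lambda>m k. Poly_Mapping.single (m + k) (Poly_Mapping.lookup p m * Poly_Mapping.lookup q k)"
  have "p * q = (\<Sum>m\<in>Poly_Mapping.keys p. Poly_Mapping.single m (Poly_Mapping.lookup p m)) *
      (\<Sum>k\<in>Poly_Mapping.keys q. Poly_Mapping.single k (Poly_Mapping.lookup q k))"
    by (simp only: mpoly_sum_monomials[symmetric])
  then have pq: "p * q = (\<Sum>m\<in>Poly_Mapping.keys p. \<Sum>k\<in>Poly_Mapping.keys q. ?t m k)"
    by (simp add: sum_product mult_single)
  have le: "m \<le> \<mu>" "k \<le> \<nu>" if "m \<in> Poly_Mapping.keys p" "k \<in> Poly_Mapping.keys q" for m k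
    using that p q by (auto simp: in_keys_iff not_le[symmetric])
  show "\<forall>m>\<mu> + \<nu>. Poly_Mapping.lookup (p * q) m = 0"
  proof (intro allI impI)
    fix x assume x: "x > \<mu> + \<nu>"
    have "m + k \<noteq> x" if "m \<in> Poly_Mapping.keys p" "k \<in> Poly_Mapping.keys q" for m k
      using add_mono[OF le[OF that]] x by auto
    then show "Poly_Mapping.lookup (p * q) x = 0"
      unfolding pq by (simp add: lookup_sum lookup_single when_def)
  qed
  have eq: "m + k = \<mu> + \<nu> \<longleftrightarrow> m = \<mu> \<and> k = \<nu>" if "m \<in> Poly_Mapping.keys p" "k \<in> Poly_Mapping.keys q" for m k
  proof
    assume *: "m + k = \<mu> + \<nu>"
    show "m = \<mu> \<and> k = \<nu>"
    proof (rule ccontr)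
      assume "\<not> (m = \<mu> \<and> k = \<nu>)"
      then have "m < \<mu> \<or> k < \<nu>"
        using le[OF that] by auto
      then have "m + k < \<mu> + \<nu>"
        using le[OF that] add_less_le_mono add_le_less_mono by blast
      with * show False by simp
    qed
  qed auto
  have "Poly_Mapping.lookup (p * q) (\<mu> + \<nu>) =
      (\<Sum>m\<in>Poly_Mapping.keys p. \<Sum>k\<in>Poly_Mapping.keys q.
        if m = \<mu> \<and> k = \<nu> then Poly_Mapping.lookup p \<mu> * Poly_Mapping.lookup q \<nu> else 0)"
    unfolding pq by (simp add: lookup_sum lookup_single when_def eq cong: sum.cong)
      (intro sum.cong; auto)
  also have "\<dots> = (\<Sum>m\<in>Poly_Mapping.keys p. if m = \<mu> then
      (\<Sum>k\<in>Poly_Mapping.keys q. if k = \<nu> then Poly_Mapping.lookup p \<mu> * Poly_Mapping.lookup q \<nu> else 0) else 0)"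
    by (intro sum.cong) auto
  also have "\<dots> = Poly_Mapping.lookup p \<mu> * Poly_Mapping.lookup q \<nu>"
    by (auto simp: in_keys_iff)
  finally show "Poly_Mapping.lookup (p * q) (\<mu> + \<nu>) = Poly_Mapping.lookup p \<mu> * Poly_Mapping.lookup q \<nu>" .
qed

text \<open>
  \<open>\<mu>\<close> is the leading exponent of the denominator \<open>b\<close> in the lexicographic order, in which the
  smallest variable is the most significant one.
\<close>

definition has_lim :: "'n::linorder ratfun \<Rightarrow> complex \<Rightarrow> bool"
  where "has_lim f c \<longleftrightarrow> (\<exists>a b \<mu>. f = to_fract a / to_fract b \<and> Poly_Mapping.lookup b \<mu> \<noteq> 0 \<and>
    (\<forall>m>\<mu>. Poly_Mapping.lookup a m = 0) \<and> (\<forall>m>\<mu>. Poly_Mapping.lookup b m = 0) \<and>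
    Poly_Mapping.lookup a \<mu> = c * Poly_Mapping.lookup b \<mu>)"

lemma has_lim_E:
  assumes "has_lim f c"
  obtains a b \<mu> where "f = to_fract a / to_fract b" "Poly_Mapping.lookup b \<mu> \<noteq> 0"
    "\<forall>m>\<mu>. Poly_Mapping.lookup a m = 0" "\<forall>m>\<mu>. Poly_Mapping.lookup b m = 0"
    "Poly_Mapping.lookup a \<mu> = c * Poly_Mapping.lookup b \<mu>" "b \<noteq> 0"
  using assms unfolding has_lim_def by (metis lookup_zero)

lemma has_lim_unique:
  assumes "has_lim f c" "has_lim f d"
  shows "c = d"
proof -
  obtain a b \<mu> where 1: "f = to_fract a / to_fract b" "Poly_Mapping.lookup b \<mu> \<noteq> 0"
    "\<forall>m>\<mu>. Poly_Mapping.lookup a m = 0" "\<forall>m>\<mu>. Poly_Mapping.lookup b m = 0"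
    "Poly_Mapping.lookup a \<mu> = c * Poly_Mapping.lookup b \<mu>" "b \<noteq> 0"
    using assms(1) by (rule has_lim_E)
  obtain p q \<nu> where 2: "f = to_fract p / to_fract q" "Poly_Mapping.lookup q \<nu> \<noteq> 0"
    "\<forall>m>\<nu>. Poly_Mapping.lookup p m = 0" "\<forall>m>\<nu>. Poly_Mapping.lookup q m = 0"
    "Poly_Mapping.lookup p \<nu> = d * Poly_Mapping.lookup q \<nu>" "q \<noteq> 0"
    using assms(2) by (rule has_lim_E)
  have "to_fract (a * q) = to_fract (b * p)"
    using 1(1,6) 2(1,6) by (simp add: field_simps)
  then have "a * q = b * p"
    by (simp only: to_fract_eq_iff)
  then show ?thesis
    using lookup_mult_top(2)[OF 1(3) 2(4)] lookup_mult_top(2)[OF 1(4) 2(3)] 1 2 by simp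
qed

lemma has_lim_add:
  assumes "has_lim f c" "has_lim g d"
  shows "has_lim (f + g) (c + d)"
proof -
  obtain a b \<mu> where 1: "f = to_fract a / to_fract b" "Poly_Mapping.lookup b \<mu> \<noteq> 0"
    "\<forall>m>\<mu>. Poly_Mapping.lookup a m = 0" "\<forall>m>\<mu>. Poly_Mapping.lookup b m = 0"
    "Poly_Mapping.lookup a \<mu> = c * Poly_Mapping.lookup b \<mu>" "b \<noteq> 0"
    using assms(1) by (rule has_lim_E)
  obtain p q \<nu> where 2: "g = to_fract p / to_fract q" "Poly_Mapping.lookup q \<nu> \<noteq> 0"
    "\<forall>m>\<nu>. Poly_Mapping.lookup p m = 0" "\<forall>m>\<nu>. Poly_Mapping.lookup q m = 0"
    "Poly_Mapping.lookup p \<nu> = d * Poly_Mapping.lookup q \<nu>" "q \<noteq> 0"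
    using assms(2) by (rule has_lim_E)
  have "f + g = to_fract (a * q + b * p) / to_fract (b * q)"
    using 1 2 by (simp add: field_simps)
  then show ?thesis
    unfolding has_lim_def
    using lookup_mult_top[OF 1(3) 2(4)] lookup_mult_top[OF 1(4) 2(3)] lookup_mult_top[OF 1(4) 2(4)] 1 2
    by (intro exI[of _ "a * q + b * p"] exI[of _ "b * q"] exI[of _ "\<mu> + \<nu>"])
      (auto simp: lookup_add algebra_simps)
qed

lemma has_lim_mult:
  assumes "has_lim f c" "has_lim g d"
  shows "has_lim (f * g) (c * d)"
proof -
  obtain a b \<mu> where 1: "f = to_fract a / to_fract b" "Poly_Mapping.lookup b \<mu> \<noteq> 0"
    "\<forall>m>\<mu>. Poly_Mapping.lookup a m = 0" "\<forall>m>\<mu>. Poly_Mapping.lookup b m = 0"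
    "Poly_Mapping.lookup a \<mu> = c * Poly_Mapping.lookup b \<mu>" "b \<noteq> 0"
    using assms(1) by (rule has_lim_E)
  obtain p q \<nu> where 2: "g = to_fract p / to_fract q" "Poly_Mapping.lookup q \<nu> \<noteq> 0"
    "\<forall>m>\<nu>. Poly_Mapping.lookup p m = 0" "\<forall>m>\<nu>. Poly_Mapping.lookup q m = 0"
    "Poly_Mapping.lookup p \<nu> = d * Poly_Mapping.lookup q \<nu>" "q \<noteq> 0"
    using assms(2) by (rule has_lim_E)
  have "f * g = to_fract (a * p) / to_fract (b * q)"
    using 1 2 by simp
  then show ?thesis
    unfolding has_lim_def
    using lookup_mult_top[OF 1(3) 2(3)] lookup_mult_top[OF 1(4) 2(4)] 1 2
    by (intro exI[of _ "a * p"] exI[of _ "b * q"] exI[of _ "\<mu> + \<nu>"]) auto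
qed

lemma has_lim_inverse:
  assumes "has_lim f c" "c \<noteq> 0"
  shows "has_lim (1 / f) (1 / c)"
proof -
  obtain a b \<mu> where 1: "f = to_fract a / to_fract b" "Poly_Mapping.lookup b \<mu> \<noteq> 0"
    "\<forall>m>\<mu>. Poly_Mapping.lookup a m = 0" "\<forall>m>\<mu>. Poly_Mapping.lookup b m = 0"
    "Poly_Mapping.lookup a \<mu> = c * Poly_Mapping.lookup b \<mu>" "b \<noteq> 0"
    using assms(1) by (rule has_lim_E)
  show ?thesis
    unfolding has_lim_def
    using 1 assms(2) by (intro exI[of _ b] exI[of _ a] exI[of _ \<mu>]) auto
qed

text \<open>At the top exponent \<mu> both a and b are multiplied by the same number \<mu>_i, so the
  top terms of the quotient rule cancel.\<close>

lemma has_lim_euler: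
  assumes "has_lim f c"
  shows "has_lim (euler i f) 0"
proof -
  obtain a b \<mu> where 1: "f = to_fract a / to_fract b" "Poly_Mapping.lookup b \<mu> \<noteq> 0"
    "\<forall>m>\<mu>. Poly_Mapping.lookup a m = 0" "\<forall>m>\<mu>. Poly_Mapping.lookup b m = 0"
    "Poly_Mapping.lookup a \<mu> = c * Poly_Mapping.lookup b \<mu>" "b \<noteq> 0"
    using assms by (rule has_lim_E)
  have e: "\<forall>m>\<mu>. Poly_Mapping.lookup (euler_mpoly i a) m = 0" "\<forall>m>\<mu>. Poly_Mapping.lookup (euler_mpoly i b) m = 0"
    using 1 by (auto simp: lookup_euler_mpoly)
  show ?thesis
    unfolding has_lim_def 1(1) euler_quotient[OF 1(6)]
    using lookup_mult_top[OF e(1) 1(4)] lookup_mult_top[OF 1(3) e(2)] lookup_mult_top[OF 1(4) 1(4)] 1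
    by (intro exI[of _ "euler_mpoly i a * b - a * euler_mpoly i b"] exI[of _ "b * b"] exI[of _ "\<mu> + \<mu>"])
      (auto simp: lookup_minus lookup_euler_mpoly)
qed

lemma has_lim_polynomial:
  assumes "\<forall>m>\<mu>. Poly_Mapping.lookup p m = 0"
  shows "has_lim (to_fract p / Mon \<mu>) (Poly_Mapping.lookup p \<mu>)"
  unfolding has_lim_def Mon_def using assms
  by (intro exI[of _ p] exI[of _ "Poly_Mapping.single \<mu> 1"] exI[of _ \<mu>])
    (auto simp: lookup_single when_def)

lemma has_lim_scalar: "has_lim (scalar c) c"
proof -
  have "\<forall>m>0. Poly_Mapping.lookup (Const c) m = 0"
    by (auto simp: Const_def lookup_single when_def)
  from has_lim_polynomial[OF this] show ?thesis
    by (simp add: scalar_def Const_def)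
qed

lemma has_lim_scalar_mult: "has_lim f d \<Longrightarrow> has_lim (scalar c * f) (c * d)"
  by (rule has_lim_mult[OF has_lim_scalar])

lemma has_lim_diff: "has_lim f c \<Longrightarrow> has_lim g d \<Longrightarrow> has_lim (f - g) (c - d)"
  using has_lim_add[OF _ has_lim_scalar_mult[of g d "- 1"], of f c] by (simp add: scalar_minus)

lemma has_lim_sum:
  assumes "\<And>a. a \<in> A \<Longrightarrow> has_lim (f a) (c a)"
  shows "has_lim (\<Sum>a\<in>A. f a) (\<Sum>a\<in>A. c a)"
  using assms has_lim_scalar[of 0]
  by (induction A rule: infinite_finite_induct) (auto intro: has_lim_add)

lemma has_lim_prod:
  assumes "\<And>a. a \<in> A \<Longrightarrow> has_lim (f a) (c a)"
  shows "has_lim (\<Prod>a\<in>A. f a) (\<Prod>a\<in>A. c a)"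
  using assms has_lim_scalar[of 1]
  by (induction A rule: infinite_finite_induct) (auto intro: has_lim_mult)

lemma single_less_single:
  fixes i j :: "'n::linorder"
  assumes "i < j" "k > 0"
  shows "Poly_Mapping.single j l < Poly_Mapping.single i (k::nat)"
  using assms unfolding less_poly_mapping.rep_eq less_fun_def
  by (intro exI[of _ i]) (auto simp: lookup_single when_def)

lemma has_lim_ratio:
  assumes "i < j"
  shows "has_lim (X j / X i) 0"
proof -
  have less: "Poly_Mapping.single j (1::nat) < Poly_Mapping.single i 1"
    using assms by (intro single_less_single) auto
  then have "\<forall>m>Poly_Mapping.single i 1. Poly_Mapping.lookup (Var j) m = 0"
    by (auto simp: lookup_Var)
  from has_lim_polynomial[OF this] show ?thesis
    using less_imp_neq[OF assms] by (simp add: lookup_Var single_exponent_eq_iff Mon_single[of _ 1, simplified] X_def)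
qed

lemma has_lim_theta:
  assumes "i < j"
  shows "has_lim ((X i - X j) / (X i + X j)) 1"
proof -
  have "has_lim ((scalar 1 - X j / X i) * (1 / (scalar 1 + X j / X i))) ((1 - 0) * (1 / (1 + 0)))"
    by (intro has_lim_mult has_lim_diff has_lim_inverse has_lim_add has_lim_scalar has_lim_ratio assms) simp
  moreover have "(1 - X j / X i) * (1 / (1 + X j / X i)) = (X i - X j) / (X i + X j)"
  proof -
    have "1 - X j / X i = (X i - X j) / X i" "1 + X j / X i = (X i + X j) / X i"
      by (simp_all add: field_simps)
    then show ?thesis
      by simp
  qed
  ultimately show ?thesis
    by simp
qed

lemma has_lim_coef_lt:
  assumes "i < j"
  shows "has_lim (coef_a i j) 0" "has_lim (coef_b i j) 2"
proof -
  have nz: "(X i)\<^sup>2 - (X j)\<^sup>2 \<noteq> 0"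
    using assms by simp
  let ?r = "X j / X i"
  have b: "has_lim (scalar 2 * (1 / (scalar 1 - ?r * ?r))) (2 * (1 / (1 - 0 * 0)))"
    by (intro has_lim_mult has_lim_diff has_lim_inverse has_lim_scalar has_lim_ratio assms) simp
  have e: "2 * (1 / (1 - ?r * ?r)) = coef_b i j"
    using nz by (simp add: coef_b_def field_simps power2_eq_square)
  show "has_lim (coef_b i j) 2"
    using b by (simp add: e[symmetric])
  have "has_lim (?r * coef_b i j) (0 * 2)"
    by (intro has_lim_mult has_lim_ratio assms) fact
  moreover have "?r * coef_b i j = coef_a i j"
    by (simp add: coef_a_def coef_b_def power2_eq_square)
  ultimately show "has_lim (coef_a i j) 0"
    by simp
qed

text \<open>1 / sinh tends to 0, and 1 + coth to 2 or 0 according to the sign of its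
  argument.\<close>

lemma has_lim_coef:
  assumes "i \<noteq> j"
  shows "has_lim (coef_a i j) 0" "has_lim (coef_b i j) (if i < j then 2 else 0)"
proof -
  have "has_lim (coef_a i j) 0 \<and> has_lim (coef_b i j) (if i < j then 2 else 0)"
  proof (cases "i < j")
    case False
    then have ji: "j < i"
      using assms by simp
    have "has_lim (scalar (- 1) * coef_a j i) (- 1 * 0)" "has_lim (scalar 2 - coef_b j i) (2 - 2)"
      by (intro has_lim_scalar_mult has_lim_diff has_lim_scalar has_lim_coef_lt ji)+
    then show ?thesis
      using False assms by (simp add: coef_a_antisym[of i j] coef_b_swap[of j i] scalar_minus)
  qed (simp add: has_lim_coef_lt)
  then show "has_lim (coef_a i j) 0" "has_lim (coef_b i j) (if i < j then 2 else 0)"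
    by simp_all
qed

text \<open>The limit of the shifted recursion with exponents l: the coefficients become 0, or 2 for
  \<open>coef_b\<close> with j > i, so the system is triangular.\<close>

primrec ev :: "('n \<Rightarrow> nat) \<Rightarrow> nat \<Rightarrow> 'n::{finite,linorder} \<Rightarrow> complex" where
  "ev l 0 = (\<lambda>i. 1)"
| "ev l (Suc k) = (\<lambda>i. if even k then of_nat (l i) * ev l k i
    else (of_nat (l i) - 1) * ev l k i - 2 * (\<Sum>j\<in>{i<..}. ev l k j))"

definition eig :: "('n::{finite,linorder} \<Rightarrow> nat) \<Rightarrow> nat \<Rightarrow> complex"
  where "eig l k = (\<Sum>i\<in>UNIV. ev l k i)"

lemma has_lim_chain:
  assumes "has_lim f c"
  shows "has_lim (chain (shifted_euler m) k f i) (c * ev (Poly_Mapping.lookup m) k i)"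
proof (induction k arbitrary: i)
  case (Suc k)
  let ?u = "chain (shifted_euler m) k f" and ?l = "Poly_Mapping.lookup m"
  have e: "has_lim (euler i (?u i) + scalar (of_nat (?l i)) * ?u i) (0 + of_nat (?l i) * (c * ev ?l k i))"
    by (intro has_lim_add has_lim_euler[OF Suc] has_lim_scalar_mult Suc)
  show ?case
  proof (cases "even k")
    case True
    have "has_lim (\<Sum>j\<in>UNIV - {i}. coef_a i j * ?u j) (\<Sum>j\<in>UNIV - {i}. 0 * (c * ev ?l k j))"
      by (intro has_lim_sum has_lim_mult has_lim_coef Suc) auto
    from has_lim_diff[OF e this] show ?thesis
      using True by (simp add: step_a_def mult.left_commute)
  next
    case False
    have "has_lim (\<Sum>j\<in>UNIV - {i}. coef_b i j * ?u j)
        (\<Sum>j\<in>UNIV - {i}. (if i < j then 2 else 0) * (c * ev ?l k j))"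
      by (intro has_lim_sum has_lim_mult has_lim_coef Suc) auto
    moreover have "(\<Sum>j\<in>UNIV - {i}. (if i < j then 2 else 0) * (c * ev ?l k j)) = c * (2 * (\<Sum>j\<in>{i<..}. ev ?l k j))"
    proof -
      have "(\<Sum>j\<in>UNIV - {i}. (if i < j then 2 else 0) * (c * ev ?l k j)) =
          (\<Sum>j\<in>{i<..}. (if i < j then 2 else 0) * (c * ev ?l k j))"
        by (intro sum.mono_neutral_right) auto
      also have "\<dots> = (\<Sum>j\<in>{i<..}. c * (2 * ev ?l k j))"
        by (intro sum.cong) auto
      finally show ?thesis
        by (simp add: sum_distrib_left)
    qed
    ultimately have "has_lim (\<Sum>j\<in>UNIV - {i}. coef_b i j * ?u j) (c * (2 * (\<Sum>j\<in>{i<..}. ev ?l k j)))"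
      by simp
    from has_lim_diff[OF has_lim_diff[OF e Suc[of i]] this] show ?thesis
      using False by (simp add: step_b_def algebra_simps)
  qed
qed (simp add: assms)

text \<open>Besides monomials (f = 1) this serves any eigenfunction that is asymptotic to a multiple
  of a monomial, since f only has to possess a nonzero limit.\<close>

lemma conj_Omega_eigenvalue:
  assumes "has_lim f a" "a \<noteq> 0" "conj_Omega k (Mon m * f) = scalar c * (Mon m * f)"
  shows "c = eig (Poly_Mapping.lookup m) k"
proof -
  have "Mon m * (scalar c * f) = Mon m * (\<Sum>i\<in>UNIV. chain (shifted_euler m) k f i)"
    using assms(3) by (simp add: conj_Omega_def chain_euler_Mon sum_distrib_left mult.left_commute)
  then have "scalar c * f = (\<Sum>i\<in>UNIV. chain (shifted_euler m) k f i)"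
    by simp
  moreover have "has_lim (\<Sum>i\<in>UNIV. chain (shifted_euler m) k f i)
      (\<Sum>i\<in>UNIV. a * ev (Poly_Mapping.lookup m) k i)"
    by (intro has_lim_sum has_lim_chain assms)
  ultimately have "c * a = (\<Sum>i\<in>UNIV. a * ev (Poly_Mapping.lookup m) k i)"
    using has_lim_scalar_mult[OF assms(1)] has_lim_unique by metis
  then show ?thesis
    using assms(2) by (simp add: eig_def flip: sum_distrib_left)
qed

lemma conj_Omega_Mon_eig:
  assumes "odd k"
  shows "conj_Omega k (Mon m) = scalar (eig (Poly_Mapping.lookup m) k) * Mon m"
proof -
  obtain c where c: "conj_Omega k (Mon m) = scalar c * Mon m"
    using conj_Omega_Mon[OF assms] by blast
  then have "c = eig (Poly_Mapping.lookup m) k"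
    using has_lim_scalar[of 1] by (intro conj_Omega_eigenvalue[of "scalar 1" 1]) simp_all
  with c show ?thesis by simp
qed

section \<open>The generating function of the eigenvalues\<close>

definition qm :: "nat \<Rightarrow> complex" where "qm l = of_nat l * (of_nat l - 1)"
definition qp :: "nat \<Rightarrow> complex" where "qp l = of_nat l * (of_nat l + 1)"

text \<open>The constant 1 and the factor -2 match the equation of the series U in
  \<open>gen_product\<close>: \<open>gen\<close> is its right-hand side with the sum taken over all
  variables.\<close>

definition gen :: "('n::{finite,linorder} \<Rightarrow> nat) \<Rightarrow> complex fps"
  where "gen l = Abs_fps (\<lambda>r. if r = 0 then 1 else - 2 * eig l (2 * r - 1))"

definition pow :: "('n::finite \<Rightarrow> nat) \<Rightarrow> nat \<Rightarrow> complex"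
  where "pow l j = (\<Sum>i\<in>UNIV. qm (l i) ^ j - qp (l i) ^ j)"

text \<open>The even-indexed values form series U i that solve a triangular system. Adjoining a new
  smallest index multiplies the partial right-hand side by (1 - qp t) / (1 - qm t).\<close>

lemma gen_product:
  "gen l * (\<Prod>i\<in>UNIV. 1 - fps_const (qm (l i)) * fps_X) =
    (\<Prod>i\<in>UNIV. 1 - fps_const (qp (l i)) * fps_X)"
proof -
  define U where "U i = Abs_fps (\<lambda>r. ev l (2 * r) i)" for i :: 'a
  have even_step: "ev l (2 * Suc r) i =
      qm (l i) * ev l (2 * r) i - 2 * (\<Sum>j\<in>{i<..}. of_nat (l j) * ev l (2 * r) j)" for r i
    by (simp add: qm_def algebra_simps)
  have U: "U i * (1 - fps_const (qm (l i)) * fps_X) =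
      1 - 2 * fps_X * (\<Sum>j\<in>{i<..}. fps_const (of_nat (l j)) * U j)" for i
  proof (rule fps_ext)
    fix r
    have c: "fps_nth (\<Sum>j\<in>{i<..}. fps_const (of_nat (l j)) * U j) r =
      (\<Sum>j\<in>{i<..}. of_nat (l j) * ev l (2 * r) j)" for r
      by (simp add: fps_sum_nth U_def)
    have two: "fps_nth (1 - 2 * fps_X * f) r = (if r = 0 then 1 else - 2 * fps_nth f (r - 1))" for f :: "complex fps" and r
      by (simp add: mult.assoc numeral_fps_const)
    have "fps_nth (U i * (1 - fps_const (qm (l i)) * fps_X)) r =
      fps_nth (U i) r - (if r = 0 then 0 else qm (l i) * fps_nth (U i) (r - 1))"
      by (simp add: algebra_simps)
    then show "fps_nth (U i * (1 - fps_const (qm (l i)) * fps_X)) r =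
      fps_nth (1 - 2 * fps_X * (\<Sum>j\<in>{i<..}. fps_const (of_nat (l j)) * U j)) r"
      unfolding two c by (cases r) (simp_all add: U_def even_step del: mult_Suc_right)
  qed
  \<comment> \<open>Induction over sets closed under larger indices: the indices above the new
    minimum b are then exactly those already treated, as the equation for U b requires.\<close>
  have part: "finite T \<Longrightarrow> (\<forall>i\<in>T. {i<..} \<subseteq> T) \<longrightarrow>
      (1 - 2 * fps_X * (\<Sum>j\<in>T. fps_const (of_nat (l j)) * U j)) * (\<Prod>i\<in>T. 1 - fps_const (qm (l i)) * fps_X) =
      (\<Prod>i\<in>T. 1 - fps_const (qp (l i)) * fps_X)" for T :: "'a set"
  proof (induction T rule: finite_linorder_min_induct)
    case (insert b A)
    show ?case
    proof
      assume up: "\<forall>i\<in>insert b A. {i<..} \<subseteq> insert b A"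
      have A: "{b<..} = A"
        using up insert by (auto simp: subset_iff)
      have upA: "\<forall>i\<in>A. {i<..} \<subseteq> A"
        using A by auto
      let ?Pm = "\<Prod>i\<in>A. 1 - fps_const (qm (l i)) * fps_X"
      let ?S = "\<Sum>j\<in>A. fps_const (of_nat (l j)) * U j"
      let ?m = "1 - fps_const (qm (l b)) * fps_X"
      have nb: "b \<notin> A" "finite A"
        using insert by auto
      have "(1 - 2 * fps_X * (fps_const (of_nat (l b)) * U b + ?S)) * (?m * ?Pm) =
          (1 - 2 * fps_X * ?S) * ?Pm * ?m - 2 * fps_X * fps_const (of_nat (l b)) * (U b * ?m) * ?Pm"
        by (simp add: algebra_simps)
      also have "\<dots> = (1 - 2 * fps_X * ?S) * ?Pm * (?m - 2 * fps_X * fps_const (of_nat (l b)))"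
        unfolding U A by (simp add: algebra_simps)
      \<comment> \<open>This is l(l - 1) + 2l = l(l + 1).\<close>
      also have "?m - 2 * fps_X * fps_const (of_nat (l b)) = 1 - fps_const (qp (l b)) * fps_X"
        by (simp add: qm_def qp_def fps_eq_iff algebra_simps numeral_fps_const)
      also have "(1 - 2 * fps_X * ?S) * ?Pm = (\<Prod>i\<in>A. 1 - fps_const (qp (l i)) * fps_X)"
        using insert.IH upA by blast
      finally show "(1 - 2 * fps_X * (\<Sum>j\<in>insert b A. fps_const (of_nat (l j)) * U j)) *
          (\<Prod>i\<in>insert b A. 1 - fps_const (qm (l i)) * fps_X) =
          (\<Prod>i\<in>insert b A. 1 - fps_const (qp (l i)) * fps_X)"
        unfolding sum.insert[OF nb(2,1)] prod.insert[OF nb(2,1)] by (simp only: mult.commute)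
    qed
  qed simp
  have "gen l = 1 - 2 * fps_X * (\<Sum>j\<in>UNIV. fps_const (of_nat (l j)) * U j)"
  proof (rule fps_ext)
    fix r
    have "eig l (2 * r' + 1) = (\<Sum>j\<in>UNIV. of_nat (l j) * ev l (2 * r') j)" for r'
      by (simp add: eig_def)
    then show "fps_nth (gen l) r = fps_nth (1 - 2 * fps_X * (\<Sum>j\<in>UNIV. fps_const (of_nat (l j)) * U j)) r"
      by (cases r) (simp_all add: gen_def U_def mult.assoc numeral_fps_const fps_sum_nth)
  qed
  then show ?thesis
    using part[of UNIV] by simp
qed

lemma fps_deriv_prod_linear:
  fixes a :: "'a \<Rightarrow> complex"
  shows "fps_deriv (\<Prod>i\<in>A. 1 - fps_const (a i) * fps_X) =
    - (\<Sum>i\<in>A. Abs_fps (\<lambda>j. a i ^ Suc j)) * (\<Prod>i\<in>A. 1 - fps_const (a i) * fps_X)"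
proof (induction A rule: infinite_finite_induct)
  case (insert x F)
  have "Abs_fps (\<lambda>j. a x ^ Suc j) * (1 - fps_const (a x) * fps_X) = fps_const (a x)"
  proof (rule fps_ext)
    fix r
    show "fps_nth (Abs_fps (\<lambda>j. a x ^ Suc j) * (1 - fps_const (a x) * fps_X)) r = fps_nth (fps_const (a x)) r"
      by (cases r) (simp_all add: algebra_simps)
  qed
  then have d: "fps_deriv (1 - fps_const (a x) * fps_X) = - (Abs_fps (\<lambda>j. a x ^ Suc j) * (1 - fps_const (a x) * fps_X))"
    by simp
  have e: "b * (- s * p) + - (c * b) * p = - (c + s) * (b * p)" for b c s p :: "complex fps"
    by (simp add: algebra_simps)
  show ?case
    unfolding prod.insert[OF insert(1,2)] sum.insert[OF insert(1,2)] fps_deriv_mult d insert.IH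
    by (rule e)
qed simp_all

text \<open>Coefficients of the logarithmic derivative of \<open>gen_product\<close>; the zeros of
  numerator and denominator contribute to \<open>pow\<close> with opposite signs.\<close>

lemma gen_Newton:
  "of_nat (Suc r) * fps_nth (gen l) (Suc r) = (\<Sum>i=0..r. fps_nth (gen l) i * pow l (Suc (r - i)))"
proof -
  let ?A = "\<Prod>i\<in>UNIV. 1 - fps_const (qm (l i)) * fps_X" and ?B = "\<Prod>i\<in>UNIV. 1 - fps_const (qp (l i)) * fps_X"
  let ?a = "\<Sum>i\<in>UNIV. Abs_fps (\<lambda>j. qm (l i) ^ Suc j)" and ?b = "\<Sum>i\<in>UNIV. Abs_fps (\<lambda>j. qp (l i) ^ Suc j)"
  have "fps_deriv (gen l * ?A) = fps_deriv ?B"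
    by (simp only: gen_product)
  then have "fps_deriv (gen l) * ?A + gen l * (- ?a * ?A) = - ?b * (gen l * ?A)"
    unfolding gen_product[symmetric] fps_deriv_mult fps_deriv_prod_linear
    by (metis fps_deriv_mult fps_deriv_prod_linear gen_product add.commute)
  then have "(fps_deriv (gen l) - gen l * (?a - ?b)) * ?A = 0"
    by (simp add: algebra_simps)
  moreover have "?A \<noteq> 0"
  proof -
    have "fps_nth (1 - fps_const c * fps_X) 0 \<noteq> 0" for c :: complex
      by simp
    then have "1 - fps_const c * fps_X \<noteq> 0" for c :: complex
      by (metis fps_zero_nth)
    then show ?thesis
      by simp
  qed
  ultimately have "fps_deriv (gen l) = gen l * (?a - ?b)"
    by simp
  from arg_cong[OF this, of "\<lambda>f. fps_nth f r"] show ?thesis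
    by (simp add: fps_mult_nth fps_sum_nth pow_def sum_subtractf)
qed

section \<open>Newton's identities for the operators\<close>

definition qm_op :: "'n::linorder \<Rightarrow> 'n ratfun \<Rightarrow> 'n ratfun"
  where "qm_op i f = euler i (euler i f) - euler i f"
definition qp_op :: "'n::linorder \<Rightarrow> 'n ratfun \<Rightarrow> 'n ratfun"
  where "qp_op i f = euler i (euler i f) + euler i f"

definition pow_op :: "nat \<Rightarrow> 'n ratfun \<Rightarrow> 'n::{finite,linorder} ratfun"
  where "pow_op j f = (\<Sum>i\<in>UNIV. (qm_op i ^^ j) f - (qp_op i ^^ j) f)"

definition gen_op :: "nat \<Rightarrow> 'n ratfun \<Rightarrow> 'n::{finite,linorder} ratfun"
  where "gen_op r f = (if r = 0 then f else - 2 * conj_Omega (2 * r - 1) f)"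

lemma diff_op_iterate:
  assumes "diff_op T"
  shows "diff_op (\<lambda>f. (qm_op i ^^ j) (T f))" "diff_op (\<lambda>f. (qp_op i ^^ j) (T f))"
  using assms by (induction j) (auto simp: qm_op_def qp_op_def intro!: diff_op_intros)

lemma diff_op_pow_op: "diff_op T \<Longrightarrow> diff_op (\<lambda>f. pow_op j (T f))"
  unfolding pow_op_def by (intro diff_op_intros diff_op_iterate)

lemma diff_op_gen_op: "diff_op (gen_op r)"
  unfolding gen_op_def[abs_def] using diff_op_mult[OF diff_op_conj_Omega, of "- 2"]
  by (cases "r = 0") (simp_all add: diff_op_id)

lemma qm_op_eigen:
  assumes "euler i f = of_nat l * f"
  shows "(qm_op i ^^ j) f = scalar (qm l ^ j) * f" "(qp_op i ^^ j) f = scalar (qp l ^ j) * f"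
proof -
  have e: "euler i f = scalar (of_nat l) * f"
    using assms by simp
  have 1: "qm_op i f = scalar (qm l) * f" "qp_op i f = scalar (qp l) * f"
    unfolding qm_op_def qp_op_def e euler_scalar_mult
    by (simp_all add: qm_def qp_def scalar_mult scalar_diff scalar_add algebra_simps)
  have 2: "qm_op i (scalar c * f) = scalar c * qm_op i f" "qp_op i (scalar c * f) = scalar c * qp_op i f" for c
    by (simp_all only: qm_op_def qp_op_def euler_scalar_mult right_diff_distrib distrib_left)
  have iterate: "(T ^^ j) f = scalar (c ^ j) * f"
    if "T f = scalar c * f" "\<And>a. T (scalar a * f) = scalar a * T f" for T c
  proof (induction j)
    case (Suc j)
    then have "(T ^^ Suc j) f = scalar (c ^ j) * (scalar c * f)"
      by (simp add: that)
    then show ?case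
      by (simp add: scalar_mult mult_ac)
  qed simp
  show "(qm_op i ^^ j) f = scalar (qm l ^ j) * f" "(qp_op i ^^ j) f = scalar (qp l ^ j) * f"
    by (rule iterate, rule 1, rule 2)+
qed

lemma pow_op_Mon: "pow_op j (Mon m) = scalar (pow (Poly_Mapping.lookup m) j) * Mon m"
  by (simp add: pow_op_def pow_def qm_op_eigen[OF euler_Mon] scalar_sum scalar_diff sum_distrib_right left_diff_distrib)

lemma gen_op_Mon: "gen_op r (Mon m) = scalar (fps_nth (gen (Poly_Mapping.lookup m)) r) * Mon m"
proof (cases "r = 0")
  case False
  then have "odd (2 * r - 1)"
    by simp
  from conj_Omega_Mon_eig[OF this, of m] False show ?thesis
    by (simp add: gen_op_def gen_def scalar_mult scalar_minus)
qed (simp add: gen_op_def gen_def)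

lemma pow_op_scalar: "pow_op j (scalar c * f) = scalar c * pow_op j f"
  using diff_op_scalar[OF diff_op_pow_op[OF diff_op_id]] .

text \<open>Both sides are differential operators, and on monomials the claim is
  \<open>gen_Newton\<close>. This is the passage from eigenvalues to operators.\<close>

lemma gen_op_Newton:
  fixes f :: "'n::{finite,linorder} ratfun"
  shows "of_nat (Suc r) * gen_op (Suc r) f = (\<Sum>i=0..r. pow_op (Suc (r - i)) (gen_op i f))"
proof (rule diff_op_eqI[where T = "\<lambda>f. of_nat (Suc r) * gen_op (Suc r) f"])
  show "diff_op (\<lambda>f. of_nat (Suc r) * gen_op (Suc r) f)"
    by (intro diff_op_intros diff_op_gen_op)
  show "diff_op (\<lambda>f. \<Sum>i=0..r. pow_op (Suc (r - i)) (gen_op i f))"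
    by (intro diff_op_intros diff_op_pow_op diff_op_gen_op)
  fix m :: "'n \<Rightarrow>\<^sub>0 nat"
  let ?l = "Poly_Mapping.lookup m"
  have "of_nat (Suc r) * gen_op (Suc r) (Mon m) = scalar (of_nat (Suc r) * fps_nth (gen ?l) (Suc r)) * Mon m"
    by (simp add: gen_op_Mon scalar_mult scalar_add algebra_simps)
  also have "\<dots> = (\<Sum>i=0..r. pow_op (Suc (r - i)) (gen_op i (Mon m)))"
    unfolding gen_Newton gen_op_Mon pow_op_scalar pow_op_Mon
    by (simp add: scalar_sum scalar_mult sum_distrib_right mult.assoc)
  finally show "of_nat (Suc r) * gen_op (Suc r) (Mon m) = (\<Sum>i=0..r. pow_op (Suc (r - i)) (gen_op i (Mon m)))" .
qed

text \<open>Newton's recursion determines \<open>gen_op\<close> from the operators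
  \<open>pow_op\<close>, division by r being possible in characteristic 0.\<close>

lemma gen_op_eigen:
  assumes "\<And>j. pow_op (Suc j) f = scalar (pow l (Suc j)) * f"
  shows "gen_op r f = scalar (fps_nth (gen l) r) * f"
proof (induction r rule: less_induct)
  case (less r)
  show ?case
  proof (cases r)
    case 0
    then show ?thesis by (simp add: gen_op_def gen_def)
  next
    case (Suc k)
    have "of_nat (Suc k) * gen_op (Suc k) f = (\<Sum>i=0..k. scalar (fps_nth (gen l) i) * (scalar (pow l (Suc (k - i))) * f))"
      unfolding gen_op_Newton using less Suc
      by (intro sum.cong refl) (simp add: pow_op_scalar assms)
    also have "\<dots> = scalar (of_nat (Suc k) * fps_nth (gen l) (Suc k)) * f"
      unfolding gen_Newton by (simp add: scalar_sum scalar_mult sum_distrib_right mult.assoc)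
    also have "\<dots> = of_nat (Suc k) * (scalar (fps_nth (gen l) (Suc k)) * f)"
      by (simp only: scalar_mult scalar_of_nat mult.assoc)
    finally show ?thesis
      unfolding Suc by (simp only: mult_left_cancel[OF of_nat_neq_0])
  qed
qed

lemma conj_Omega_eigen:
  assumes "\<And>j. pow_op (Suc j) f = scalar (pow l (Suc j)) * f" "odd k"
  shows "conj_Omega k f = scalar (eig l k) * f"
proof -
  obtain r where k: "k = 2 * r + 1"
    using assms(2) by (rule oddE)
  have "- 2 * conj_Omega k f = - 2 * (scalar (eig l k) * f)"
    using gen_op_eigen[OF assms(1), of "Suc r"]
    by (simp add: gen_op_def gen_def k scalar_mult scalar_minus)
  then show ?thesis
    by simp
qed

text \<open>The first two Newton identities: qm - qp = -2 l gives the square of the sum, and qm^2 -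
  qp^2 = -4 l^3 the sum of cubes.\<close>

lemma eig_3: "eig l 3 = (\<Sum>i\<in>UNIV. of_nat (l i) ^ 3) - (\<Sum>i\<in>UNIV. of_nat (l i))\<^sup>2"
proof -
  let ?s = "\<Sum>i\<in>UNIV. of_nat (l i) :: complex" and ?t = "\<Sum>i\<in>UNIV. of_nat (l i) ^ 3 :: complex"
  have p1: "pow l 1 = - 2 * ?s"
    unfolding pow_def sum_distrib_left
    by (intro sum.cong refl) (simp add: qm_def qp_def algebra_simps)
  have p2: "pow l 2 = - 4 * ?t"
    unfolding pow_def sum_distrib_left
    by (intro sum.cong refl) (simp add: qm_def qp_def algebra_simps power2_eq_square power3_eq_cube)
  have g: "fps_nth (gen l) 0 = 1" "fps_nth (gen l) 1 = pow l 1" "fps_nth (gen l) 2 = - 2 * eig l 3"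
    using gen_Newton[of 0 l] by (simp_all add: gen_def)
  have "2 * fps_nth (gen l) 2 = fps_nth (gen l) 0 * pow l 2 + fps_nth (gen l) 1 * pow l 1"
    using gen_Newton[of 1 l] by (simp add: numeral_2_eq_2)
  then have "- 4 * eig l 3 = - 4 * ?t + 4 * ?s\<^sup>2"
    unfolding g p1 p2 by (simp add: power2_eq_square)
  then have "- 4 * eig l 3 = - 4 * (?t - ?s\<^sup>2)"
    by (simp only: right_diff_distrib) simp
  moreover have "- 4 \<noteq> (0 :: complex)"
    by simp
  ultimately show ?thesis
    using mult_left_cancel by blast
qed

theorem conj_Omega_3:
  "conj_Omega 3 f = (\<Sum>i\<in>UNIV. (euler i ^^ 3) f) - ((\<lambda>g. \<Sum>i\<in>UNIV. euler i g) ^^ 2) f"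
proof (rule diff_op_eqI[where T = "conj_Omega 3"])
  show "diff_op (conj_Omega 3)"
    by (rule diff_op_conj_Omega)
  show "diff_op (\<lambda>f. (\<Sum>i\<in>UNIV. (euler i ^^ 3) f) - ((\<lambda>g. \<Sum>i\<in>UNIV. euler i g) ^^ 2) f)"
    by (simp add: numeral_3_eq_3 numeral_2_eq_2) (intro diff_op_intros)
  fix m :: "'a \<Rightarrow>\<^sub>0 nat"
  let ?l = "Poly_Mapping.lookup m"
  have e: "euler i (scalar c * Mon m) = scalar (of_nat (?l i) * c) * Mon m" for i c
    by (simp add: euler_scalar_mult euler_Mon scalar_mult)
  have e1: "euler i (Mon m) = scalar (of_nat (?l i)) * Mon m" for i
    by (simp add: euler_Mon)
  have "(euler i ^^ 3) (Mon m) = scalar (of_nat (?l i) ^ 3) * Mon m" for i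
    unfolding numeral_3_eq_3 funpow.simps o_def id_def e1 e by (simp add: mult_ac)
  moreover have "((\<lambda>g. \<Sum>i\<in>UNIV. euler i g) ^^ 2) (Mon m) = scalar ((\<Sum>i\<in>UNIV. of_nat (?l i))\<^sup>2) * Mon m"
  proof -
    have "(\<Sum>i\<in>UNIV. euler i (scalar c * Mon m)) = scalar ((\<Sum>i\<in>UNIV. of_nat (?l i)) * c) * Mon m" for c
      unfolding e by (simp only: scalar_sum sum_distrib_right)
    from this[of 1] this show ?thesis
      by (simp only: numeral_2_eq_2 funpow.simps o_def id_def scalar_1 mult_1_left mult_1_right power_Suc power_0)
  qed
  ultimately show "conj_Omega 3 (Mon m) =
      (\<Sum>i\<in>UNIV. (euler i ^^ 3) (Mon m)) - ((\<lambda>g. \<Sum>i\<in>UNIV. euler i g) ^^ 2) (Mon m)"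
    by (simp add: conj_Omega_Mon_eig eig_3 scalar_diff scalar_sum left_diff_distrib sum_distrib_right)
qed

text \<open>An involution \<open>\<iota>\<close> pairs the variables on which \<open>f\<close> depends only through the quotient.\<close>

lemma pow_op_paired:
  fixes f :: "'n::{finite,linorder} ratfun"
  assumes inv: "\<And>i. \<iota> (\<iota> i) = i"
    and pair: "\<And>i. \<iota> i \<noteq> i \<Longrightarrow> euler (\<iota> i) f = - euler i f"
    and fix_: "\<And>i. \<iota> i = i \<Longrightarrow> euler i f = of_nat (l i) * f"
    and zero: "\<And>i. \<iota> i \<noteq> i \<Longrightarrow> l i = 0"
  shows "pow_op (Suc j) f = scalar (pow l (Suc j)) * f"
proof -
  let ?h = "\<lambda>i. (qm_op i ^^ Suc j) f - (qp_op i ^^ Suc j) f"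
  \<comment> \<open>A change of sign of the derivation turns D(D - 1) into D(D + 1). The last two
    conjuncts carry the sign rule to the iterates, as the induction needs.\<close>
  have swap: "(qm_op (\<iota> i) ^^ k) f = (qp_op i ^^ k) f \<and> (qp_op (\<iota> i) ^^ k) f = (qm_op i ^^ k) f \<and>
      euler (\<iota> i) ((qm_op i ^^ k) f) = - euler i ((qm_op i ^^ k) f) \<and>
      euler (\<iota> i) ((qp_op i ^^ k) f) = - euler i ((qp_op i ^^ k) f)" if "\<iota> i \<noteq> i" for i k
  proof (induction k)
    case (Suc k)
    have "euler i' (qm_op i g) = - euler i (qm_op i g)" "euler i' (qp_op i g) = - euler i (qp_op i g)"
      if "euler i' g = - euler i g" for g :: "'n ratfun" and i'
      using that by (simp_all add: qm_op_def qp_op_def euler.diff euler.add euler.minus euler_commute[of i' i])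
    moreover have "qm_op i' g = qp_op i g" "qp_op i' g = qm_op i g" if "euler i' g = - euler i g" for g :: "'n ratfun" and i'
    proof -
      have "euler i' (euler i' g) = euler i (euler i g)"
        unfolding that euler.minus using that by (simp add: euler_commute[of i' i] euler.minus)
      then show "qm_op i' g = qp_op i g" "qp_op i' g = qm_op i g"
        using that by (simp_all add: qm_op_def qp_op_def)
    qed
    ultimately show ?case
      using Suc by simp
  qed (use pair[OF that] in simp)
  have "(\<Sum>i | \<iota> i \<noteq> i. ?h i) = (\<Sum>i | \<iota> i \<noteq> i. ?h (\<iota> i))"
    by (rule sum.reindex_bij_witness[of _ \<iota> \<iota>]) (use inv in auto)
  also have "\<dots> = (\<Sum>i | \<iota> i \<noteq> i. - ?h i)"
    using swap by (intro sum.cong refl) (simp del: funpow.simps)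
  finally have "(\<Sum>i | \<iota> i \<noteq> i. ?h i) = - (\<Sum>i | \<iota> i \<noteq> i. ?h i)"
    by (simp only: sum_negf)
  moreover have "x = 0" if "x = - x" for x :: "'n ratfun"
    using that by (simp add: eq_neg_iff_add_eq_0 mult_2[symmetric])
  ultimately have unpaired: "(\<Sum>i | \<iota> i \<noteq> i. ?h i) = 0"
    by blast
  have split: "(\<Sum>i\<in>UNIV. g i) = (\<Sum>i | \<iota> i = i. g i) + (\<Sum>i | \<iota> i \<noteq> i. g i)" for g :: "'n \<Rightarrow> 'b::comm_monoid_add"
  proof -
    have "(\<Sum>i\<in>{i. \<iota> i = i} \<union> {i. \<iota> i \<noteq> i}. g i) = (\<Sum>i | \<iota> i = i. g i) + (\<Sum>i | \<iota> i \<noteq> i. g i)"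
      by (rule sum.union_disjoint) auto
    moreover have "{i. \<iota> i = i} \<union> {i. \<iota> i \<noteq> i} = UNIV"
      by auto
    ultimately show ?thesis
      by simp
  qed
  have "(\<Sum>i | \<iota> i \<noteq> i. qm (l i) ^ Suc j - qp (l i) ^ Suc j) = 0"
    by (intro sum.neutral) (simp add: zero qm_def qp_def)
  then have "pow l (Suc j) = (\<Sum>i | \<iota> i = i. qm (l i) ^ Suc j - qp (l i) ^ Suc j)"
    unfolding pow_def split by simp
  moreover have "pow_op (Suc j) f = (\<Sum>i | \<iota> i = i. ?h i)"
    unfolding pow_op_def split unpaired by simp
  moreover have "(\<Sum>i | \<iota> i = i. ?h i) = (\<Sum>i | \<iota> i = i. scalar (qm (l i) ^ Suc j - qp (l i) ^ Suc j) * f)"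
    by (intro sum.cong refl) (simp only: qm_op_eigen[OF fix_] mem_Collect_eq scalar_diff left_diff_distrib)
  ultimately show ?thesis
    by (simp only: scalar_sum sum_distrib_right)
qed

section \<open>The eigenvalues separate strict partitions\<close>

lemma order_prod_linear:
  fixes c :: "'a \<Rightarrow> complex"
  assumes "finite A" "a \<noteq> 0"
  shows "order (1 / a) (\<Prod>i\<in>A. [:1, - c i:]) = card {i \<in> A. c i = a}"
  using assms(1)
proof (induction A rule: finite_induct)
  case empty
  then show ?case by simp
next
  case (insert x F)
  have lin: "order (1 / a) [:1, - c x:] = (if c x = a then 1 else 0)"
  proof (cases "c x = a")
    case True
    have "[:1, - a:] = smult (- a) [:- (1 / a), 1:]"
      using assms(2) by simp
    then have "order (1 / a) [:1, - a:] = order (1 / a) [:- (1 / a), 1:]"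
      using assms(2) by (metis neg_equal_0_iff_equal order_smult)
    then show ?thesis
      using True order_power_n_n[of "1 / a" 1] by simp
  next
    case False
    then have "poly [:1, - c x:] (1 / a) \<noteq> 0"
      using assms(2) by (simp add: field_simps)
    then show ?thesis
      using False by (simp add: order_0I)
  qed
  have "(\<Prod>i\<in>F. [:1, - c i:]) \<noteq> 0"
    using insert.hyps(1) by simp
  then have nz: "[:1, - c x:] * (\<Prod>i\<in>F. [:1, - c i:]) \<noteq> 0"
    by (metis mult_eq_0_iff one_neq_zero pCons_eq_0_iff)
  have "{i \<in> insert x F. c i = a} = (if c x = a then insert x {i \<in> F. c i = a} else {i \<in> F. c i = a})"
    by auto
  then show ?case
    unfolding prod.insert[OF insert.hyps] order_mult[OF nz] lin insert.IH
    using insert.hyps by simp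
qed

text \<open>The value v(v + 1) is taken by \<open>qp\<close> only at v and by \<open>qm\<close> only
  at v + 1. Positivity of v excludes the value 0, which both take at 0.\<close>

lemma qp_eq_iff:
  assumes "v > 0"
  shows "qp l = of_nat (v * Suc v) \<longleftrightarrow> l = v" "qm l = of_nat (v * Suc v) \<longleftrightarrow> l = Suc v"
proof -
  have mono: "l * Suc l = v * Suc v \<longleftrightarrow> l = v" for l v :: nat
  proof
    assume *: "l * Suc l = v * Suc v"
    have "\<not> l < v" "\<not> v < l"
      using * mult_strict_mono[of l v "Suc l" "Suc v"] mult_strict_mono[of v l "Suc v" "Suc l"] by auto
    then show "l = v" by simp
  qed simp
  have "qp l = of_nat (l * Suc l)"
    by (simp add: qp_def algebra_simps)
  then show "qp l = of_nat (v * Suc v) \<longleftrightarrow> l = v"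
    by (simp only: of_nat_eq_iff mono)
  show "qm l = of_nat (v * Suc v) \<longleftrightarrow> l = Suc v"
  proof (cases l)
    case 0
    have "(0 :: complex) \<noteq> of_nat (v * Suc v)"
      using assms by (metis of_nat_0 of_nat_eq_iff mult_is_0 nat.simps(3) not_gr_zero)
    then show ?thesis
      using 0 by (simp add: qm_def del: of_nat_mult)
  next
    case (Suc k)
    then have "qm l = of_nat (k * Suc k)"
      by (simp add: qm_def algebra_simps)
    then show ?thesis
      using Suc by (simp only: of_nat_eq_iff mono) simp
  qed
qed

text \<open>Equal eigenvalues give equal quotients in \<open>gen_product\<close>. Comparing orders
  of vanishing at 1 / (v(v + 1)) shows that the difference of the multiplicities of v and v + 1 is
  the same for l and l'; beyond the largest value both are 0.\<close>

theorem eig_separates: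
  fixes l l' :: "'n::{finite,linorder} \<Rightarrow> nat"
  assumes "\<And>k. odd k \<Longrightarrow> eig l k = eig l' k" "v > 0"
  shows "card {i. l i = v} = card {i. l' i = v}"
proof -
  have gen: "gen l = gen l'"
    unfolding gen_def using assms(1) by (intro arg_cong[of _ _ Abs_fps] ext) auto
  let ?Q = "\<lambda>q l. \<Prod>i\<in>UNIV. [:1, - q (l i :: nat) :: complex:]"
  have f: "fps_of_poly (?Q q (l :: 'n \<Rightarrow> nat)) = (\<Prod>i\<in>UNIV. 1 - fps_const (q (l i)) * fps_X)" for q l
    by (simp add: fps_of_poly_prod fps_of_poly_linear' flip: fps_const_neg)
  have "fps_of_poly (?Q qp l * ?Q qm l') = fps_of_poly (?Q qp l' * ?Q qm l)"
    unfolding fps_of_poly_mult f gen_product[symmetric] gen by (simp only: mult_ac)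
  then have "?Q qp l * ?Q qm l' = ?Q qp l' * ?Q qm l"
    by (simp only: fps_of_poly_eq_iff)
  moreover have nz: "?Q q l \<noteq> 0" for q and l :: "'n \<Rightarrow> nat"
    by simp
  have mult: "order a (?Q q l * ?Q q' l') = order a (?Q q l) + order a (?Q q' l')" for a q q' and l l' :: "'n \<Rightarrow> nat"
    by (rule order_mult) (use nz[of q l] nz[of q' l'] in \<open>simp only: mult_eq_0_iff simp_thms\<close>)
  ultimately have ord: "order a (?Q qp l) + order a (?Q qm l') = order a (?Q qp l') + order a (?Q qm l)" for a
    by (simp only: mult[symmetric])
  have step: "card {i. l i = v} + card {i. l' i = Suc v} = card {i. l' i = v} + card {i. l i = Suc v}" if "v > 0" for v
  proof -
    have "of_nat (v * Suc v) \<noteq> (0 :: complex)"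
      using that by (metis of_nat_0 of_nat_eq_iff mult_is_0 nat.simps(3) not_gr_zero)
    note o = order_prod_linear[OF finite_class.finite_UNIV this]
    show ?thesis
      using ord[of "1 / of_nat (v * Suc v)"] unfolding o qp_eq_iff[OF that] by simp
  qed
  \<comment> \<open>Telescoping of \<open>step\<close>; with k beyond all values the multiplicities
    at v + k disappear.\<close>
  have shift: "card {i. l i = v} + card {i. l' i = v + k} = card {i. l' i = v} + card {i. l i = v + k}" if "v > 0" for v k
  proof (induction k)
    case (Suc k)
    then show ?case
      using step[of "v + k"] that by simp
  qed simp
  define b where "b = Suc (Max (range l \<union> range l'))"
  have b: "l i < b" "l' i < b" for i
    unfolding b_def by (simp_all add: less_Suc_eq_le)
  have "l i \<noteq> v + b" "l' i \<noteq> v + b" for i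
    using b[of i] by linarith+
  then have "{i. l i = v + b} = {}" "{i. l' i = v + b} = {}"
    by simp_all
  then show ?thesis
    using shift[OF assms(2), of b] by simp
qed

section \<open>Schur's Pfaffian\<close>

definition matchings :: "nat \<Rightarrow> (nat \<Rightarrow> nat) set"
  where "matchings m = {\<pi>. \<pi> permutes {..<2 * m} \<and> (\<forall>i<m. \<pi> (2 * i) < \<pi> (2 * i + 1)) \<and>
    (\<forall>i<m. \<forall>j<i. \<pi> (2 * j) < \<pi> (2 * i))}"

lemma pfaffian_matchings:
  "pfaffian m A = (\<Sum>\<pi>\<in>matchings m. of_int (sign \<pi>) * (\<Prod>i<m. A (\<pi> (2 * i)) (\<pi> (2 * i + 1))))"
  by (simp add: pfaffian_def matchings_def)

section \<open>Normalized matchings and expansion along the first row\<close>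

definition lift2 :: "(nat \<Rightarrow> nat) \<Rightarrow> nat \<Rightarrow> nat"
  where "lift2 \<rho> x = (if x < 2 then x else \<rho> (x - 2) + 2)"

text \<open>For positive b, the cycle that moves 1 to b and lowers 2, ..., b by one: b becomes the
  partner of 0 and the other points keep their order.\<close>

definition insert_at :: "nat \<Rightarrow> nat \<Rightarrow> nat"
  where "insert_at b x = (if x = 0 then 0 else if x = 1 then b else if x \<le> b then x - 1 else x)"

text \<open>For positive b, the increasing enumeration of the positive integers other than
  b.\<close>

definition skip :: "nat \<Rightarrow> nat \<Rightarrow> nat"
  where "skip b x = (if x + 1 < b then x + 1 else x + 2)"

lemma insert_at_Suc: "b \<ge> 1 \<Longrightarrow> insert_at (Suc b) = transpose b (Suc b) \<circ> insert_at b"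
  by (auto simp: fun_eq_iff insert_at_def transpose_def)

lemma insert_at_1: "insert_at (Suc 0) = id"
  by (auto simp: fun_eq_iff insert_at_def)

lemma insert_at_permutes:
  assumes "1 \<le> b" "b < N"
  shows "insert_at b permutes {..<N} \<and> sign (insert_at b) = (- 1) ^ (b - 1)"
  using assms
proof (induction b rule: dec_induct)
  case base
  then show ?case
    using permutes_id[of "{..<N}"] by (simp add: insert_at_1 id_def[symmetric])
next
  case (step b)
  then have IH: "insert_at b permutes {..<N}" "sign (insert_at b) = (- 1) ^ (b - 1)"
    by auto
  have t: "transpose b (Suc b) permutes {..<N}"
    using step by (intro permutes_swap_id) auto
  have perm: "permutation (insert_at b)" "permutation (transpose b (Suc b))"
    using IH t permutes_imp_permutation by blast+
  have "sign (insert_at (Suc b)) = - ((- 1) ^ (b - 1))"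
    using step perm IH by (simp add: insert_at_Suc sign_compose sign_swap_id)
  moreover have "- ((- 1) ^ (b - 1)) = ((- 1) ^ (Suc b - 1) :: int)"
    using step by (cases b) auto
  moreover have "insert_at (Suc b) permutes {..<N}"
    using step permutes_compose[OF IH(1) t] by (simp add: insert_at_Suc)
  ultimately show ?case
    by simp
qed

lemma insert_at_ge2: "insert_at b (Suc (Suc x)) = skip b x"
  by (auto simp: insert_at_def skip_def)

lemma skip_less_iff: "skip b x < skip b y \<longleftrightarrow> x < y"
  by (auto simp: skip_def)

lemma lift2_transpose: "lift2 (transpose a b \<circ> p) = transpose (a + 2) (b + 2) \<circ> lift2 p"
  by (auto simp: fun_eq_iff lift2_def transpose_def)

lemma lift2_permutes:
  assumes "\<rho> permutes {..<N}"
  shows "lift2 \<rho> permutes {..<N + 2} \<and> sign (lift2 \<rho>) = sign \<rho>"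
proof (rule permutes_induct[OF assms finite_lessThan])
  have "lift2 id = id"
    by (auto simp: fun_eq_iff lift2_def)
  then show "lift2 id permutes {..<N + 2} \<and> sign (lift2 id) = sign (id :: nat \<Rightarrow> nat)"
    by (simp add: permutes_id)
next
  fix a b p
  assume ab: "a \<in> {..<N}" "b \<in> {..<N}" "a \<noteq> b"
    and IH: "lift2 p permutes {..<N + 2} \<and> sign (lift2 p) = sign p" and p: "p permutes {..<N}"
  have t: "transpose (a + 2) (b + 2) permutes {..<N + 2}"
    using ab by (intro permutes_swap_id) auto
  have perm: "permutation p" "permutation (lift2 p)"
    using p IH permutes_imp_permutation[OF finite_lessThan] by blast+
  then have "sign (lift2 (transpose a b \<circ> p)) = sign (transpose a b \<circ> p)"
    unfolding lift2_transpose using IH ab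
    by (subst (1 2) sign_compose) (simp_all add: sign_swap_id permutation_swap_id)
  then show "lift2 (transpose a b \<circ> p) permutes {..<N + 2} \<and>
      sign (lift2 (transpose a b \<circ> p)) = sign (transpose a b \<circ> p)"
    using permutes_compose[OF _ t] IH unfolding lift2_transpose by blast
qed

lemma insert_lift_apply:
  "(insert_at b \<circ> lift2 \<rho>) 0 = 0"
  "(insert_at b \<circ> lift2 \<rho>) (Suc 0) = b"
  "(insert_at b \<circ> lift2 \<rho>) (Suc (Suc x)) = skip b (\<rho> x)"
  by (simp_all add: lift2_def insert_at_ge2[of b "\<rho> x", symmetric] add.commute[of _ "2::nat"] insert_at_def)

lemma insert_lift_matchings:
  assumes "1 \<le> b" "b < 2 * Suc m" "\<rho> permutes {..<2 * m}"
  shows "insert_at b \<circ> lift2 \<rho> \<in> matchings (Suc m) \<longleftrightarrow> \<rho> \<in> matchings m"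
proof -
  define \<pi> where "\<pi> = insert_at b \<circ> lift2 \<rho>"
  have perm: "\<pi> permutes {..<2 * Suc m}"
    unfolding \<pi>_def using lift2_permutes[OF assms(3)] insert_at_permutes[OF assms(1,2)]
    by (intro permutes_compose) (auto simp: add.commute)
  have \<pi>: "\<pi> 0 = 0" "\<pi> (Suc 0) = b" "\<pi> (Suc (Suc x)) = skip b (\<rho> x)" for x
    unfolding \<pi>_def by (rule insert_lift_apply)+
  have "(\<forall>i<Suc m. \<pi> (2 * i) < \<pi> (2 * i + 1)) \<longleftrightarrow> (\<forall>i<m. \<rho> (2 * i) < \<rho> (2 * i + 1))"
    using assms(1) by (simp add: All_less_Suc2 \<pi> skip_less_iff)
  moreover have "0 < skip b x" for x
    by (simp add: skip_def)
  then have "(\<forall>i<Suc m. \<forall>j<i. \<pi> (2 * j) < \<pi> (2 * i)) \<longleftrightarrow> (\<forall>i<m. \<forall>j<i. \<rho> (2 * j) < \<rho> (2 * i))"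
    by (simp add: All_less_Suc2 \<pi> skip_less_iff)
  ultimately show ?thesis
    unfolding matchings_def mem_Collect_eq \<pi>_def[symmetric] using perm assms(3) by blast
qed

lemma matchings_Suc_E:
  assumes "\<pi> \<in> matchings (Suc m)"
  obtains b \<rho> where "1 \<le> b" "b < 2 * Suc m" "\<rho> \<in> matchings m" "\<pi> = insert_at b \<circ> lift2 \<rho>"
proof -
  have perm: "\<pi> permutes {..<2 * Suc m}"
    and less: "\<And>i. i < Suc m \<Longrightarrow> \<pi> (2 * i) < \<pi> (2 * i + 1)"
    and mono: "\<And>i j. i < Suc m \<Longrightarrow> j < i \<Longrightarrow> \<pi> (2 * j) < \<pi> (2 * i)"
    using assms by (auto simp: matchings_def)
  \<comment> \<open>The value 0 cannot be the second in its pair, nor the first in any pair but the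
    first one.\<close>
  have zero: "\<pi> 0 = 0"
  proof -
    obtain x where "\<pi> x = 0"
      using permutes_surj[OF perm] by (metis surjD)
    then have x: "x < 2 * Suc m" "\<pi> x = 0"
      using permutes_not_in[OF perm, of x] by (cases "x < 2 * Suc m"; simp)+
    show ?thesis
    proof (cases "even x")
      case True
      then obtain i where "x = 2 * i" by blast
      then show ?thesis
        using x mono[of i 0] by (cases "i = 0") auto
    next
      case False
      then obtain i where "x = 2 * i + 1" by (rule oddE)
      then show ?thesis
        using x less[of i] by auto
    qed
  qed
  define b where "b = \<pi> (Suc 0)"
  have b: "1 \<le> b" "b < 2 * Suc m"
    using less[of 0] zero permutes_in_image[OF perm, of "Suc 0"] by (auto simp: b_def)
  have c: "insert_at b permutes {..<2 * Suc m}"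
    using insert_at_permutes[OF b] by blast
  \<comment> \<open>Undoing the insertion fixes 0 and 1; dropping them leaves the smaller matching
    \<rho>.\<close>
  define \<tau> where "\<tau> = inv (insert_at b) \<circ> \<pi>"
  have \<tau>: "\<tau> permutes {..<2 * Suc m}"
    unfolding \<tau>_def by (intro permutes_compose perm permutes_inv c)
  have c\<tau>: "insert_at b (\<tau> x) = \<pi> x" for x
    unfolding \<tau>_def by (simp add: permutes_inverses(1)[OF c])
  have inj: "\<tau> x = \<tau> y \<longleftrightarrow> x = y" for x y
    using permutes_inj[OF \<tau>] by (auto simp: inj_def)
  have c_inj: "insert_at b x = insert_at b y \<longleftrightarrow> x = y" for x y
    using permutes_inj[OF c] by (auto simp: inj_def)
  have \<tau>0: "\<tau> 0 = 0"
    using c\<tau>[of 0] zero c_inj[of "\<tau> 0" 0] by (simp add: insert_at_def)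
  have \<tau>1: "\<tau> (Suc 0) = Suc 0"
    using c\<tau>[of "Suc 0"] c_inj[of "\<tau> (Suc 0)" "Suc 0"] by (simp add: insert_at_def b_def)
  have ge: "\<tau> (x + 2) \<ge> 2" for x
    using inj[of "x + 2" 0] inj[of "x + 2" "Suc 0"] \<tau>0 \<tau>1 by simp
  define \<rho> where "\<rho> x = \<tau> (x + 2) - 2" for x
  have lift: "lift2 \<rho> = \<tau>"
  proof
    fix x
    show "lift2 \<rho> x = \<tau> x"
    proof (cases "x < 2")
      case True
      then have "x = 0 \<or> x = Suc 0" by auto
      then show ?thesis
        using \<tau>0 \<tau>1 by (auto simp: lift2_def)
    next
      case False
      then obtain y where "x = y + 2"
        by (metis le_add_diff_inverse2 not_less)
      then show ?thesis
        using ge[of y] by (simp add: lift2_def \<rho>_def)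
    qed
  qed
  have \<rho>: "\<rho> permutes {..<2 * m}"
    unfolding permutes_def
  proof (intro conjI allI impI)
    fix x assume "x \<notin> {..<2 * m}"
    then have "\<tau> (x + 2) = x + 2"
      by (intro permutes_not_in[OF \<tau>]) auto
    then show "\<rho> x = x"
      by (simp add: \<rho>_def)
  next
    fix y
    obtain z where z: "\<tau> z = y + 2"
      using permutes_surj[OF \<tau>] by (metis surjD)
    have "z \<noteq> 0" "z \<noteq> Suc 0"
      using z \<tau>0 \<tau>1 by (cases "z = 0", simp_all, cases "z = Suc 0", simp_all)
    define x where "x = z - 2"
    have x: "z = x + 2"
      using \<open>z \<noteq> 0\<close> \<open>z \<noteq> Suc 0\<close> by (simp add: x_def)
    show "\<exists>!x. \<rho> x = y"
    proof (rule ex1I[of _ x])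
      show "\<rho> x = y"
        using z x by (simp add: \<rho>_def)
      fix x' assume "\<rho> x' = y"
      then have "\<tau> (x' + 2) = \<tau> (x + 2)"
        using ge[of x'] z x by (simp add: \<rho>_def)
      then show "x' = x"
        by (simp add: inj)
    qed
  qed
  have "\<pi> = insert_at b \<circ> lift2 \<rho>"
    unfolding lift using c\<tau> by (simp add: fun_eq_iff)
  then show thesis
    using that[OF b] insert_lift_matchings[OF b \<rho>] assms by blast
qed

text \<open>A normalized matching amounts to the partner b of 0 and a normalized matching of the
  remaining points; the cycle \<open>insert_at b\<close> has sign (-1)^(b - 1).\<close>

lemma pfaffian_Suc:
  "pfaffian (Suc m) A =
    (\<Sum>b\<in>{1..<2 * Suc m}. (- 1) ^ (b - 1) * A 0 b * pfaffian m (\<lambda>i j. A (skip b i) (skip b j)))"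
proof -
  let ?f = "\<lambda>(b, \<rho>). insert_at b \<circ> lift2 \<rho>"
  let ?D = "{1..<2 * Suc m} \<times> matchings m"
  have perm: "\<rho> permutes {..<2 * m}" if "\<rho> \<in> matchings m" for \<rho>
    using that by (simp add: matchings_def)
  have "bij_betw ?f ?D (matchings (Suc m))"
    unfolding bij_betw_def
  proof
    show "inj_on ?f ?D"
    proof (rule inj_onI, clarify)
      fix b \<rho> b' \<rho>'
      assume *: "b \<in> {1..<2 * Suc m}" "insert_at b \<circ> lift2 \<rho> = insert_at b' \<circ> lift2 \<rho>'"
      have "b = b'"
        using fun_cong[OF *(2), of "Suc 0"] by (simp only: insert_lift_apply)
      moreover have "skip b (\<rho> x) = skip b (\<rho>' x)" for x
        using fun_cong[OF *(2), of "Suc (Suc x)"] \<open>b = b'\<close> by (simp only: insert_lift_apply)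
      then have "\<rho> = \<rho>'"
        using skip_less_iff[of b] by (metis ext less_irrefl linorder_neqE_nat)
      ultimately show "b = b' \<and> \<rho> = \<rho>'"
        by simp
    qed
    show "?f ` ?D = matchings (Suc m)"
    proof
      show "?f ` ?D \<subseteq> matchings (Suc m)"
        using insert_lift_matchings perm by auto
      show "matchings (Suc m) \<subseteq> ?f ` ?D"
      proof
        fix \<pi> assume "\<pi> \<in> matchings (Suc m)"
        then obtain b \<rho> where "1 \<le> b" "b < 2 * Suc m" "\<rho> \<in> matchings m" "\<pi> = insert_at b \<circ> lift2 \<rho>"
          by (rule matchings_Suc_E)
        then show "\<pi> \<in> ?f ` ?D"
          by (intro image_eqI[of _ _ "(b, \<rho>)"]) auto
      qed
    qed
  qed
  then have "pfaffian (Suc m) A = (\<Sum>p\<in>?D. of_int (sign (?f p)) * (\<Prod>i<Suc m. A (?f p (2 * i)) (?f p (2 * i + 1))))"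
    unfolding pfaffian_matchings by (rule sum.reindex_bij_betw[symmetric])
  also have "\<dots> = (\<Sum>(b, \<rho>)\<in>?D. (- 1) ^ (b - 1) * A 0 b *
      (of_int (sign \<rho>) * (\<Prod>i<m. A (skip b (\<rho> (2 * i))) (skip b (\<rho> (2 * i + 1))))))"
  proof (rule sum.cong[OF refl], clarify)
    fix b \<rho>
    assume b: "b \<in> {1..<2 * Suc m}" and r: "\<rho> \<in> matchings m"
    have c: "insert_at b permutes {..<2 * Suc m}" "sign (insert_at b) = (- 1) ^ (b - 1)"
      using insert_at_permutes[of b "2 * Suc m"] b by auto
    have l: "lift2 \<rho> permutes {..<2 * m + 2}" "sign (lift2 \<rho>) = sign \<rho>"
      using lift2_permutes[OF perm[OF r]] by auto
    have "sign (insert_at b \<circ> lift2 \<rho>) = (- 1) ^ (b - 1) * sign \<rho>"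
      using c l permutes_imp_permutation[OF finite_lessThan] by (subst sign_compose) auto
    moreover have "(\<Prod>i<Suc m. A ((insert_at b \<circ> lift2 \<rho>) (2 * i)) ((insert_at b \<circ> lift2 \<rho>) (2 * i + 1))) =
        A 0 b * (\<Prod>i<m. A (skip b (\<rho> (2 * i))) (skip b (\<rho> (2 * i + 1))))"
    proof -
      define \<sigma> where "\<sigma> = insert_at b \<circ> lift2 \<rho>"
      have \<sigma>: "\<sigma> 0 = 0" "\<sigma> (Suc 0) = b" "\<sigma> (Suc (Suc x)) = skip b (\<rho> x)" for x
        unfolding \<sigma>_def by (rule insert_lift_apply)+
      show ?thesis
        unfolding \<sigma>_def[symmetric] by (simp add: prod.lessThan_Suc_shift \<sigma> del: prod.lessThan_Suc)
    qed
    ultimately show "of_int (sign (insert_at b \<circ> lift2 \<rho>)) *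
        (\<Prod>i<Suc m. A ((insert_at b \<circ> lift2 \<rho>) (2 * i)) ((insert_at b \<circ> lift2 \<rho>) (2 * i + 1))) =
        (- 1) ^ (b - 1) * A 0 b * (of_int (sign \<rho>) * (\<Prod>i<m. A (skip b (\<rho> (2 * i))) (skip b (\<rho> (2 * i + 1)))))"
      by (simp add: mult_ac)
  qed
  also have "\<dots> = (\<Sum>b\<in>{1..<2 * Suc m}. (- 1) ^ (b - 1) * A 0 b * pfaffian m (\<lambda>i j. A (skip b i) (skip b j)))"
    unfolding pfaffian_matchings sum_distrib_left by (subst sum.cartesian_product) simp
  finally show ?thesis .
qed

lemma pfaffian_0: "pfaffian 0 A = 1"
proof -
  have "matchings 0 = {id}"
    by (auto simp: matchings_def permutes_empty)
  then show ?thesis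
    by (simp add: pfaffian_matchings)
qed

section \<open>Products of \<open>eta\<close> and partial fractions\<close>

definition eta :: "('i \<Rightarrow> 'a::field) \<Rightarrow> 'i \<Rightarrow> 'i \<Rightarrow> 'a"
  where "eta y a b = (y a - y b) / (y a + y b)"

definition eta_prod :: "('i::linorder \<Rightarrow> 'a::field) \<Rightarrow> 'i set \<Rightarrow> 'a"
  where "eta_prod y S = (\<Prod>(a, b)\<in>{(a, b). a \<in> S \<and> b \<in> S \<and> a < b}. eta y a b)"

lemma eta_swap: "eta y b a = - eta y a b"
  unfolding eta_def by (metis add.commute minus_diff_eq minus_divide_left)

text \<open>Each c below b meets b in the reversed order and costs one sign.\<close>

lemma eta_prod_remove:
  assumes "finite S" "b \<in> S"
  shows "eta_prod y S = (- 1) ^ card {c \<in> S. c < b} * (\<Prod>d\<in>S - {b}. eta y b d) * eta_prod y (S - {b})"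
proof -
  let ?P = "\<lambda>S. {(a, b). a \<in> S \<and> b \<in> S \<and> a < b}"
  let ?L = "{c \<in> S. c < b}" and ?U = "{c \<in> S. b < c}"
  have dec: "?P S = ?P (S - {b}) \<union> ((\<lambda>c. (c, b)) ` ?L \<union> (\<lambda>c. (b, c)) ` ?U)"
    using assms(2) by auto
  have fin: "finite (?P (S - {b}))"
    by (rule finite_subset[of _ "S \<times> S"]) (use assms(1) in auto)
  have "eta_prod y S = eta_prod y (S - {b}) * ((\<Prod>c\<in>?L. eta y c b) * (\<Prod>c\<in>?U. eta y b c))"
    unfolding eta_prod_def dec
    apply (subst prod.union_disjoint)
    using assms(1) fin apply auto[3]
    apply (subst prod.union_disjoint)
    using assms(1) apply auto[3]
    apply (simp add: prod.reindex inj_on_def)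
    done
  also have "(\<Prod>c\<in>?L. eta y c b) = (\<Prod>c\<in>?L. - 1 * eta y b c)"
    by (intro prod.cong refl) (simp add: eta_swap[of y _ b])
  also have "\<dots> = (- 1) ^ card ?L * (\<Prod>c\<in>?L. eta y b c)"
    by (simp only: prod.distrib prod_constant)
  also have "eta_prod y (S - {b}) * ((- 1) ^ card ?L * (\<Prod>c\<in>?L. eta y b c) * (\<Prod>c\<in>?U. eta y b c)) =
      (- 1) ^ card ?L * ((\<Prod>c\<in>?L. eta y b c) * (\<Prod>c\<in>?U. eta y b c)) * eta_prod y (S - {b})"
    by (simp add: mult_ac)
  also have "(\<Prod>c\<in>?L. eta y b c) * (\<Prod>c\<in>?U. eta y b c) = (\<Prod>d\<in>?L \<union> ?U. eta y b d)"
    using assms(1) by (intro prod.union_disjoint[symmetric]) auto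
  also have "?L \<union> ?U = S - {b}"
    using assms by auto
  finally show ?thesis .
qed

lemma eta_prod_reindex:
  fixes f :: "'j::linorder \<Rightarrow> 'i::linorder"
  assumes "strict_mono_on S f"
  shows "eta_prod (\<lambda>a. y (f a)) S = eta_prod y (f ` S)"
proof -
  have image: "{(a, b). a \<in> f ` S \<and> b \<in> f ` S \<and> a < b} = (\<lambda>(a, b). (f a, f b)) ` {(a, b). a \<in> S \<and> b \<in> S \<and> a < b}"
    using assms strict_mono_on_less[OF assms] by (auto simp: image_iff)
  have inj: "inj_on (\<lambda>(a, b). (f a, f b)) {(a, b). a \<in> S \<and> b \<in> S \<and> a < b}"
    using strict_mono_on_imp_inj_on[OF assms] by (auto simp: inj_on_def)
  show ?thesis
    unfolding eta_prod_def image prod.reindex[OF inj] by (simp add: case_prod_beta eta_def)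
qed

text \<open>For distinct points, 2 * y b times this number is the residue at s = y b of the product
  of (s + y d) / (s - y d) over B.\<close>

definition lagrange :: "('i \<Rightarrow> 'a::field) \<Rightarrow> 'i set \<Rightarrow> 'i \<Rightarrow> 'a"
  where "lagrange y B b = (\<Prod>d\<in>B - {b}. (y b + y d) / (y b - y d))"

text \<open>Both sides are polynomials in \<open>s\<close>; their difference has degree below \<open>card B\<close> and vanishes at all \<open>y b\<close>.\<close>

lemma lagrange_identity:
  fixes y :: "'i \<Rightarrow> 'a::field"
  assumes "finite B" "inj_on y B"
  shows "(\<Prod>b\<in>B. s + y b) = (\<Prod>b\<in>B. s - y b) + (\<Sum>b\<in>B. 2 * lagrange y B b * y b * (\<Prod>d\<in>B - {b}. s - y d))"
proof -
  let ?p = "\<Prod>b\<in>B. [:y b, 1:]" and ?q = "\<Prod>b\<in>B. [:- y b, 1:]"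
  let ?r = "\<lambda>b. smult (2 * lagrange y B b * y b) (\<Prod>d\<in>B - {b}. [:- y d, 1:])"
  define D where "D = ?p - ?q - (\<Sum>b\<in>B. ?r b)"
  have deg: "degree (\<Prod>d\<in>A. [:f d, 1:]) = card A" if "finite A" for A :: "'i set" and f :: "'i \<Rightarrow> 'a"
    using that by (subst degree_prod_eq_sum_degree) auto
  have lead: "coeff (\<Prod>d\<in>A. [:f d, 1:]) (card A) = 1" if "finite A" for A :: "'i set" and f :: "'i \<Rightarrow> 'a"
    using lead_coeff_prod[of "\<lambda>d. [:f d, 1:]" A] deg[OF that, of f] by simp
  have polyD: "poly D s = (\<Prod>b\<in>B. s + y b) - (\<Prod>b\<in>B. s - y b) -
      (\<Sum>b\<in>B. 2 * lagrange y B b * y b * (\<Prod>d\<in>B - {b}. s - y d))" for s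
    by (simp add: D_def poly_prod poly_sum add.commute)
  have root: "poly D (y c) = 0" if c: "c \<in> B" for c
  proof -
    have "(\<Prod>d\<in>B - {b}. y c - y d) = 0" if "b \<in> B - {c}" for b
      using that c assms(1) by (intro prod_zero) auto
    then have "(\<Sum>b\<in>B. 2 * lagrange y B b * y b * (\<Prod>d\<in>B - {b}. y c - y d)) =
        2 * lagrange y B c * y c * (\<Prod>d\<in>B - {c}. y c - y d)"
      using c assms(1) by (subst sum.remove[of _ c]) (auto intro!: sum.neutral)
    moreover have l: "lagrange y B c * (\<Prod>d\<in>B - {c}. y c - y d) = (\<Prod>d\<in>B - {c}. y c + y d)"
    proof -
      have "y c - y d \<noteq> 0" if "d \<in> B - {c}" for d
        using that c assms(2) by (auto simp: inj_on_def)
      then show ?thesis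
        unfolding lagrange_def prod.distrib[symmetric] by (intro prod.cong) auto
    qed
    have "2 * lagrange y B c * y c * (\<Prod>d\<in>B - {c}. y c - y d) = 2 * y c * (\<Prod>d\<in>B - {c}. y c + y d)"
      unfolding l[symmetric] by (simp only: mult_ac)
    also have "\<dots> = (\<Prod>d\<in>B. y c + y d)"
      using c assms(1) by (subst prod.remove[of B c]) auto
    ultimately have "(\<Sum>b\<in>B. 2 * lagrange y B b * y b * (\<Prod>d\<in>B - {b}. y c - y d)) = (\<Prod>d\<in>B. y c + y d)"
      by simp
    moreover have "(\<Prod>d\<in>B. y c - y d) = 0"
      using c assms(1) by (intro prod_zero) auto
    ultimately show ?thesis
      unfolding polyD by simp
  qed
  have "D = 0"
  proof (rule ccontr)
    assume "D \<noteq> 0"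
    then have "B \<noteq> {}"
      by (auto simp: D_def)
    then have pos: "card B > 0"
      using assms(1) by (simp add: card_gt_0_iff)
    have "degree (?p - ?q) < card B"
    proof -
      have "degree (?p - ?q) \<le> card B"
        by (intro degree_diff_le) (simp_all add: deg assms(1))
      moreover have "coeff (?p - ?q) (card B) = 0"
        by (simp add: lead assms(1))
      ultimately show ?thesis
        using pos by (metis leading_coeff_0_iff degree_0 le_neq_implies_less)
    qed
    moreover have "degree (?r b) < card B" if "b \<in> B" for b
    proof -
      have "degree (?r b) \<le> card (B - {b})"
        using degree_smult_le deg[of "B - {b}" "\<lambda>d. - y d"] assms(1) by (metis finite_Diff)
      also have "\<dots> < card B"
        using that assms(1) by (intro psubset_card_mono) auto
      finally show ?thesis .
    qed
    then have "degree (\<Sum>b\<in>B. ?r b) < card B"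
      using pos by (intro degree_sum_less) auto
    ultimately have "degree D < card B"
      unfolding D_def by (rule degree_diff_less)
    moreover have "card B \<le> card {x. poly D x = 0}"
    proof -
      have "card B = card (y ` B)"
        using assms(2) by (simp add: card_image)
      also have "\<dots> \<le> card {x. poly D x = 0}"
        using root by (intro card_mono poly_roots_finite \<open>D \<noteq> 0\<close>) auto
      finally show ?thesis .
    qed
    ultimately show False
      using card_poly_roots_bound[OF \<open>D \<noteq> 0\<close>] by simp
  qed
  then have "poly D s = 0"
    by simp
  then show ?thesis
    unfolding polyD by (simp add: diff_diff_eq)
qed

lemma lagrange_quotient:
  assumes "finite B" "inj_on y B" "\<And>b. b \<in> B \<Longrightarrow> s \<noteq> y b"
  shows "(\<Prod>b\<in>B. (s + y b) / (s - y b)) = 1 + (\<Sum>b\<in>B. 2 * lagrange y B b * y b / (s - y b))"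
proof -
  have nz: "(\<Prod>b\<in>B. s - y b) \<noteq> 0"
    using assms by simp
  have "(\<Prod>b\<in>B. (s + y b) / (s - y b)) = (\<Prod>b\<in>B. s + y b) / (\<Prod>b\<in>B. s - y b)"
    by (simp add: prod_dividef)
  also have "\<dots> = 1 + (\<Sum>b\<in>B. 2 * lagrange y B b * y b * (\<Prod>d\<in>B - {b}. s - y d) / (\<Prod>b\<in>B. s - y b))"
    unfolding lagrange_identity[OF assms(1,2)] using nz by (simp add: add_divide_distrib sum_divide_distrib)
  also have "(\<Sum>b\<in>B. 2 * lagrange y B b * y b * (\<Prod>d\<in>B - {b}. s - y d) / (\<Prod>b\<in>B. s - y b)) =
      (\<Sum>b\<in>B. 2 * lagrange y B b * y b / (s - y b))"
  proof (rule sum.cong[OF refl])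
    fix b assume b: "b \<in> B"
    have "(\<Prod>b\<in>B. s - y b) = (s - y b) * (\<Prod>d\<in>B - {b}. s - y d)"
      using assms(1) b by (rule prod.remove)
    moreover have "(\<Prod>d\<in>B - {b}. s - y d) \<noteq> 0"
      using assms by simp
    ultimately show "2 * lagrange y B b * y b * (\<Prod>d\<in>B - {b}. s - y d) / (\<Prod>b\<in>B. s - y b) =
        2 * lagrange y B b * y b / (s - y b)"
      by simp
  qed
  finally show ?thesis .
qed

text \<open>The partial fraction expansion at s = 0 reads (-1)^n = 1 - 2 * sum, provided that no
  point is 0.\<close>

lemma lagrange_sum:
  fixes y :: "'i \<Rightarrow> 'a::field_char_0"
  assumes "finite B" "inj_on y B"
  shows "(\<Sum>b\<in>B. lagrange y B b) = (if odd (card B) then 1 else 0)"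
proof -
  have nonzero: "(\<Sum>b\<in>B. lagrange y B b) = (if odd (card B) then 1 else 0)"
    if "finite B" "inj_on y B" "\<forall>b\<in>B. y b \<noteq> 0" for B
  proof -
    have "(\<Prod>b\<in>B. (0 + y b) / (0 - y b)) = (\<Prod>b\<in>B. - 1)"
      using that(3) by (intro prod.cong refl) simp
    then have "(\<Prod>b\<in>B. (0 + y b) / (0 - y b)) = (- 1) ^ card B"
      by (simp only: prod_constant)
    moreover have "(\<Sum>b\<in>B. 2 * lagrange y B b * y b / (0 - y b)) = - 2 * (\<Sum>b\<in>B. lagrange y B b)"
      unfolding sum_distrib_left using that(3) by (intro sum.cong) auto
    moreover have "(\<Prod>b\<in>B. (0 + y b) / (0 - y b)) = 1 + (\<Sum>b\<in>B. 2 * lagrange y B b * y b / (0 - y b))"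
      by (rule lagrange_quotient[OF that(1,2)]) (use that(3) in force)
    ultimately have e: "(- 1) ^ card B = 1 + - 2 * (\<Sum>b\<in>B. lagrange y B b)"
      by (simp only:)
    show ?thesis
    proof (cases "odd (card B)")
      case True
      then have "2 * (\<Sum>b\<in>B. lagrange y B b) = 2 * 1"
        using e by simp
      then show ?thesis
        using True by simp
    qed (use e in simp)
  qed
  show ?thesis
  proof (cases "\<exists>c\<in>B. y c = 0")
    case False
    then show ?thesis
      using nonzero[OF assms] by blast
  next
    case True
    then obtain c where c: "c \<in> B" "y c = 0"
      by blast
    \<comment> \<open>A point 0 contributes a factor 1 to the other summands and has itself the
      value (-1)^(n - 1), so it can be split off.\<close>
    let ?B = "B - {c}"
    have nz: "\<forall>b\<in>?B. y b \<noteq> 0"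
      using c assms(2) by (auto simp: inj_on_def)
    have B: "finite ?B" "inj_on y ?B" "card B = Suc (card ?B)"
      using assms c card_Suc_Diff1[OF assms(1) c(1)] by (auto intro: inj_on_subset)
    have "lagrange y B b = lagrange y ?B b" if "b \<in> ?B" for b
    proof -
      have "B - {b} = insert c (?B - {b})"
        using that c by auto
      then show ?thesis
        using that nz c assms(1) by (simp add: lagrange_def)
    qed
    moreover have "lagrange y B c = (- 1) ^ card ?B"
    proof -
      have "lagrange y B c = (\<Prod>b\<in>?B. - 1)"
        unfolding lagrange_def c(2) using nz by (intro prod.cong refl) simp
      then show ?thesis
        by (simp only: prod_constant)
    qed
    ultimately have "(\<Sum>b\<in>B. lagrange y B b) = (- 1) ^ card ?B + (if odd (card ?B) then 1 else 0)"
      using nonzero[OF B(1,2) nz] assms(1) c(1) by (simp add: sum.remove[of B c])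
    then show ?thesis
      using B(3) by (cases "odd (card ?B)") auto
  qed
qed

lemma eta_prod_eq_0:
  assumes "finite S" "c \<in> S" "d \<in> S" "c < d" "y c = y d"
  shows "eta_prod y S = 0"
proof -
  have "finite {(a, b). a \<in> S \<and> b \<in> S \<and> a < b}"
    by (rule finite_subset[of _ "S \<times> S"]) (use assms(1) in auto)
  then show ?thesis
    unfolding eta_prod_def using assms by (intro prod_zero bexI[of _ "(c, d)"]) (auto simp: eta_def)
qed

lemma eta_prod_expand:
  fixes y :: "'i::linorder \<Rightarrow> 'a::field_char_0"
  assumes B: "finite B" "odd (card B)"
    and y0: "\<And>b. b \<in> B \<Longrightarrow> y0 + y b \<noteq> 0"
    and yy: "\<And>b c. b \<in> B \<Longrightarrow> c \<in> B \<Longrightarrow> b \<noteq> c \<Longrightarrow> y b + y c \<noteq> 0"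
  shows "(\<Sum>b\<in>B. (- 1) ^ card {c \<in> B. c < b} * ((y0 - y b) / (y0 + y b)) * eta_prod y (B - {b})) =
    (\<Prod>b\<in>B. (y0 - y b) / (y0 + y b)) * eta_prod y B"
proof (cases "inj_on y B")
  case True
  \<comment> \<open>\<open>eta_prod_remove\<close> read backwards: \<open>lagrange\<close> is the
    inverse of the removed factors.\<close>
  have "(- 1) ^ card {c \<in> B. c < b} * eta_prod y (B - {b}) = eta_prod y B * lagrange y B b" if b: "b \<in> B" for b
  proof -
    let ?e = "\<Prod>d\<in>B - {b}. eta y b d"
    have "eta y b d \<noteq> 0" if "d \<in> B - {b}" for d
      using that b True yy[of b d] by (auto simp: eta_def inj_on_def)
    then have "?e \<noteq> 0"
      using B(1) by simp
    moreover have "lagrange y B b = 1 / ?e"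
      unfolding lagrange_def by (simp add: eta_def flip: prod_dividef) (simp add: prod_dividef)
    ultimately show ?thesis
      unfolding eta_prod_remove[OF B(1) b] by simp
  qed
  then have "(\<Sum>b\<in>B. (- 1) ^ card {c \<in> B. c < b} * ((y0 - y b) / (y0 + y b)) * eta_prod y (B - {b})) =
      (\<Sum>b\<in>B. eta_prod y B * (lagrange y B b - 2 * lagrange y B b * y b / (y0 + y b)))"
  proof (intro sum.cong refl)
    fix b assume b: "b \<in> B"
    assume eq: "\<And>b. b \<in> B \<Longrightarrow> (- 1) ^ card {c \<in> B. c < b} * eta_prod y (B - {b}) = eta_prod y B * lagrange y B b"
    have e: "(y0 - y b) / (y0 + y b) = 1 - 2 * y b / (y0 + y b)"
      using y0[OF b] by (simp add: field_simps)
    have "(- 1) ^ card {c \<in> B. c < b} * ((y0 - y b) / (y0 + y b)) * eta_prod y (B - {b}) =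
        (eta_prod y B * lagrange y B b) * (1 - 2 * y b / (y0 + y b))"
      unfolding eq[OF b, symmetric] e by (simp only: mult_ac)
    then show "(- 1) ^ card {c \<in> B. c < b} * ((y0 - y b) / (y0 + y b)) * eta_prod y (B - {b}) =
        eta_prod y B * (lagrange y B b - 2 * lagrange y B b * y b / (y0 + y b))"
      by (simp add: algebra_simps)
  qed
  also have "\<dots> = eta_prod y B * (1 - (\<Sum>b\<in>B. 2 * lagrange y B b * y b / (y0 + y b)))"
    using lagrange_sum[OF B(1) True] B(2) by (simp add: sum_subtractf flip: sum_distrib_left)
  also have "1 - (\<Sum>b\<in>B. 2 * lagrange y B b * y b / (y0 + y b)) = (\<Prod>b\<in>B. (y0 - y b) / (y0 + y b))"
  proof -
    have m: "(- y0 + z) / (- y0 - z) = (y0 - z) / (y0 + z)" for z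
    proof -
      have "- y0 + z = - (y0 - z)" "- y0 - z = - (y0 + z)"
        by simp_all
      then show ?thesis
        by (simp only: minus_divide_divide)
    qed
    have "- y0 \<noteq> y b" if "b \<in> B" for b
      using y0[OF that] by (simp add: neg_eq_iff_add_eq_0)
    from lagrange_quotient[OF B(1) True this]
    have "(\<Prod>b\<in>B. (y0 - y b) / (y0 + y b)) = 1 + (\<Sum>b\<in>B. 2 * lagrange y B b * y b / (- y0 - y b))"
      unfolding m .
    also have "(\<Sum>b\<in>B. 2 * lagrange y B b * y b / (- y0 - y b)) = - (\<Sum>b\<in>B. 2 * lagrange y B b * y b / (y0 + y b))"
    proof -
      have "- y0 - z = - (y0 + z)" for z
        by simp
      then show ?thesis
        by (simp only: minus_divide_right[symmetric] sum_negf)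
    qed
    finally show ?thesis
      by simp
  qed
  finally show ?thesis
    by (simp only: mult.commute)
next
  case False
  then obtain c d where cd: "c \<in> B" "d \<in> B" "c < d" "y c = y d"
    unfolding inj_on_def by (metis linorder_neqE)
  let ?n = "\<lambda>b. card {c \<in> B. c < b}"
  let ?t = "\<lambda>b. (- 1) ^ ?n b * ((y0 - y b) / (y0 + y b)) * eta_prod y (B - {b})"
  let ?E = "\<Prod>e\<in>B - {c, d}. eta y c e"
  \<comment> \<open>A repeated point kills every summand that keeps both copies; the two summands
    that drop one copy differ by a sign.\<close>
  have "?t b = 0" if "b \<in> B - {c, d}" for b
    using eta_prod_eq_0[of "B - {b}" c d y] B(1) cd that by auto
  then have "(\<Sum>b\<in>B. ?t b) = (\<Sum>b\<in>{c, d}. ?t b)"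
    using B(1) cd by (intro sum.mono_neutral_right) auto
  also have "\<dots> = ?t c + ?t d"
    using cd by simp
  also have "eta_prod y (B - {c}) = (- 1) ^ (?n d - 1) * ?E * eta_prod y (B - {c, d})"
  proof -
    have "{e \<in> B - {c}. e < d} = {e \<in> B. e < d} - {c}"
      by auto
    then have "card {e \<in> B - {c}. e < d} = ?n d - 1"
      using cd B(1) by (simp add: card_Diff_singleton)
    moreover have "B - {c} - {d} = B - {c, d}"
      by auto
    moreover have "(\<Prod>e\<in>B - {c, d}. eta y d e) = ?E"
      using cd(4) by (simp add: eta_def)
    ultimately show ?thesis
      using eta_prod_remove[of "B - {c}" d y] cd B(1) by simp
  qed
  also have "eta_prod y (B - {d}) = (- 1) ^ ?n c * ?E * eta_prod y (B - {c, d})"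
  proof -
    have "{e \<in> B - {d}. e < c} = {e \<in> B. e < c}"
      using cd by auto
    moreover have "B - {d} - {c} = B - {c, d}"
      by auto
    ultimately show ?thesis
      using eta_prod_remove[of "B - {d}" c y] cd B(1) by simp
  qed
  also have "(- 1) ^ ?n c * ((y0 - y c) / (y0 + y c)) * ((- 1) ^ (?n d - 1) * ?E * eta_prod y (B - {c, d})) +
      (- 1) ^ ?n d * ((y0 - y d) / (y0 + y d)) * ((- 1) ^ ?n c * ?E * eta_prod y (B - {c, d})) = 0"
  proof -
    have "?n d > 0"
      using cd B(1) by (auto simp: card_gt_0_iff)
    then have "(- 1) ^ ?n d = - ((- 1) ^ (?n d - 1) :: 'a)"
      by (cases "?n d") auto
    then show ?thesis
      using cd(4) by simp
  qed
  finally show ?thesis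
    using eta_prod_eq_0[OF B(1) cd] by simp
qed

text \<open>Schur's Pfaffian identity: the expansion along the first row becomes
  \<open>eta_prod_expand\<close> with y0 = y 0.\<close>

theorem pfaffian_eta:
  fixes y :: "nat \<Rightarrow> 'a::field_char_0"
  assumes "\<And>a b. a < 2 * m \<Longrightarrow> b < 2 * m \<Longrightarrow> a \<noteq> b \<Longrightarrow> y a + y b \<noteq> 0"
  shows "pfaffian m (eta y) = eta_prod y {..<2 * m}"
  using assms
proof (induction m arbitrary: y)
  case 0
  then show ?case
    by (simp add: pfaffian_0 eta_prod_def)
next
  case (Suc m)
  let ?B = "{1..<2 * Suc m}"
  have inner: "pfaffian m (\<lambda>i j. eta y (skip b i) (skip b j)) = eta_prod y (?B - {b})" if b: "b \<in> ?B" for b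
  proof -
    have "pfaffian m (eta (\<lambda>i. y (skip b i))) = eta_prod (\<lambda>i. y (skip b i)) {..<2 * m}"
    proof (rule Suc.IH)
      fix i j assume "i < 2 * m" "j < 2 * m" "i \<noteq> j"
      then show "y (skip b i) + y (skip b j) \<noteq> 0"
        by (intro Suc.prems) (auto simp: skip_def)
    qed
    also have "\<dots> = eta_prod y (skip b ` {..<2 * m})"
      by (rule eta_prod_reindex) (simp add: strict_mono_on_def skip_less_iff)
    also have "skip b ` {..<2 * m} = ?B - {b}"
    proof
      show "skip b ` {..<2 * m} \<subseteq> ?B - {b}"
        by (auto simp: skip_def)
      show "?B - {b} \<subseteq> skip b ` {..<2 * m}"
      proof
        fix x assume x: "x \<in> ?B - {b}"
        show "x \<in> skip b ` {..<2 * m}"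
          using x b by (intro image_eqI[of _ _ "if x < b then x - 1 else x - 2"]) (auto simp: skip_def)
      qed
    qed
    finally show ?thesis
      by (simp add: eta_def)
  qed
  have n: "{c \<in> ?B. c < b} = {1..<b}" if "b \<in> ?B" for b
    using that by auto
  have "pfaffian (Suc m) (eta y) =
      (\<Sum>b\<in>?B. (- 1) ^ card {c \<in> ?B. c < b} * ((y 0 - y b) / (y 0 + y b)) * eta_prod y (?B - {b}))"
    unfolding pfaffian_Suc
  proof (rule sum.cong[OF refl])
    fix b assume b: "b \<in> ?B"
    show "(- 1) ^ (b - 1) * eta y 0 b * pfaffian m (\<lambda>i j. eta y (skip b i) (skip b j)) =
        (- 1) ^ card {c \<in> ?B. c < b} * ((y 0 - y b) / (y 0 + y b)) * eta_prod y (?B - {b})"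
      unfolding inner[OF b] n[OF b] eta_def[of y 0] by simp
  qed
  also have "\<dots> = (\<Prod>b\<in>?B. (y 0 - y b) / (y 0 + y b)) * eta_prod y ?B"
    by (rule eta_prod_expand) (use Suc.prems in auto)
  also have "\<dots> = eta_prod y {..<2 * Suc m}"
  proof -
    have "{..<2 * Suc m} - {0} = ?B"
      by auto
    then show ?thesis
      using eta_prod_remove[of "{..<2 * Suc m}" 0 y] by (simp add: eta_def)
  qed
  finally show ?case .
qed

section \<open>The polynomials \<open>Q\<^sub>\<lambda>\<close> as sums over the variables\<close>

text \<open>The coefficient of x_i^k when q_k, k > 0, is read off the partial fractions of its
  generating function.\<close>

definition weight :: "'n::{finite,linorder} \<Rightarrow> 'n ratfun"
  where "weight i = 2 * lagrange X UNIV i"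

lemma inj_X: "inj X"
  by (rule injI) simp

text \<open>The substitution s = 1 / t in \<open>lagrange_identity\<close>, with the denominators
  cleared.\<close>

lemma lagrange_reversed:
  fixes t :: "'n::{finite,linorder} ratfun"
  assumes "t \<noteq> 0"
  shows "(\<Prod>b\<in>UNIV. 1 + X b * t) = (\<Prod>b\<in>UNIV. 1 - X b * t) +
    (\<Sum>b\<in>UNIV. weight b * X b * (t * (\<Prod>d\<in>UNIV - {b}. 1 - X d * t)))"
proof -
  let ?n = "card (UNIV :: 'n set)"
  have scale: "t ^ card A * (\<Prod>b\<in>A. f b) = (\<Prod>b\<in>A. t * f b)" for A :: "'n set" and f
    by (simp add: prod.distrib)
  have t: "t * (1 / t + x) = 1 + x * t" "t * (1 / t - x) = 1 - x * t" for x
    using assms by (simp_all add: distrib_left right_diff_distrib mult.commute)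
  have "t ^ ?n * (\<Prod>d\<in>UNIV - {b}. 1 / t - X d) = t * (\<Prod>d\<in>UNIV - {b}. 1 - X d * t)" for b :: 'n
  proof -
    have "?n = Suc (card (UNIV - {b}))"
      using card_Suc_Diff1[OF finite_class.finite_UNIV UNIV_I[of b]] by simp
    then show ?thesis
      by (simp only: power_Suc mult.assoc scale t)
  qed
  moreover have "t ^ ?n * (\<Prod>b\<in>UNIV. 1 / t + X b) = t ^ ?n * (\<Prod>b\<in>UNIV. 1 / t - X b) +
      (\<Sum>b\<in>UNIV. weight b * X b * (t ^ ?n * (\<Prod>d\<in>UNIV - {b}. 1 / t - X d)))"
    unfolding lagrange_identity[OF finite_class.finite_UNIV inj_X, of "1 / t"] weight_def
    by (simp only: distrib_left sum_distrib_left mult.left_commute[of "t ^ ?n"])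
  ultimately show ?thesis
    by (simp only: scale t)
qed

definition fract_fps :: "'n::{finite,linorder} mpoly fps \<Rightarrow> 'n ratfun fps"
  where "fract_fps a = Abs_fps (\<lambda>k. to_fract (fps_nth a k))"

lemma fract_fps_mult: "fract_fps (a * b) = fract_fps a * fract_fps b"
  by (simp add: fract_fps_def fps_eq_iff fps_mult_nth)

lemma fract_fps_1: "fract_fps 1 = 1"
  by (simp add: fract_fps_def fps_eq_iff)

lemma fract_fps_prod: "fract_fps (\<Prod>a\<in>A. f a) = (\<Prod>a\<in>A. fract_fps (f a))"
  by (induction A rule: infinite_finite_induct) (simp_all add: fract_fps_mult fract_fps_1)

lemma fract_fps_linear: "fract_fps (1 + fps_const c * fps_X) = 1 + fps_const (to_fract c) * fps_X"
  "fract_fps (1 - fps_const c * fps_X) = 1 - fps_const (to_fract c) * fps_X"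
  by (auto simp: fract_fps_def fps_eq_iff)

text \<open>Partial fractions of the generating function: beside the constant 1 they consist of
  geometric series without constant term, which explains the exception at k = 0.\<close>

lemma to_fract_q_poly:
  "to_fract (q_poly k) = (if k = 0 then 1 else (\<Sum>i\<in>UNIV. weight i * X i ^ k))"
proof -
  let ?A = "\<Prod>i\<in>UNIV. 1 - fps_const (X i) * fps_X :: 'a ratfun fps"
  let ?B = "\<Prod>i\<in>UNIV. 1 + fps_const (X i) * fps_X :: 'a ratfun fps"
  define G where "G i = Abs_fps (\<lambda>k. if k = 0 then 0 else X i ^ k)" for i :: 'a
  have F: "fract_fps q_gen * ?A = ?B"
    using arg_cong[OF q_gen_mult[where 'n = 'a], of fract_fps]
    by (simp only: fract_fps_mult fract_fps_prod fract_fps_linear X_def)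
  have G: "G i * (1 - fps_const (X i) * fps_X) = fps_const (X i) * fps_X" for i
  proof (rule fps_ext)
    fix r
    show "fps_nth (G i * (1 - fps_const (X i) * fps_X)) r = fps_nth (fps_const (X i) * fps_X) r"
      by (cases r) (auto simp: G_def algebra_simps)
  qed
  let ?p = "\<Prod>b\<in>UNIV. [:1, X b:] :: 'a ratfun poly" and ?q = "\<Prod>b\<in>UNIV. [:1, - X b:] :: 'a ratfun poly"
  let ?r = "\<lambda>b. smult (weight b * X b) ([:0, 1:] * (\<Prod>d\<in>UNIV - {b}. [:1, - X d:])) :: 'a ratfun poly"
  \<comment> \<open>\<open>lagrange_reversed\<close> holds at every nonzero element of an infinite
    field, hence as an identity of polynomials, and so of power series.\<close>
  have "?p - ?q - (\<Sum>b\<in>UNIV. ?r b) = 0" (is "?D = 0")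
  proof (rule ccontr)
    assume "?D \<noteq> 0"
    then have "finite {t. poly ?D t = 0}"
      by (rule poly_roots_finite)
    moreover have "UNIV - {0} \<subseteq> {t. poly ?D t = 0}"
    proof
      fix t :: "'a ratfun" assume "t \<in> UNIV - {0}"
      then have "t \<noteq> 0" by simp
      from lagrange_reversed[OF this] show "t \<in> {t. poly ?D t = 0}"
        by (simp add: poly_prod poly_sum mult_ac)
    qed
    ultimately have "finite (UNIV - {0 :: 'a ratfun})"
      by (rule rev_finite_subset)
    then show False
      using infinite_UNIV_char_0[where 'a = "'a ratfun"] by simp
  qed
  then have "?p = ?q + (\<Sum>b\<in>UNIV. ?r b)"
    by (simp add: algebra_simps)
  then have poly: "fps_of_poly ?p = fps_of_poly (?q + (\<Sum>b\<in>UNIV. ?r b))"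
    by (simp only:)
  have lin: "fps_of_poly [:1, c:] = 1 + fps_const c * fps_X" "fps_of_poly [:1, - c:] = 1 - fps_const c * fps_X"
    "fps_of_poly [:0, 1:] = fps_X" for c :: "'a ratfun"
    by (simp_all add: fps_of_poly_linear' fps_of_poly_linear[of 0, simplified] flip: fps_const_neg)
  from poly have "?B = ?A + (\<Sum>b\<in>UNIV. fps_const (weight b * X b) * (fps_X * (\<Prod>d\<in>UNIV - {b}. 1 - fps_const (X d) * fps_X)))"
    unfolding fps_of_poly_add fps_of_poly_sum fps_of_poly_smult fps_of_poly_mult fps_of_poly_prod
    unfolding lin(2) unfolding lin(1,3) .
  also have "\<dots> = (1 + (\<Sum>b\<in>UNIV. fps_const (weight b) * G b)) * ?A"
  proof -
    have "fps_const (weight b * X b) * (fps_X * (\<Prod>d\<in>UNIV - {b}. 1 - fps_const (X d) * fps_X)) =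
        fps_const (weight b) * G b * ?A" for b
    proof -
      have "?A = (1 - fps_const (X b) * fps_X) * (\<Prod>d\<in>UNIV - {b}. 1 - fps_const (X d) * fps_X)"
        by (rule prod.remove) auto
      then have e: "fps_const (weight b) * G b * ?A =
          fps_const (weight b) * (G b * (1 - fps_const (X b) * fps_X)) * (\<Prod>d\<in>UNIV - {b}. 1 - fps_const (X d) * fps_X)"
        by (simp only: mult_ac)
      show ?thesis
        unfolding e G fps_const_mult[symmetric] by (simp only: mult_ac)
    qed
    then show ?thesis
      by (simp add: distrib_right sum_distrib_right)
  qed
  finally have "fract_fps q_gen * ?A = (1 + (\<Sum>b\<in>UNIV. fps_const (weight b) * G b)) * ?A"
    unfolding F .
  moreover have "?A \<noteq> 0"
  proof -
    have "1 - fps_const c * fps_X \<noteq> 0" for c :: "'a ratfun"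
    proof
      assume "1 - fps_const c * fps_X = 0"
      from arg_cong[OF this, of "\<lambda>f. fps_nth f 0"] show False by simp
    qed
    then show ?thesis by simp
  qed
  ultimately have "fract_fps q_gen = 1 + (\<Sum>b\<in>UNIV. fps_const (weight b) * G b)"
    by simp
  from arg_cong[OF this, of "\<lambda>f. fps_nth f k"] show ?thesis
    by (simp add: fract_fps_def q_poly_def fps_sum_nth G_def)
qed

text \<open>Partial fractions at s = - x_i, where the factor of index i vanishes.\<close>

lemma weight_sum: "(\<Sum>j\<in>UNIV. weight j * X j / (X i + X j)) = 1"
proof -
  have "- X i \<noteq> X b" for b
    using X_add_nonzero[of i b] by (auto simp: neg_eq_iff_add_eq_0 simp del: X_add_nonzero)
  then have "(\<Prod>b\<in>UNIV. (- X i + X b) / (- X i - X b)) = 1 + (\<Sum>b\<in>UNIV. weight b * X b / (- X i - X b))"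
    unfolding weight_def by (intro lagrange_quotient) (auto simp: inj_X)
  moreover have "(\<Prod>b\<in>UNIV. (- X i + X b) / (- X i - X b)) = 0"
    by (intro prod_zero bexI[of _ i]) auto
  moreover have "x / (- X i - X b) = - (x / (X i + X b))" for x b
  proof -
    have "- X i - X b = - (X i + X b)" by simp
    then show ?thesis by (simp only: minus_divide_right)
  qed
  ultimately show ?thesis
    by (simp add: sum_negf)
qed

text \<open>Arranged so that the first term is the kernel of Schur's identity and the second the
  contribution of the missing index p = l.\<close>

lemma alternating_geometric:
  fixes a b :: "'a::field"
  assumes "a + b \<noteq> 0" "l \<ge> 1"
  shows "b ^ l + 2 * (\<Sum>p\<in>{1..<l}. (- 1) ^ p * a ^ p * b ^ (l - p)) =
    b ^ l * ((b - a) / (b + a)) - 2 * (- 1) ^ l * a ^ l * (b / (a + b))"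
proof -
  define T where "T l = (\<Sum>p\<in>{1..<l}. (- 1) ^ p * a ^ p * b ^ (l - p))" for l
  have T_Suc: "T (Suc l) = b * T l + (- 1) ^ l * a ^ l * b" if "l \<ge> 1" for l
  proof -
    have "{1..<Suc l} = insert l {1..<l}"
      using that by auto
    then have "T (Suc l) = (- 1) ^ l * a ^ l * b + (\<Sum>p\<in>{1..<l}. (- 1) ^ p * a ^ p * b ^ (Suc l - p))"
      by (simp add: T_def)
    also have "(\<Sum>p\<in>{1..<l}. (- 1) ^ p * a ^ p * b ^ (Suc l - p)) = b * T l"
      unfolding T_def sum_distrib_left by (intro sum.cong refl) (simp add: Suc_diff_le mult_ac)
    finally show ?thesis
      by (simp only: add.commute)
  qed
  have "(a + b) * (b ^ l + 2 * T l) = (b - a) * b ^ l - 2 * (- 1) ^ l * a ^ l * b"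
    using assms(2)
  proof (induction l rule: dec_induct)
    case base
    then show ?case by (simp add: T_def algebra_simps)
  next
    case (step l)
    have "(a + b) * (b ^ Suc l + 2 * T (Suc l)) = b * ((a + b) * (b ^ l + 2 * T l)) + 2 * (a + b) * ((- 1) ^ l * a ^ l * b)"
      unfolding T_Suc[OF step(1)] by (simp add: algebra_simps)
    then show ?case
      unfolding step.IH by (simp add: algebra_simps)
  qed
  then have "b ^ l + 2 * T l = ((b - a) * b ^ l - 2 * (- 1) ^ l * a ^ l * b) / (a + b)"
    using assms(1) by (simp add: eq_divide_eq mult.commute)
  moreover have "(x * y - c * b) / d = y * (x / d) - c * (b / d)" for x y c d :: 'a
    by (simp add: diff_divide_distrib mult.commute)
  ultimately show ?thesis
    unfolding T_def add.commute[of b a] by simp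
qed

text \<open>The summand p = l of \<open>Q_pair\<close> contains q_0 = 1, which is not a weighted
  power sum. By \<open>weight_sum\<close> it cancels the last term of
  \<open>alternating_geometric\<close>.\<close>

lemma to_fract_Q_pair:
  assumes "k \<ge> 1" "l \<ge> 1"
  shows "to_fract (Q_pair k l) = (\<Sum>i\<in>UNIV. \<Sum>j\<in>UNIV.
    (weight i * X i ^ k) * (weight j * X j ^ l) * ((X j - X i) / (X j + X i)))"
proof -
  let ?q = "\<lambda>k. \<Sum>i\<in>UNIV. weight i * X i ^ k :: 'a ratfun"
  have q: "to_fract (q_poly k) = ?q k" if "k \<ge> 1" for k
    using that by (simp add: to_fract_q_poly)
  have sign: "to_fract ((- 1) ^ p) = (- 1 :: 'a ratfun) ^ p" for p
    by (simp add: to_fract_power)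
  have two: "to_fract 2 = (2 :: 'a ratfun)"
    using to_fract_add[of 1 "1 :: 'a mpoly"] by simp
  have l: "{1..l} = insert l {1..<l}"
    using assms(2) by auto
  have qq: "?q a * ?q b = (\<Sum>i\<in>UNIV. \<Sum>j\<in>UNIV. weight i * weight j * (X i ^ a * X j ^ b))" for a b
    by (simp add: sum_product mult_ac)
  have "to_fract (Q_pair k l) = ?q k * ?q l + 2 * (\<Sum>p\<in>{1..<l}. (- 1) ^ p * (?q (k + p) * ?q (l - p))) + 2 * (- 1) ^ l * ?q (k + l)"
  proof -
    have "(\<Sum>p=1..l. (- 1) ^ p * to_fract (q_poly (k + p)) * to_fract (q_poly (l - p))) =
        (- 1) ^ l * ?q (k + l) + (\<Sum>p\<in>{1..<l}. (- 1) ^ p * (?q (k + p) * ?q (l - p)))"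
    proof -
      have "(\<Sum>p\<in>{1..<l}. (- 1) ^ p * to_fract (q_poly (k + p)) * to_fract (q_poly (l - p))) =
          (\<Sum>p\<in>{1..<l}. (- 1) ^ p * (?q (k + p) * ?q (l - p)))"
      proof (intro sum.cong refl)
        fix p assume "p \<in> {1..<l}"
        then have "k + p \<ge> 1" "l - p \<ge> 1"
          by auto
        then show "(- 1) ^ p * to_fract (q_poly (k + p)) * to_fract (q_poly (l - p)) = (- 1) ^ p * (?q (k + p) * ?q (l - p))"
          by (simp only: q mult.assoc)
      qed
      moreover have "to_fract (q_poly (k + l)) = ?q (k + l)"
        using assms by (intro q) auto
      ultimately show ?thesis
        unfolding l by (simp add: to_fract_q_poly[of 0])
    qed
    then show ?thesis
      unfolding Q_pair_def using q assms by (simp add: sign two distrib_left mult.assoc)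
  qed
  also have "?q k * ?q l + 2 * (\<Sum>p\<in>{1..<l}. (- 1) ^ p * (?q (k + p) * ?q (l - p))) =
      (\<Sum>i\<in>UNIV. \<Sum>j\<in>UNIV. weight i * weight j * X i ^ k *
        (X j ^ l + 2 * (\<Sum>p\<in>{1..<l}. (- 1) ^ p * X i ^ p * X j ^ (l - p))))"
  proof -
    have "(\<Sum>p\<in>{1..<l}. (- 1) ^ p * (?q (k + p) * ?q (l - p))) =
        (\<Sum>p\<in>{1..<l}. \<Sum>i\<in>UNIV. \<Sum>j\<in>UNIV. (- 1) ^ p * (weight i * weight j * (X i ^ (k + p) * X j ^ (l - p))))"
      unfolding qq unfolding sum_distrib_left ..
    also have "\<dots> = (\<Sum>i\<in>UNIV. \<Sum>p\<in>{1..<l}. \<Sum>j\<in>UNIV. (- 1) ^ p * (weight i * weight j * (X i ^ (k + p) * X j ^ (l - p))))"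
      by (rule sum.swap)
    also have "\<dots> = (\<Sum>i\<in>UNIV. \<Sum>j\<in>UNIV. \<Sum>p\<in>{1..<l}. (- 1) ^ p * (weight i * weight j * (X i ^ (k + p) * X j ^ (l - p))))"
      by (intro sum.cong refl sum.swap)
    also have "\<dots> = (\<Sum>i\<in>UNIV. \<Sum>j\<in>UNIV. weight i * weight j * X i ^ k *
        (\<Sum>p\<in>{1..<l}. (- 1) ^ p * X i ^ p * X j ^ (l - p)))"
      by (simp add: sum_distrib_left power_add mult_ac)
    finally show ?thesis
      unfolding qq by (simp add: sum_distrib_left sum.distrib distrib_left mult_ac)
  qed
  also have "\<dots> = (\<Sum>i\<in>UNIV. \<Sum>j\<in>UNIV. weight i * weight j * X i ^ k *
      (X j ^ l * ((X j - X i) / (X j + X i)) - 2 * (- 1) ^ l * X i ^ l * (X j / (X i + X j))))"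
    by (intro sum.cong refl arg_cong2[of _ _ _ _ "(*)"] alternating_geometric assms X_add_nonzero)
  also have "\<dots> = (\<Sum>i\<in>UNIV. \<Sum>j\<in>UNIV. (weight i * X i ^ k) * (weight j * X j ^ l) * ((X j - X i) / (X j + X i))) -
      (\<Sum>i\<in>UNIV. 2 * (- 1) ^ l * (weight i * X i ^ (k + l)) * (\<Sum>j\<in>UNIV. weight j * X j / (X i + X j)))"
    by (simp add: right_diff_distrib sum_subtractf sum_distrib_left power_add mult_ac)
  finally show ?thesis
    unfolding weight_sum by (simp add: sum_distrib_left mult_ac)
qed

lemma to_fract_Q_pair_0:
  "to_fract (Q_pair k 0) = (if k = 0 then 1 else (\<Sum>i\<in>UNIV. weight i * X i ^ k))"
  by (simp add: Q_pair_def to_fract_q_poly)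

lemma prod_pairs:
  fixes h :: "nat \<Rightarrow> 'a::comm_monoid_mult"
  shows "(\<Prod>a<2 * m. h a) = (\<Prod>l<m. h (2 * l) * h (2 * l + 1))"
  by (induction m) (simp_all add: mult.assoc)

lemma pfaffian_cong:
  assumes "\<And>a b. a < b \<Longrightarrow> b < 2 * m \<Longrightarrow> A a b = B a b"
  shows "pfaffian m A = pfaffian m B"
proof -
  have "A (\<pi> (2 * l)) (\<pi> (2 * l + 1)) = B (\<pi> (2 * l)) (\<pi> (2 * l + 1))" if "\<pi> \<in> matchings m" "l < m" for \<pi> l
    using that permutes_in_image[of \<pi> "{..<2 * m}" "2 * l + 1"]
    by (intro assms) (auto simp: matchings_def)
  then show ?thesis
    unfolding pfaffian_matchings by (intro sum.cong refl arg_cong2[of _ _ _ _ "(*)"] prod.cong) auto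
qed

lemma to_fract_pfaffian: "to_fract (pfaffian m A) = pfaffian m (\<lambda>i j. to_fract (A i j))"
proof -
  have sign: "to_fract (of_int (sign \<pi>)) = (of_int (sign \<pi>) :: 'a fract)" for \<pi> :: "nat \<Rightarrow> nat"
    by (cases \<pi> rule: sign_cases) simp_all
  show ?thesis
    by (simp add: pfaffian_matchings sign to_fract_prod)
qed

text \<open>Choosing a pair of indices for each edge of a perfect matching is the same as choosing
  one index for each vertex.\<close>

lemma prod_sum_matching:
  fixes h :: "nat \<Rightarrow> 'i \<Rightarrow> 'i \<Rightarrow> 'a::comm_ring_1"
  assumes \<pi>: "\<pi> permutes {..<2 * m}" and fin: "\<And>a. finite (I a)"
  shows "(\<Prod>l<m. \<Sum>i\<in>I (\<pi> (2 * l)). \<Sum>j\<in>I (\<pi> (2 * l + 1)). h l i j) =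
    (\<Sum>f\<in>PiE {..<2 * m} I. \<Prod>l<m. h l (f (\<pi> (2 * l))) (f (\<pi> (2 * l + 1))))"
proof -
  let ?J = "\<lambda>l. I (\<pi> (2 * l)) \<times> I (\<pi> (2 * l + 1))"
  let ?pick = "\<lambda>g x. (let y = inv \<pi> x in if even y then fst (g (y div 2)) else snd (g (y div 2)))"
  let ?to = "\<lambda>g. \<lambda>x\<in>{..<2 * m}. ?pick g x"
  let ?from = "\<lambda>f. \<lambda>l\<in>{..<m}. (f (\<pi> (2 * l)), f (\<pi> (2 * l + 1)))"
  have inv: "inv \<pi> (\<pi> x) = x" "\<pi> (inv \<pi> x) = x" for x
    using permutes_inverses[OF \<pi>] by auto
  have range: "\<pi> x < 2 * m \<longleftrightarrow> x < 2 * m" for x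
    using permutes_in_image[OF \<pi>, of x] by simp
  have range': "inv \<pi> x < 2 * m \<longleftrightarrow> x < 2 * m" for x
    using range[of "inv \<pi> x"] inv by simp
  have "(\<Prod>l<m. \<Sum>i\<in>I (\<pi> (2 * l)). \<Sum>j\<in>I (\<pi> (2 * l + 1)). h l i j) = (\<Prod>l<m. \<Sum>p\<in>?J l. h l (fst p) (snd p))"
    by (intro prod.cong refl) (simp add: sum.cartesian_product case_prod_beta)
  also have "\<dots> = (\<Sum>g\<in>PiE {..<m} ?J. \<Prod>l<m. h l (fst (g l)) (snd (g l)))"
    by (rule prod_sum_PiE) (simp_all add: fin)
  also have "\<dots> = (\<Sum>f\<in>PiE {..<2 * m} I. \<Prod>l<m. h l (f (\<pi> (2 * l))) (f (\<pi> (2 * l + 1))))"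
  proof (rule sum.reindex_bij_witness[of _ ?from ?to])
    fix g assume g: "g \<in> PiE {..<m} ?J"
    have to: "?to g (\<pi> (2 * l)) = fst (g l)" "?to g (\<pi> (2 * l + 1)) = snd (g l)" if "l < m" for l
      using that range[of "2 * l"] range[of "2 * l + 1"] by (simp_all add: inv)
    show "?from (?to g) = g"
    proof
      fix l
      show "?from (?to g) l = g l"
        using to[of l] g by (cases "l < m") (auto simp: PiE_def extensional_def)
    qed
    show "?to g \<in> PiE {..<2 * m} I"
    proof (rule PiE_I)
      fix x assume x: "x \<in> {..<2 * m}"
      define y where "y = inv \<pi> x"
      have y: "y < 2 * m" "\<pi> y = x"
        using x range'[of x] inv by (auto simp: y_def)
      then have "y div 2 \<in> {..<m}"
        by auto
      then have "g (y div 2) \<in> ?J (y div 2)"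
        by (rule PiE_mem[OF g])
      then have mem: "fst (g (y div 2)) \<in> I (\<pi> (2 * (y div 2)))" "snd (g (y div 2)) \<in> I (\<pi> (2 * (y div 2) + 1))"
        by (simp_all only: mem_Times_iff)
      have eq: "?to g x = (if even y then fst (g (y div 2)) else snd (g (y div 2)))"
        using x by (simp only: restrict_apply' Let_def y_def)
      show "?to g x \<in> I x"
      proof (cases "even y")
        case True
        then have "2 * (y div 2) = y"
          by (rule dvd_mult_div_cancel)
        then show ?thesis
          using mem(1) y(2) unfolding eq if_P[OF True] by (simp only:)
      next
        case False
        then have "2 * (y div 2) + 1 = y"
          by (rule odd_two_times_div_two_succ)
        then show ?thesis
          using mem(2) y(2) unfolding eq if_not_P[OF False] by (simp only:)
      qed
    qed auto
    show "(\<Prod>l<m. h l (?to g (\<pi> (2 * l))) (?to g (\<pi> (2 * l + 1)))) = (\<Prod>l<m. h l (fst (g l)) (snd (g l)))"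
      using to by (intro prod.cong refl) (simp only: lessThan_iff)
  next
    fix f assume f: "f \<in> PiE {..<2 * m} I"
    show "?to (?from f) = f"
    proof
      fix x
      show "?to (?from f) x = f x"
      proof (cases "x < 2 * m")
        case True
        define y where "y = inv \<pi> x"
        have y: "y < 2 * m" "\<pi> y = x"
          using True range'[of x] inv by (auto simp: y_def)
        then have "y div 2 \<in> {..<m}" by auto
        then have bck: "?from f (y div 2) = (f (\<pi> (2 * (y div 2))), f (\<pi> (2 * (y div 2) + 1)))"
          by (rule restrict_apply')
        have eq: "?to (?from f) x = (if even y then fst (?from f (y div 2)) else snd (?from f (y div 2)))"
          using True by (simp only: restrict_apply' Let_def y_def lessThan_iff)
        show ?thesis
        proof (cases "even y")
          case True
          then have "2 * (y div 2) = y"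
            by (rule dvd_mult_div_cancel)
          then show ?thesis
            using y(2) unfolding eq if_P[OF True] bck by (simp only: fst_conv)
        next
          case False
          then have "2 * (y div 2) + 1 = y"
            by (rule odd_two_times_div_two_succ)
          then show ?thesis
            using y(2) unfolding eq if_not_P[OF False] bck by (simp only: snd_conv)
        qed
      next
        case False
        then show ?thesis
          using f by (simp add: PiE_def extensional_def)
      qed
    qed
    show "?from f \<in> PiE {..<m} ?J"
    proof (rule PiE_I)
      fix l assume l: "l \<in> {..<m}"
      then have "\<pi> (2 * l) \<in> {..<2 * m}" "\<pi> (2 * l + 1) \<in> {..<2 * m}"
        using range[of "2 * l"] range[of "2 * l + 1"] by auto
      from this[THEN PiE_mem[OF f]] show "?from f l \<in> ?J l"
        unfolding restrict_apply'[OF l] mem_Times_iff by simp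
    qed (simp only: restrict_apply if_False)
  qed
  finally show ?thesis .
qed

lemma pfaffian_multilinear:
  fixes c :: "nat \<Rightarrow> 'i \<Rightarrow> 'a::comm_ring_1"
  assumes fin: "\<And>a. finite (I a)"
  shows "pfaffian m (\<lambda>a b. \<Sum>i\<in>I a. \<Sum>j\<in>I b. c a i * c b j * E a b i j) =
    (\<Sum>f\<in>PiE {..<2 * m} I. (\<Prod>a<2 * m. c a (f a)) * pfaffian m (\<lambda>a b. E a b (f a) (f b)))"
proof -
  have "of_int (sign \<pi>) * (\<Prod>l<m. \<Sum>i\<in>I (\<pi> (2 * l)). \<Sum>j\<in>I (\<pi> (2 * l + 1)).
        c (\<pi> (2 * l)) i * c (\<pi> (2 * l + 1)) j * E (\<pi> (2 * l)) (\<pi> (2 * l + 1)) i j) =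
      (\<Sum>f\<in>PiE {..<2 * m} I. (\<Prod>a<2 * m. c a (f a)) *
        (of_int (sign \<pi>) * (\<Prod>l<m. E (\<pi> (2 * l)) (\<pi> (2 * l + 1)) (f (\<pi> (2 * l))) (f (\<pi> (2 * l + 1))))))"
    if "\<pi> \<in> matchings m" for \<pi>
  proof -
    have \<pi>: "\<pi> permutes {..<2 * m}"
      using that by (simp add: matchings_def)
    have c: "(\<Prod>l<m. c (\<pi> (2 * l)) (f (\<pi> (2 * l))) * c (\<pi> (2 * l + 1)) (f (\<pi> (2 * l + 1)))) = (\<Prod>a<2 * m. c a (f a))" for f
      using prod_pairs[of "\<lambda>a. c (\<pi> a) (f (\<pi> a))" m] prod.permute[OF \<pi>, of "\<lambda>a. c a (f a)"] by (simp add: o_def)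
    have f1: "(\<Prod>l<m. \<Sum>i\<in>I (\<pi> (2 * l)). \<Sum>j\<in>I (\<pi> (2 * l + 1)).
        c (\<pi> (2 * l)) i * c (\<pi> (2 * l + 1)) j * E (\<pi> (2 * l)) (\<pi> (2 * l + 1)) i j) =
      (\<Sum>f\<in>PiE {..<2 * m} I. \<Prod>l<m. c (\<pi> (2 * l)) (f (\<pi> (2 * l))) * c (\<pi> (2 * l + 1)) (f (\<pi> (2 * l + 1))) *
        E (\<pi> (2 * l)) (\<pi> (2 * l + 1)) (f (\<pi> (2 * l))) (f (\<pi> (2 * l + 1))))"
      by (rule prod_sum_matching[OF \<pi> fin])
    have f2: "(\<Prod>l<m. c (\<pi> (2 * l)) (f (\<pi> (2 * l))) * c (\<pi> (2 * l + 1)) (f (\<pi> (2 * l + 1))) *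
        E (\<pi> (2 * l)) (\<pi> (2 * l + 1)) (f (\<pi> (2 * l))) (f (\<pi> (2 * l + 1)))) =
      (\<Prod>a<2 * m. c a (f a)) * (\<Prod>l<m. E (\<pi> (2 * l)) (\<pi> (2 * l + 1)) (f (\<pi> (2 * l))) (f (\<pi> (2 * l + 1))))" for f
      unfolding c[symmetric] by (rule prod.distrib)
    show ?thesis
      unfolding f1 f2 sum_distrib_left by (intro sum.cong refl mult.left_commute)
  qed
  then have "pfaffian m (\<lambda>a b. \<Sum>i\<in>I a. \<Sum>j\<in>I b. c a i * c b j * E a b i j) =
      (\<Sum>\<pi>\<in>matchings m. \<Sum>f\<in>PiE {..<2 * m} I. (\<Prod>a<2 * m. c a (f a)) *
        (of_int (sign \<pi>) * (\<Prod>l<m. E (\<pi> (2 * l)) (\<pi> (2 * l + 1)) (f (\<pi> (2 * l))) (f (\<pi> (2 * l + 1))))))"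
    unfolding pfaffian_matchings by (intro sum.cong refl)
  also have "\<dots> = (\<Sum>f\<in>PiE {..<2 * m} I. (\<Prod>a<2 * m. c a (f a)) * pfaffian m (\<lambda>a b. E a b (f a) (f b)))"
    unfolding pfaffian_matchings sum_distrib_left by (rule sum.swap)
  finally show ?thesis .
qed

lemma eta_prod_cong: "(\<And>a. a \<in> S \<Longrightarrow> y a = z a) \<Longrightarrow> eta_prod y S = eta_prod z S"
  unfolding eta_prod_def eta_def by (intro prod.cong refl) auto

lemma X_inverse_sum_nonzero: "1 / X i + 1 / X j \<noteq> 0"
proof -
  have "1 / X i + 1 / X j = (X i + X j) / (X i * X j)"
    by (simp add: add_frac_eq add.commute)
  then show ?thesis by simp
qed

text \<open>In the inverse variables the kernel has the form of \<open>eta\<close>, and the entries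
  of the padding column become \<open>eta\<close> at the point 0.\<close>

lemma eta_X_inverse: "(1 / X i - 1 / X j) / (1 / X i + 1 / X j) = (X j - X i) / (X j + X i)"
proof -
  have "1 / X i + 1 / X j = (X j + X i) / (X i * X j)" "1 / X i - 1 / X j = (X j - X i) / (X i * X j)"
    by (simp_all add: field_simps)
  then show ?thesis by simp
qed

text \<open>
  The first \<open>length lam\<close> rows of the Pfaffian are expanded over the variables; the row that pads an
  odd sequence corresponds to the point \<open>0\<close> in the inverse variables and has no choice to make,
  hence the dummy \<open>i0\<close>.
\<close>

definition choices :: "nat list \<Rightarrow> 'n \<Rightarrow> (nat \<Rightarrow> 'n) set"
  where "choices lam i0 =
    PiE {..<length (even_padding lam)} (\<lambda>a. if a < length lam then UNIV else {i0})"

text \<open>The entries are bilinear in the rows, so the Pfaffian expands over choices of a variable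
  for each part; \<open>pfaffian_eta\<close> evaluates each term.\<close>

theorem to_fract_Q_poly:
  fixes i0 :: "'n::{finite,linorder}"
  assumes "strict_partition lam"
  shows "to_fract (Q_poly lam) = (\<Sum>f\<in>choices lam i0.
    (\<Prod>a<length lam. weight (f a) * X (f a) ^ (lam ! a)) * eta_prod (\<lambda>a. 1 / X (f a)) {..<length lam})"
proof -
  let ?n = "length lam" and ?mu = "even_padding lam"
  define m where "m = length ?mu div 2"
  let ?I = "\<lambda>a. if a < ?n then UNIV else {i0}"
  let ?c = "\<lambda>a (i :: 'n). if a < ?n then weight i * X i ^ (lam ! a) else 1"
  let ?Y = "\<lambda>a (i :: 'n). if a < ?n then 1 / X i else 0"
  have len: "length ?mu = 2 * m"
    by (auto simp: m_def even_padding_def)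
  have parity: "if even ?n then ?n = 2 * m else 2 * m = Suc ?n"
    using len by (simp add: even_padding_def split: if_splits)
  then have n: "?n = 2 * m \<or> 2 * m = Suc ?n"
    by (auto split: if_splits)
  have pos: "lam ! a \<ge> 1" if "a < ?n" for a
    using assms that by (auto simp: strict_partition_def Suc_le_eq)
  have mu: "?mu ! a = (if a < ?n then lam ! a else 0)" if "a < 2 * m" for a
    using that parity by (auto simp: even_padding_def nth_append split: if_splits)
  have entry: "to_fract (Q_pair (?mu ! a) (?mu ! b)) =
      (\<Sum>i\<in>?I a. \<Sum>j\<in>?I b. ?c a i * ?c b j * ((?Y a i - ?Y b j) / (?Y a i + ?Y b j)))" if "a < b" "b < 2 * m" for a b
  proof -
    have a: "a < ?n"
      using that n by auto
    show ?thesis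
    proof (cases "b < ?n")
      case True
      then show ?thesis
        using a that mu pos by (simp add: to_fract_Q_pair eta_X_inverse)
    next
      case False
      then show ?thesis
        using a that mu pos[OF a] by (simp add: to_fract_Q_pair_0)
    qed
  qed
  have "to_fract (Q_poly lam) = pfaffian m (\<lambda>a b. \<Sum>i\<in>?I a. \<Sum>j\<in>?I b. ?c a i * ?c b j * ((?Y a i - ?Y b j) / (?Y a i + ?Y b j)))"
    unfolding Q_poly_def Let_def to_fract_pfaffian m_def[symmetric]
    by (rule pfaffian_cong) (simp add: entry)
  also have "\<dots> = (\<Sum>f\<in>PiE {..<2 * m} ?I. (\<Prod>a<2 * m. ?c a (f a)) *
      pfaffian m (\<lambda>a b. (?Y a (f a) - ?Y b (f b)) / (?Y a (f a) + ?Y b (f b))))"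
    by (rule pfaffian_multilinear) simp
  also have "\<dots> = (\<Sum>f\<in>choices lam i0.
    (\<Prod>a<?n. weight (f a) * X (f a) ^ (lam ! a)) * eta_prod (\<lambda>a. 1 / X (f a)) {..<?n})"
    unfolding choices_def len
  proof (intro sum.cong refl arg_cong2[of _ _ _ _ "(*)"])
    fix f :: "nat \<Rightarrow> 'n"
    let ?y = "\<lambda>a. ?Y a (f a)"
    show "(\<Prod>a<2 * m. ?c a (f a)) = (\<Prod>a<?n. weight (f a) * X (f a) ^ (lam ! a))"
      using n by (auto intro: prod.cong)
    have "pfaffian m (\<lambda>a b. (?y a - ?y b) / (?y a + ?y b)) = pfaffian m (eta ?y)"
      by (simp add: eta_def[abs_def])
    also have "\<dots> = eta_prod ?y {..<2 * m}"
      by (rule pfaffian_eta) (use n in \<open>auto simp: X_inverse_sum_nonzero\<close>)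
    also have "\<dots> = eta_prod ?y {..<?n}"
      using n
    proof
      \<comment> \<open>The padding point 0 in last position costs (-1)^n, and its n factors
        \<open>eta ?y ?n d = - 1\<close> give the same sign again.\<close>
      assume m: "2 * m = Suc ?n"
      have "{c \<in> {..<2 * m}. c < ?n} = {..<?n}" "{..<2 * m} - {?n} = {..<?n}"
        using m by auto
      moreover have "(\<Prod>d<?n. eta ?y ?n d) = (\<Prod>d<?n. - 1)"
        by (intro prod.cong refl) (simp add: eta_def)
      moreover have "(- 1) ^ ?n * (- 1) ^ ?n = (1 :: 'n ratfun)"
        by (simp flip: power_mult_distrib)
      ultimately show ?thesis
        using eta_prod_remove[of "{..<2 * m}" ?n ?y] m by simp
    qed simp
    also have "\<dots> = eta_prod (\<lambda>a. 1 / X (f a)) {..<?n}"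
      by (rule eta_prod_cong) simp
    finally show "pfaffian m (\<lambda>a b. (?y a - ?y b) / (?y a + ?y b)) = eta_prod (\<lambda>a. 1 / X (f a)) {..<?n}" .
  qed
  finally show ?thesis .
qed

section \<open>The polynomials \<open>Q\<^sub>\<lambda>\<close> are eigenfunctions\<close>

lemma delta_eta_prod: "delta * eta_prod X UNIV = 1"
proof -
  let ?P = "{(a, b). a < (b::'a)}"
  have "eta_prod X UNIV = (\<Prod>(a, b)\<in>?P. eta X a b)"
    by (simp add: eta_prod_def)
  then have "delta * eta_prod X UNIV =
      (\<Prod>p\<in>?P. (case p of (a, b) \<Rightarrow> (X a + X b) / (X a - X b)) * (case p of (a, b) \<Rightarrow> eta X a b))"
    unfolding delta_def by (simp only: prod.distrib)
  also have "\<dots> = 1"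
    by (intro prod.neutral) (auto simp: eta_def)
  finally show ?thesis .
qed

lemma eta_prod_X_nonzero: "eta_prod X S \<noteq> 0"
proof -
  have "eta X a b \<noteq> 0" if "a < b" for a b :: 'a
    using that by (simp add: eta_def)
  then show ?thesis
    unfolding eta_prod_def by (cases "finite {(a, b). a \<in> S \<and> b \<in> S \<and> a < b}") (auto simp: prod_zero_iff)
qed

text \<open>The weights of the chosen variables cancel all factors of \<open>eta_prod X UNIV\<close> that involve them.\<close>

lemma weight_collapse:
  assumes "inj_on f {..<k}"
  shows "\<exists>c. (c = 2 ^ k \<or> c = - (2 ^ k)) \<and>
    (\<Prod>a<k. weight (f a)) * eta_prod (\<lambda>a. 1 / X (f a)) {..<k} * eta_prod X UNIV =
    c * eta_prod X (UNIV - f ` {..<k})"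
  using assms
proof (induction k)
  case 0
  show ?case
    by (rule exI[of _ 1]) (simp add: eta_prod_def)
next
  case (Suc k)
  let ?y = "\<lambda>a. 1 / X (f a)"
  let ?i = "f k" and ?B = "UNIV - f ` {..<k}"
  have inj: "inj_on f {..<k}"
    using Suc.prems by (rule inj_on_subset) auto
  from Suc.IH[OF inj] obtain c where c: "c = 2 ^ k \<or> c = - (2 ^ k)"
    and IH: "(\<Prod>a<k. weight (f a)) * eta_prod ?y {..<k} * eta_prod X UNIV = c * eta_prod X ?B"
    by blast
  have iB: "?i \<in> ?B"
    using inj_onD[OF Suc.prems, of k] by fastforce
  have B: "?B - {?i} = UNIV - f ` {..<Suc k}"
    by (auto simp: lessThan_Suc)
  let ?p = "\<Prod>d\<in>?B - {?i}. eta X ?i d" and ?q = "\<Prod>d<k. eta X ?i (f d)"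
  have nz: "eta X ?i d \<noteq> 0" if "d \<noteq> ?i" for d
    using that by (simp add: eta_def)
  have pq: "?p \<noteq> 0" "?q \<noteq> 0"
    using nz iB by (auto, metis imageI lessThan_iff)
  have w: "weight ?i = 2 / (?p * ?q)"
  proof -
    have "UNIV - {?i} = (?B - {?i}) \<union> f ` {..<k}"
      using iB by auto
    then have "(\<Prod>d\<in>UNIV - {?i}. eta X ?i d) = ?p * (\<Prod>d\<in>f ` {..<k}. eta X ?i d)"
      by (simp only:) (rule prod.union_disjoint; auto)
    also have "(\<Prod>d\<in>f ` {..<k}. eta X ?i d) = ?q"
      by (simp add: prod.reindex[OF inj])
    finally have "(\<Prod>d\<in>UNIV - {?i}. eta X ?i d) = ?p * ?q" .
    moreover have "lagrange X UNIV ?i = 1 / (\<Prod>d\<in>UNIV - {?i}. eta X ?i d)"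
    proof -
      have "lagrange X UNIV ?i = (\<Prod>d\<in>UNIV - {?i}. 1 / eta X ?i d)"
        unfolding lagrange_def by (simp add: eta_def)
      then show ?thesis
        by (simp add: prod_dividef)
    qed
    ultimately show ?thesis
      by (simp add: weight_def)
  qed
  obtain s :: "'a ratfun" where s: "s = 1 \<or> s = - 1" "eta_prod X ?B = s * ?p * eta_prod X (?B - {?i})"
  proof (rule that)
    show "(- 1) ^ n = (1 :: 'a ratfun) \<or> (- 1) ^ n = (- 1 :: 'a ratfun)" for n
      by (cases "even n") simp_all
    show "eta_prod X ?B = (- 1) ^ card {c \<in> ?B. c < ?i} * ?p * eta_prod X (?B - {?i})"
      by (rule eta_prod_remove[OF _ iB]) simp
  qed
  \<comment> \<open>The last index gives (-1)^k by its position and (-1)^k by inverting the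
    variables; ?q then cancels against the weight.\<close>
  have e: "eta_prod ?y {..<Suc k} = ?q * eta_prod ?y {..<k}"
  proof -
    have "{..<Suc k} - {k} = {..<k}" "{c \<in> {..<Suc k}. c < k} = {..<k}"
      by auto
    then have "eta_prod ?y {..<Suc k} = (- 1) ^ k * (\<Prod>d<k. eta ?y k d) * eta_prod ?y {..<k}"
      using eta_prod_remove[of "{..<Suc k}" k ?y] by simp
    also have "(\<Prod>d<k. eta ?y k d) = (\<Prod>d<k. - 1 * eta X ?i (f d))"
    proof (intro prod.cong refl)
      fix d
      show "eta ?y k d = - 1 * eta X ?i (f d)"
        using eta_swap[of X "f d" ?i] by (simp only: eta_def eta_X_inverse mult_minus1)
    qed
    also have "\<dots> = (- 1) ^ k * ?q"
      by (simp only: prod.distrib prod_constant card_lessThan)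
    finally show ?thesis
      by (simp add: mult.assoc[symmetric] flip: power_mult_distrib)
  qed
  have "(\<Prod>a<Suc k. weight (f a)) * eta_prod ?y {..<Suc k} * eta_prod X UNIV =
      weight ?i * ?q * ((\<Prod>a<k. weight (f a)) * eta_prod ?y {..<k} * eta_prod X UNIV)"
    unfolding e prod.lessThan_Suc by (simp only: mult_ac)
  also have "\<dots> = (2 * c * s) * eta_prod X (UNIV - f ` {..<Suc k})"
  proof -
    have "2 / (p * q) * q * (c * (s * p * e)) = 2 * c * s * e" if "p \<noteq> 0" "q \<noteq> 0" for p q e
      using that by simp
    from this[OF pq] show ?thesis
      unfolding IH s(2) w B .
  qed
  finally show ?case
    using c s(1) by (intro exI[of _ "2 * c * s"]) auto
qed

definition exponent :: "nat list \<Rightarrow> (nat \<Rightarrow> 'n) \<Rightarrow> 'n \<Rightarrow>\<^sub>0 nat"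
  where "exponent lam f = (\<Sum>a<length lam. Poly_Mapping.single (f a) (lam ! a))"

lemma lookup_exponent:
  assumes "inj_on f {..<length lam}"
  shows "a < length lam \<Longrightarrow> Poly_Mapping.lookup (exponent lam f) (f a) = lam ! a"
    "i \<notin> f ` {..<length lam} \<Longrightarrow> Poly_Mapping.lookup (exponent lam f) i = 0"
proof -
  assume a: "a < length lam"
  have "Poly_Mapping.lookup (exponent lam f) (f a) = (\<Sum>b<length lam. if b = a then lam ! b else 0)"
    unfolding exponent_def lookup_sum using assms a
    by (intro sum.cong refl) (auto simp: lookup_single when_def inj_on_def)
  then show "Poly_Mapping.lookup (exponent lam f) (f a) = lam ! a"
    using a by simp
next
  assume "i \<notin> f ` {..<length lam}"
  then show "Poly_Mapping.lookup (exponent lam f) i = 0"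
    unfolding exponent_def lookup_sum by (intro sum.neutral) (auto simp: lookup_single when_def)
qed

lemma pow_exponent:
  assumes "inj_on f {..<length lam}"
  shows "pow (Poly_Mapping.lookup (exponent lam f)) (Suc j) =
    (\<Sum>a<length lam. qm (lam ! a) ^ Suc j - qp (lam ! a) ^ Suc j)"
proof -
  let ?h = "\<lambda>l. qm l ^ Suc j - qp l ^ Suc j"
  have "?h 0 = 0"
    by (simp add: qm_def qp_def)
  then have "pow (Poly_Mapping.lookup (exponent lam f)) (Suc j) =
      (\<Sum>i\<in>f ` {..<length lam}. ?h (Poly_Mapping.lookup (exponent lam f) i))"
    unfolding pow_def using lookup_exponent(2)[OF assms]
    by (intro sum.mono_neutral_right) auto
  also have "\<dots> = (\<Sum>a<length lam. ?h (Poly_Mapping.lookup (exponent lam f) (f a)))"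
    by (simp only: sum.reindex[OF assms] o_def)
  also have "\<dots> = (\<Sum>a<length lam. ?h (lam ! a))"
    by (intro sum.cong refl) (simp only: lookup_exponent(1)[OF assms] lessThan_iff)
  finally show ?thesis .
qed

text \<open>A stage in expanding \<open>eta_prod\<close>: \<iota> joins the variables already paired
  in g, its fixed points carry the exponents l, and the variables in S are still free.\<close>

definition pairing :: "('n::{finite,linorder} \<Rightarrow> nat) \<Rightarrow> 'n set \<Rightarrow> 'n ratfun \<Rightarrow> bool"
  where "pairing l S g \<longleftrightarrow> (\<exists>\<iota>. (\<forall>i. \<iota> (\<iota> i) = i) \<and>
    (\<forall>i. \<iota> i \<noteq> i \<longrightarrow> euler (\<iota> i) g = - euler i g \<and> l i = 0) \<and>
    (\<forall>i. \<iota> i = i \<longrightarrow> euler i g = of_nat (l i) * g) \<and> (\<forall>i\<in>S. \<iota> i = i \<and> l i = 0))"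

lemma pairing_subset: "pairing l S g \<Longrightarrow> T \<subseteq> S \<Longrightarrow> pairing l T g"
  unfolding pairing_def by blast

lemma euler_eta:
  assumes "i \<noteq> j"
  shows "euler k (eta X i j) = (if k = i then euler i (eta X i j) else if k = j then - euler i (eta X i j) else 0)"
proof -
  have e: "euler k (eta X i j) =
      ((euler k (X i) - euler k (X j)) * (X i + X j) - (X i - X j) * (euler k (X i) + euler k (X j))) / (X i + X j)\<^sup>2" for k
    by (simp add: eta_def euler.divide euler.add euler.diff)
  have "euler j (eta X i j) = - euler i (eta X i j)"
    using assms unfolding e minus_divide_left by (simp add: euler_X algebra_simps)
  moreover have "euler k (eta X i j) = 0" if "k \<noteq> i" "k \<noteq> j"
    unfolding e using that by (simp add: euler_X)
  ultimately show ?thesis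
    by auto
qed

lemma pairing_insert:
  assumes "pairing l S g" "a \<in> S" "b \<in> S" "a \<noteq> b"
  shows "pairing l (S - {a, b}) (g * eta X a b)"
proof -
  obtain \<iota> where inv: "\<And>i. \<iota> (\<iota> i) = i"
    and pair: "\<And>i. \<iota> i \<noteq> i \<Longrightarrow> euler (\<iota> i) g = - euler i g \<and> l i = 0"
    and fixed: "\<And>i. \<iota> i = i \<Longrightarrow> euler i g = of_nat (l i) * g"
    and S: "\<And>i. i \<in> S \<Longrightarrow> \<iota> i = i \<and> l i = 0"
    using assms(1) unfolding pairing_def by blast
  have ab: "\<iota> a = a" "\<iota> b = b" "l a = 0" "l b = 0" "euler a g = 0" "euler b g = 0"
    using S[OF assms(2)] S[OF assms(3)] fixed[of a] fixed[of b] by auto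
  let ?i = "\<iota>(a := b, b := a)"
  have other: "\<iota> i \<noteq> a \<and> \<iota> i \<noteq> b" if "i \<noteq> a" "i \<noteq> b" for i
    using inv[of i] ab that by auto
  have e: "euler k (g * eta X a b) = euler k g * eta X a b" if "k \<noteq> a" "k \<noteq> b" for k
    using that euler_eta[OF assms(4), of k] by (simp add: euler.mult)
  have "euler (?i i) (g * eta X a b) = - euler i (g * eta X a b) \<and> l i = 0" if "?i i \<noteq> i" for i
  proof (cases "i = a \<or> i = b")
    case True
    then show ?thesis
      using ab assms(4) euler_eta[OF assms(4), of b] by (auto simp: euler.mult)
  next
    case False
    then show ?thesis
      using that other[of i] pair[of i] by (simp add: e)
  qed
  moreover have "euler i (g * eta X a b) = of_nat (l i) * (g * eta X a b)" if "?i i = i" for i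
  proof -
    have "i \<noteq> a" "i \<noteq> b" "\<iota> i = i"
      using that assms(4) by (auto split: if_splits)
    then show ?thesis
      by (simp add: e fixed)
  qed
  moreover have "?i (?i i) = i" for i
    using inv[of i] other[of i] assms(4) by auto
  moreover have "\<forall>i\<in>S - {a, b}. ?i i = i \<and> l i = 0"
    using S by auto
  ultimately show ?thesis
    unfolding pairing_def by blast
qed

lemma pow_op_sum: "pow_op j (\<Sum>a\<in>A. f a) = (\<Sum>a\<in>A. pow_op j (f a))"
  using diff_op_setsum[OF diff_op_pow_op[OF diff_op_id]] .

text \<open>Expansion of \<open>eta_prod\<close> into products over disjoint pairs: an even set
  pairs its minimum with each other element, an odd set drops one element, which stays unpaired with
  exponent 0. Fully expanded terms are covered by \<open>pow_op_paired\<close>.\<close>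

lemma pow_op_eta_prod:
  assumes "pairing l S g"
  shows "pow_op (Suc j) (g * eta_prod X S) = scalar (pow l (Suc j)) * (g * eta_prod X S)"
  using assms
proof (induction "card S" arbitrary: S g rule: less_induct)
  case less
  have sum_case: "pow_op (Suc j) (g * (\<Sum>b\<in>B. (- 1) ^ n b * h b)) = scalar (pow l (Suc j)) * (g * (\<Sum>b\<in>B. (- 1) ^ n b * h b))"
    if "\<And>b. b \<in> B \<Longrightarrow> pow_op (Suc j) (g * h b) = scalar (pow l (Suc j)) * (g * h b)" for B :: "'a set" and n h
  proof -
    have sign: "(- 1) ^ k = (scalar ((- 1) ^ k) :: 'a ratfun)" for k
      by (simp add: scalar_power scalar_minus)
    have "g * (\<Sum>b\<in>B. (- 1) ^ n b * h b) = (\<Sum>b\<in>B. scalar ((- 1) ^ n b) * (g * h b))"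
      unfolding sum_distrib_left sign by (intro sum.cong refl mult.left_commute)
    moreover have "pow_op (Suc j) (\<Sum>b\<in>B. scalar ((- 1) ^ n b) * (g * h b)) =
        (\<Sum>b\<in>B. scalar ((- 1) ^ n b) * (scalar (pow l (Suc j)) * (g * h b)))"
      unfolding pow_op_sum pow_op_scalar by (intro sum.cong refl) (simp only: that)
    moreover have "\<dots> = scalar (pow l (Suc j)) * (\<Sum>b\<in>B. scalar ((- 1) ^ n b) * (g * h b))"
      unfolding sum_distrib_left by (intro sum.cong refl mult.left_commute)
    ultimately show ?thesis
      by (simp only:)
  qed
  have fin: "finite S" by simp
  show ?case
  proof (cases "S = {}")
    case True
    obtain \<iota> where "\<And>i. \<iota> (\<iota> i) = i"
      "\<And>i. \<iota> i \<noteq> i \<Longrightarrow> euler (\<iota> i) g = - euler i g \<and> l i = 0"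
      "\<And>i. \<iota> i = i \<Longrightarrow> euler i g = of_nat (l i) * g"
      using less.prems unfolding pairing_def by blast
    then have "pow_op (Suc j) g = scalar (pow l (Suc j)) * g"
      by (intro pow_op_paired[of \<iota>]) blast+
    then show ?thesis
      using True by (simp add: eta_prod_def)
  next
    case False
    show ?thesis
    proof (cases "odd (card S)")
      case True
      have m1: "(0 - X b) / (0 + X b) = - 1" for b :: 'a
        by simp
      have "(\<Prod>b\<in>S. (- 1 :: 'a ratfun)) = - 1"
        using True by simp
      then have e: "eta_prod X S = (\<Sum>b\<in>S. (- 1) ^ card {c \<in> S. c < b} * eta_prod X (S - {b}))"
      proof -
        \<comment> \<open>\<open>eta_prod_expand\<close> with y0 = 0, where all quotients are
          -1.\<close>
        have "(\<Sum>b\<in>S. (- 1) ^ card {c \<in> S. c < b} * ((0 - X b) / (0 + X b)) * eta_prod X (S - {b})) =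
            (\<Prod>b\<in>S. (0 - X b) / (0 + X b)) * eta_prod X S"
          by (rule eta_prod_expand[OF fin True]) simp_all
        then show ?thesis
          unfolding m1 \<open>(\<Prod>b\<in>S. (- 1 :: 'a ratfun)) = - 1\<close> by (simp add: sum_negf)
      qed
      show ?thesis
        unfolding e
      proof (rule sum_case)
        fix b assume b: "b \<in> S"
        show "pow_op (Suc j) (g * eta_prod X (S - {b})) = scalar (pow l (Suc j)) * (g * eta_prod X (S - {b}))"
          by (rule less.hyps[OF card_Diff1_less[OF fin b] pairing_subset[OF less.prems Diff_subset]])
      qed
    next
      case even: False
      define a where "a = Min S"
      have a: "a \<in> S" "{c \<in> S. c < a} = {}"
        using False by (auto simp: a_def not_less)
      let ?B = "S - {a}"
      have odd: "odd (card ?B)"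
        using even False card_Suc_Diff1[OF fin a(1)] by (metis even_Suc)
      \<comment> \<open>The minimum serves as y0; the rest has odd cardinality, and removing the
        minimum costs no sign.\<close>
      have "(\<Sum>b\<in>?B. (- 1) ^ card {c \<in> ?B. c < b} * ((X a - X b) / (X a + X b)) * eta_prod X (?B - {b})) =
          (\<Prod>b\<in>?B. (X a - X b) / (X a + X b)) * eta_prod X ?B"
        by (rule eta_prod_expand) (use odd in auto)
      then have e: "eta_prod X S = (\<Sum>b\<in>?B. (- 1) ^ card {c \<in> ?B. c < b} * (eta X a b * eta_prod X (?B - {b})))"
        unfolding eta_prod_remove[OF fin a(1)] a(2) by (simp add: eta_def mult.assoc)
      show ?thesis
        unfolding e
      proof (rule sum_case)
        fix b assume b: "b \<in> ?B"
        have "?B - {b} = S - {a, b}"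
          by auto
        moreover have "pow_op (Suc j) ((g * eta X a b) * eta_prod X (S - {a, b})) =
            scalar (pow l (Suc j)) * ((g * eta X a b) * eta_prod X (S - {a, b}))"
          using b a by (intro less.hyps pairing_insert less.prems psubset_card_mono) auto
        ultimately show "pow_op (Suc j) (g * (eta X a b * eta_prod X (?B - {b}))) =
            scalar (pow l (Suc j)) * (g * (eta X a b * eta_prod X (?B - {b})))"
          by (simp only: mult.assoc)
      qed
    qed
  qed
qed

lemma to_fract_Q_poly_terms:
  fixes i0 :: "'n::{finite,linorder}"
  assumes "strict_partition lam"
  shows "\<exists>c. (\<forall>f. c f \<noteq> 0) \<and> to_fract (Q_poly lam) * eta_prod X UNIV =
    (\<Sum>f\<in>{f \<in> choices lam i0. inj_on f {..<length lam}}.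
      scalar (c f) * (Mon (exponent lam f) * eta_prod X (UNIV - f ` {..<length lam})))"
proof -
  let ?n = "length lam"
  let ?T = "\<lambda>f :: nat \<Rightarrow> 'n. (\<Prod>a<?n. weight (f a) * X (f a) ^ (lam ! a)) * eta_prod (\<lambda>a. 1 / X (f a)) {..<?n}"
  have "\<exists>c. c \<noteq> 0 \<and> ?T f * eta_prod X UNIV = scalar c * (Mon (exponent lam f) * eta_prod X (UNIV - f ` {..<?n}))"
    if inj: "inj_on f {..<?n}" for f
  proof -
    obtain c where c: "c = 2 ^ ?n \<or> c = - (2 ^ ?n)"
      and e: "(\<Prod>a<?n. weight (f a)) * eta_prod (\<lambda>a. 1 / X (f a)) {..<?n} * eta_prod X UNIV = c * eta_prod X (UNIV - f ` {..<?n})"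
      using weight_collapse[OF inj] by blast
    have "Mon (exponent lam f) = (\<Prod>a<?n. X (f a) ^ (lam ! a))"
      by (simp add: exponent_def Mon_sum Mon_single)
    then have "?T f * eta_prod X UNIV = Mon (exponent lam f) *
        ((\<Prod>a<?n. weight (f a)) * eta_prod (\<lambda>a. 1 / X (f a)) {..<?n} * eta_prod X UNIV)"
      by (simp only: prod.distrib mult_ac)
    then have "?T f * eta_prod X UNIV = c * (Mon (exponent lam f) * eta_prod X (UNIV - f ` {..<?n}))"
      unfolding e by (simp only: mult_ac)
    moreover have "c = scalar (2 ^ ?n) \<or> c = scalar (- (2 ^ ?n))"
      using c by (simp add: scalar_power scalar_minus)
    moreover have "(2 :: complex) ^ ?n \<noteq> 0" "- ((2 :: complex) ^ ?n) \<noteq> 0"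
      by simp_all
    ultimately show ?thesis
      by blast
  qed
  then have "\<forall>f. \<exists>c. inj_on f {..<?n} \<longrightarrow> c \<noteq> 0 \<and>
      ?T f * eta_prod X UNIV = scalar c * (Mon (exponent lam f) * eta_prod X (UNIV - f ` {..<?n}))"
    by blast
  from choice[OF this] obtain c' where c': "\<And>f. inj_on f {..<?n} \<Longrightarrow> c' f \<noteq> 0 \<and>
      ?T f * eta_prod X UNIV = scalar (c' f) * (Mon (exponent lam f) * eta_prod X (UNIV - f ` {..<?n}))"
    by blast
  define c where "c f = (if inj_on f {..<?n} then c' f else 1)" for f
  have zero: "?T f = 0" if "\<not> inj_on f {..<?n}" for f
  proof -
    obtain a b where "a < ?n" "b < ?n" "a < b" "f a = f b"
      using \<open>\<not> inj_on f {..<?n}\<close> unfolding inj_on_def by (metis lessThan_iff linorder_neqE)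
    then have "eta_prod (\<lambda>a. 1 / X (f a)) {..<?n} = 0"
      by (intro eta_prod_eq_0[of _ a b]) auto
    then show ?thesis by simp
  qed
  have fin: "finite (choices lam i0)"
    unfolding choices_def by (intro finite_PiE) auto
  have "to_fract (Q_poly lam) * eta_prod X UNIV = (\<Sum>f\<in>choices lam i0. ?T f * eta_prod X UNIV)"
    unfolding to_fract_Q_poly[OF assms, of i0] sum_distrib_right ..
  also have "\<dots> = (\<Sum>f\<in>{f \<in> choices lam i0. inj_on f {..<?n}}. ?T f * eta_prod X UNIV)"
    using zero by (intro sum.mono_neutral_right fin) auto
  also have "\<dots> = (\<Sum>f\<in>{f \<in> choices lam i0. inj_on f {..<?n}}.
      scalar (c f) * (Mon (exponent lam f) * eta_prod X (UNIV - f ` {..<?n})))"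
    using c' by (intro sum.cong refl) (simp add: c_def)
  finally show ?thesis
    using c' by (intro exI[of _ c]) (auto simp: c_def)
qed

lemma pow_op_Q_poly:
  fixes f0 :: "nat \<Rightarrow> 'n::{finite,linorder}"
  assumes "strict_partition lam" "inj_on f0 {..<length lam}"
  shows "pow_op (Suc j) (to_fract (Q_poly lam :: 'n mpoly) * eta_prod X UNIV) =
    scalar (pow (Poly_Mapping.lookup (exponent lam f0)) (Suc j)) * (to_fract (Q_poly lam) * eta_prod X UNIV)"
proof -
  let ?n = "length lam"
  let ?F = "\<lambda>f :: nat \<Rightarrow> 'n. Mon (exponent lam f) * eta_prod X (UNIV - f ` {..<?n})"
  obtain c where c: "to_fract (Q_poly lam) * eta_prod X UNIV =
      (\<Sum>f\<in>{f \<in> choices lam undefined. inj_on f {..<?n}}. scalar (c f) * ?F f)"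
    using to_fract_Q_poly_terms[OF assms(1)] by blast
  have "pow_op (Suc j) (?F f) = scalar (pow (Poly_Mapping.lookup (exponent lam f0)) (Suc j)) * ?F f"
    if "inj_on f {..<?n}" for f
  proof -
    have "pairing (Poly_Mapping.lookup (exponent lam f)) (UNIV - f ` {..<?n}) (Mon (exponent lam f))"
      unfolding pairing_def using lookup_exponent(2)[OF that]
      by (intro exI[of _ id]) (auto simp: euler_Mon)
    from pow_op_eta_prod[OF this] show ?thesis
      unfolding pow_exponent[OF that] pow_exponent[OF assms(2)] .
  qed
  then have "pow_op (Suc j) (\<Sum>f\<in>{f \<in> choices lam undefined. inj_on f {..<?n}}. scalar (c f) * ?F f) =
      (\<Sum>f\<in>{f \<in> choices lam undefined. inj_on f {..<?n}}.
        scalar (c f) * (scalar (pow (Poly_Mapping.lookup (exponent lam f0)) (Suc j)) * ?F f))"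
    unfolding pow_op_sum pow_op_scalar by (intro sum.cong refl) simp
  also have "\<dots> = scalar (pow (Poly_Mapping.lookup (exponent lam f0)) (Suc j)) *
      (\<Sum>f\<in>{f \<in> choices lam undefined. inj_on f {..<?n}}. scalar (c f) * ?F f)"
    unfolding sum_distrib_left by (intro sum.cong refl mult.left_commute)
  finally show ?thesis
    unfolding c .
qed

text \<open>A partition with more parts than variables leaves no injective choice.\<close>

lemma Q_poly_eq_0:
  assumes "strict_partition lam" "\<not> (\<exists>f :: nat \<Rightarrow> 'n::{finite,linorder}. inj_on f {..<length lam})"
  shows "(Q_poly lam :: 'n mpoly) = 0"
proof -
  have "{f \<in> choices lam undefined. inj_on f {..<length lam}} = ({} :: (nat \<Rightarrow> 'n) set)"
    using assms(2) by blast
  moreover obtain c where "to_fract (Q_poly lam) * eta_prod X UNIV =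
      (\<Sum>f\<in>{f \<in> choices lam undefined. inj_on f {..<length lam}}.
        scalar (c f) * (Mon (exponent lam f) * eta_prod X (UNIV - f ` {..<length lam}) :: 'n ratfun))"
    using to_fract_Q_poly_terms[OF assms(1)] by blast
  ultimately have "to_fract (Q_poly lam :: 'n mpoly) * eta_prod X UNIV = 0"
    by (simp only: sum.empty)
  then show ?thesis
    by (simp add: eta_prod_X_nonzero)
qed

lemma Omega_conj:
  assumes "odd k"
  shows "Omega k f = delta * conj_Omega k (f * eta_prod X UNIV)"
proof -
  have e: "delta * (f * eta_prod X UNIV) = f"
    by (simp only: mult.left_commute[of delta] delta_eta_prod mult_1_right)
  show ?thesis
    using Omega_conj_delta[OF assms, of "f * eta_prod X UNIV"] unfolding e .
qed

lemma Omega_Q_poly: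
  fixes f0 :: "nat \<Rightarrow> 'n::{finite,linorder}"
  assumes "strict_partition lam" "inj_on f0 {..<length lam}" "odd k"
  shows "Omega k (to_fract (Q_poly lam :: 'n mpoly)) =
    scalar (eig (Poly_Mapping.lookup (exponent lam f0)) k) * to_fract (Q_poly lam)"
proof -
  have "delta * (to_fract (Q_poly lam) * eta_prod X UNIV) = to_fract (Q_poly lam :: 'n mpoly)"
    by (simp only: mult.left_commute[of delta] delta_eta_prod mult_1_right)
  then show ?thesis
    unfolding Omega_conj[OF assms(3)] conj_Omega_eigen[OF pow_op_Q_poly[OF assms(1,2)] assms(3)]
    by (simp only: mult.left_commute[of delta])
qed

theorem eigenfunction_Q_poly:
  assumes "strict_partition lam" "odd k"
  shows "eigenfunction (Omega k) (to_fract (Q_poly lam :: 'n::{finite,linorder} mpoly))"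
proof (cases "\<exists>f :: nat \<Rightarrow> 'n. inj_on f {..<length lam}")
  case True
  then obtain f0 :: "nat \<Rightarrow> 'n" where "inj_on f0 {..<length lam}"
    by blast
  from Omega_Q_poly[OF assms(1) this assms(2)] show ?thesis
    unfolding eigenfunction_def scalar_def by blast
next
  case False
  have "conj_Omega k 0 = 0"
    using diff_op_scalar[OF diff_op_conj_Omega, of k 0 0] by simp
  then have "Omega k (0 :: 'n ratfun) = 0"
    by (simp add: Omega_conj[OF assms(2)])
  then show ?thesis
    unfolding Q_poly_eq_0[OF assms(1) False] eigenfunction_def by simp
qed

section \<open>Leading exponents of eigenfunctions\<close>

lemma leading_exponent:
  fixes p :: "'n::linorder mpoly"
  assumes "p \<noteq> 0"
  obtains \<alpha> where "Poly_Mapping.lookup p \<alpha> \<noteq> 0" "\<forall>m>\<alpha>. Poly_Mapping.lookup p m = 0"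
proof (rule that[of "Max (Poly_Mapping.keys p)"])
  let ?K = "Poly_Mapping.keys p"
  have "?K \<noteq> {}"
    using assms by simp
  then have "Max ?K \<in> ?K"
    by (intro Max_in) simp_all
  then show "Poly_Mapping.lookup p (Max ?K) \<noteq> 0"
    by (rule in_keys_iff[THEN iffD1])
  show "\<forall>m>Max ?K. Poly_Mapping.lookup p m = 0"
  proof (intro allI impI)
    fix m assume "Max ?K < m"
    then have "m \<notin> ?K"
      by (metis Max_ge finite_keys leD)
    then show "Poly_Mapping.lookup p m = 0"
      by (simp add: in_keys_iff)
  qed
qed

lemma has_lim_eta_prod: "has_lim (eta_prod X S) 1"
proof -
  have "has_lim (eta_prod X S) (\<Prod>p\<in>{(a, b). a \<in> S \<and> b \<in> S \<and> a < b}. 1)"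
    unfolding eta_prod_def by (intro has_lim_prod) (auto simp: eta_def intro: has_lim_theta)
  then show ?thesis
    by (simp only: prod.neutral_const)
qed

text \<open>After conjugation p becomes its leading monomial times a function whose limit is the
  leading coefficient, because \<open>eta_prod\<close> tends to 1.\<close>

lemma eigenvalue_leading:
  assumes "Poly_Mapping.lookup p \<alpha> \<noteq> 0" "\<forall>m>\<alpha>. Poly_Mapping.lookup p m = 0"
    and "odd k" "Omega k (to_fract p) = scalar c * to_fract p"
  shows "c = eig (Poly_Mapping.lookup \<alpha>) k"
proof -
  let ?e = "eta_prod X UNIV :: 'a ratfun"
  let ?f = "to_fract p / Mon \<alpha> * ?e"
  have lim: "has_lim ?f (Poly_Mapping.lookup p \<alpha> * 1)"
    by (intro has_lim_mult has_lim_polynomial[OF assms(2)] has_lim_eta_prod)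
  have f: "Mon \<alpha> * ?f = to_fract p * ?e"
    by simp
  have "delta * conj_Omega k (to_fract p * ?e) = scalar c * (to_fract p * (delta * ?e))"
    using Omega_conj[OF assms(3), of "to_fract p"] assms(4) by (simp only: delta_eta_prod mult_1_right)
  also have "\<dots> = delta * (scalar c * (to_fract p * ?e))"
    by (simp only: mult_ac)
  finally have "conj_Omega k (to_fract p * ?e) = scalar c * (to_fract p * ?e)"
    by (rule mult_left_cancel[OF delta_nonzero, THEN iffD1])
  then have "conj_Omega k (Mon \<alpha> * ?f) = scalar c * (Mon \<alpha> * ?f)"
    unfolding f .
  from conj_Omega_eigenvalue[OF lim _ this] assms(1) show ?thesis
    by simp
qed

section \<open>Symmetric polynomials\<close>

lemma permuted_exponent:
  fixes k :: "'n::finite \<Rightarrow>\<^sub>0 nat"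
  assumes "bij \<pi>"
  obtains k' where "\<And>i. Poly_Mapping.lookup k' (\<pi> i) = Poly_Mapping.lookup k i"
proof
  fix i
  have "Poly_Mapping.lookup (\<Sum>j\<in>UNIV. Poly_Mapping.single (\<pi> j) (Poly_Mapping.lookup k j)) (\<pi> i) =
      (\<Sum>j\<in>UNIV. if j = i then Poly_Mapping.lookup k j else 0)"
    unfolding lookup_sum using bij_is_inj[OF assms]
    by (intro sum.cong refl) (auto simp: lookup_single when_def inj_eq)
  then show "Poly_Mapping.lookup (\<Sum>j\<in>UNIV. Poly_Mapping.single (\<pi> j) (Poly_Mapping.lookup k j)) (\<pi> i) =
      Poly_Mapping.lookup k i"
    by simp
qed

lemma symmetric_lookup:
  fixes p :: "'n::{finite,linorder} mpoly"
  assumes "symmetric_mpoly p" "bij \<pi>"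
    and m': "\<And>i. Poly_Mapping.lookup m' (\<pi> i) = Poly_Mapping.lookup m i"
  shows "Poly_Mapping.lookup p m' = Poly_Mapping.lookup p m"
proof -
  have "Poly_Mapping.lookup (Const (Poly_Mapping.lookup p k) * (\<Prod>i\<in>UNIV. Var (\<pi> i) ^ Poly_Mapping.lookup k i)) m' =
      (if k = m then Poly_Mapping.lookup p m else 0)" for k
  proof -
    obtain k' where k': "\<And>i. Poly_Mapping.lookup k' (\<pi> i) = Poly_Mapping.lookup k i"
      using permuted_exponent[OF assms(2), of k] by blast
    have "(\<Prod>i\<in>UNIV. Var (\<pi> i) ^ Poly_Mapping.lookup k i) =
        (\<Prod>i\<in>UNIV. Var (\<pi> i) ^ Poly_Mapping.lookup k' (\<pi> i) :: 'n mpoly)"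
      unfolding k' ..
    also have "\<dots> = Poly_Mapping.single k' 1"
      unfolding single_eq_prod_Var by (rule prod.reindex_bij_betw[OF assms(2)])
    finally have "Const (Poly_Mapping.lookup p k) * (\<Prod>i\<in>UNIV. Var (\<pi> i) ^ Poly_Mapping.lookup k i) =
        Poly_Mapping.single k' (Poly_Mapping.lookup p k)"
      by (simp add: Const_def mult_single)
    moreover have "k' = m' \<longleftrightarrow> k = m"
    proof
      assume "k' = m'"
      then show "k = m"
        using k' m' by (intro poly_mapping_eqI) simp
    next
      assume "k = m"
      then have "Poly_Mapping.lookup k' (\<pi> i) = Poly_Mapping.lookup m' (\<pi> i)" for i
        by (simp add: k' m')
      then show "k' = m'"
        using bij_is_surj[OF assms(2)] by (intro poly_mapping_eqI) (metis surjD)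
    qed
    ultimately show ?thesis
      by (simp add: lookup_single when_def)
  qed
  then have "Poly_Mapping.lookup (subst Const (\<lambda>i. Var (\<pi> i)) p) m' =
      (\<Sum>k\<in>Poly_Mapping.keys p. if k = m then Poly_Mapping.lookup p m else 0)"
    unfolding subst_def lookup_sum by (intro sum.cong refl)
  also have "\<dots> = Poly_Mapping.lookup p m"
    by (auto simp: in_keys_iff)
  finally show ?thesis
    using assms(1,2) unfolding symmetric_mpoly_def by simp
qed

text \<open>Permuting the variables fixes numerator and denominator of the generating function, and
  the denominator can be cancelled.\<close>

lemma subst_q_poly:
  fixes \<pi> :: "'n::{finite,linorder} \<Rightarrow> 'n"
  assumes "bij \<pi>"
  shows "subst Const (\<lambda>i. Var (\<pi> i)) (q_poly k) = (q_poly k :: 'n mpoly)"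
proof -
  let ?s = "subst Const (\<lambda>i. Var (\<pi> i)) :: 'n mpoly \<Rightarrow> 'n mpoly"
  define F where "F f = Abs_fps (\<lambda>k. ?s (fps_nth f k))" for f
  have mult: "F (f * g) = F f * F g" for f g
    by (rule fps_ext) (simp add: F_def fps_mult_nth Const.subst_sum Const.subst_mult)
  have one: "F 1 = 1"
    by (rule fps_ext) (simp add: F_def)
  have prod: "F (\<Prod>i\<in>A. f i) = (\<Prod>i\<in>A. F (f i))" for A :: "'n set" and f
    by (induction A rule: infinite_finite_induct) (simp_all add: one mult)
  have lin: "F (1 + fps_const a * fps_X) = 1 + fps_const (?s a) * fps_X"
    "F (1 - fps_const a * fps_X) = 1 - fps_const (?s a) * fps_X" for a
    by (rule fps_ext; simp add: F_def Const.subst_add Const.subst_diff fps_X_def)+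
  let ?D = "\<Prod>i\<in>UNIV. 1 - fps_const (Var i) * fps_X :: 'n mpoly fps"
  let ?N = "\<Prod>i\<in>UNIV. 1 + fps_const (Var i) * fps_X :: 'n mpoly fps"
  have "F ?D = (\<Prod>i\<in>UNIV. 1 - fps_const (Var (\<pi> i)) * fps_X)"
    "F ?N = (\<Prod>i\<in>UNIV. 1 + fps_const (Var (\<pi> i)) * fps_X)"
    by (simp_all only: prod lin Const.subst_Var)
  then have inv: "F ?D = ?D" "F ?N = ?N"
    using prod.reindex_bij_betw[OF assms, of "\<lambda>i. 1 - fps_const (Var i) * fps_X :: 'n mpoly fps"]
      prod.reindex_bij_betw[OF assms, of "\<lambda>i. 1 + fps_const (Var i) * fps_X :: 'n mpoly fps"]
    by simp_all
  have nz: "?D \<noteq> 0"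
  proof -
    have "fps_nth (1 - fps_const (Var i) * fps_X :: 'n mpoly fps) 0 = 1" for i
      by simp
    then have "1 - fps_const (Var i) * fps_X \<noteq> (0 :: 'n mpoly fps)" for i
      by (metis fps_zero_nth zero_neq_one)
    then show ?thesis
      by (subst prod_zero_iff) simp_all
  qed
  have "F q_gen * ?D = q_gen * ?D"
    using mult[of q_gen ?D] unfolding q_gen_mult inv by simp
  then have "F q_gen = q_gen"
    by (rule mult_right_cancel[OF nz, THEN iffD1])
  then have "fps_nth (F q_gen) k = fps_nth q_gen k"
    by simp
  then show ?thesis
    by (simp add: F_def q_poly_def)
qed

lemma symmetric_Q_poly: "symmetric_mpoly (Q_poly lam :: 'n::{finite,linorder} mpoly)"
  unfolding symmetric_mpoly_def
proof (intro allI impI)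
  fix \<pi> :: "'n \<Rightarrow> 'n"
  assume \<pi>: "bij \<pi>"
  let ?s = "subst Const (\<lambda>i. Var (\<pi> i)) :: 'n mpoly \<Rightarrow> 'n mpoly"
  have two: "?s 2 = 2"
    using Const.subst_add[of "\<lambda>i. Var (\<pi> i)" 1 1] by simp
  have pair: "?s (Q_pair k l) = Q_pair k l" for k l
    unfolding Q_pair_def
    by (simp add: two Const.subst_add Const.subst_mult Const.subst_sum Const.subst_power Const.subst_minus subst_q_poly[OF \<pi>])
  have sign: "?s (of_int (sign \<sigma>)) = of_int (sign \<sigma>)" for \<sigma> :: "nat \<Rightarrow> nat"
    by (cases \<sigma> rule: sign_cases) (simp_all add: Const.subst_minus)
  have pf: "?s (pfaffian m A) = pfaffian m (\<lambda>i j. ?s (A i j))" for m A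
    by (simp only: pfaffian_def Const.subst_sum Const.subst_mult Const.subst_prod sign)
  have entry: "?s (if i = j then 0 else Q_pair k l) = (if i = j then 0 else Q_pair k l)" for i j :: nat and k l
    by (simp add: pair)
  show "?s (Q_poly lam) = Q_poly lam"
    unfolding Q_poly_def Let_def pf entry ..
qed

section \<open>The cancellation property\<close>

text \<open>
  Let \<open>a\<close> be a repeated exponent at \<open>i\<close> and \<open>j\<close>. By symmetry and maximality, the leading monomial is
  the only one that contributes to its image at \<open>t ^ (2 * a)\<close>.
\<close>

lemma leading_exponent_strict:
  fixes p :: "'n::{finite,linorder} mpoly"
  assumes sym: "symmetric_mpoly p" and cancel: "cancellation_property p"
    and nz: "Poly_Mapping.lookup p \<alpha> \<noteq> 0" and lead: "\<forall>m>\<alpha>. Poly_Mapping.lookup p m = 0"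
    and ij: "i < j" and eq: "Poly_Mapping.lookup \<alpha> i = Poly_Mapping.lookup \<alpha> j"
  shows "Poly_Mapping.lookup \<alpha> i = 0"
proof (rule ccontr)
  let ?a = "Poly_Mapping.lookup \<alpha> i"
  assume a: "?a \<noteq> 0"
  let ?\<phi> = "\<lambda>l. if l = i then [:0, 1:] else if l = j then - [:0, 1:] else [:Var l:] :: 'n mpoly poly"
  let ?rest = "\<lambda>m. Poly_Mapping.update i 0 (Poly_Mapping.update j 0 m) :: 'n \<Rightarrow>\<^sub>0 nat"
  define v where "v l = (if l = i then 1 else if l = j then - 1 else Var l :: 'n mpoly)" for l
  define e where "e l = (if l = i then 1 else if l = j then 1 else 0 :: nat)" for l
  have prod_monom: "(\<Prod>l\<in>A. monom (b l) (d l)) = monom (\<Prod>l\<in>A. b l) (\<Sum>l\<in>A. d l)"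
    for b :: "'n \<Rightarrow> 'n mpoly" and d A
    by (induction A rule: infinite_finite_induct) (simp_all add: mult_monom)
  have \<phi>: "?\<phi> l = monom (v l) (e l)" for l
    by (simp add: v_def e_def monom_0 monom_Suc)
  have sign: "(- 1 :: 'n mpoly) ^ n = Const ((- 1) ^ n)" for n
    by (cases "even n") (simp_all add: Const_def single_uminus)
  \<comment> \<open>\<open>?rest\<close> erases the exponents of i and j: the power of t is their
    sum, and x_j = -t contributes the sign.\<close>
  have coeff_term: "Poly_Mapping.lookup (coeff ([:Const c:] * (\<Prod>l\<in>UNIV. ?\<phi> l ^ Poly_Mapping.lookup m l)) (2 * ?a)) (?rest \<alpha>) =
      (if Poly_Mapping.lookup m i + Poly_Mapping.lookup m j = 2 * ?a \<and> ?rest m = ?rest \<alpha>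
       then c * (- 1) ^ Poly_Mapping.lookup m j else 0)" for c m
  proof -
    let ?m = "Poly_Mapping.lookup m"
    have "(\<Sum>l\<in>UNIV. e l * ?m l) = (\<Sum>l\<in>UNIV. (if l = i then ?m i else 0) + (if l = j then ?m j else 0))"
      using ij by (intro sum.cong refl) (auto simp: e_def)
    also have "\<dots> = ?m i + ?m j"
      by (simp add: sum.distrib)
    finally have deg: "(\<Sum>l\<in>UNIV. e l * ?m l) = ?m i + ?m j" .
    have "(\<Prod>l\<in>UNIV. v l ^ ?m l) =
        (\<Prod>l\<in>UNIV. (if l = j then (- 1) ^ ?m j else 1) * Var l ^ Poly_Mapping.lookup (?rest m) l)"
      using ij by (intro prod.cong refl) (auto simp: v_def lookup_update)
    also have "\<dots> = (- 1) ^ ?m j * Poly_Mapping.single (?rest m) 1"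
      unfolding single_eq_prod_Var by (simp add: prod.distrib)
    also have "\<dots> = Poly_Mapping.single (?rest m) ((- 1) ^ ?m j)"
      unfolding sign by (simp add: Const_def mult_single)
    finally have val: "(\<Prod>l\<in>UNIV. v l ^ ?m l) = Poly_Mapping.single (?rest m) ((- 1) ^ ?m j)" .
    have "[:Const c:] * (\<Prod>l\<in>UNIV. ?\<phi> l ^ ?m l) = monom (Const c * Poly_Mapping.single (?rest m) ((- 1) ^ ?m j)) (?m i + ?m j)"
      unfolding \<phi> monom_power prod_monom deg val by (simp add: smult_monom)
    also have "Const c * Poly_Mapping.single (?rest m) ((- 1) ^ ?m j) = Poly_Mapping.single (?rest m) (c * (- 1) ^ ?m j)"
      by (simp add: Const_def mult_single)
    finally show ?thesis
      by (simp add: lookup_single when_def)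
  qed
  have only: "m = \<alpha>" if m: "Poly_Mapping.lookup p m \<noteq> 0"
    "Poly_Mapping.lookup m i + Poly_Mapping.lookup m j = 2 * ?a" "?rest m = ?rest \<alpha>" for m
  proof -
    \<comment> \<open>Of the two positions that may differ, i is the more significant one, so the
      comparison is decided there.\<close>
    have greater: "\<alpha> < m'" if "Poly_Mapping.lookup m' i > ?a" "?rest m' = ?rest \<alpha>" for m'
    proof -
      have "Poly_Mapping.lookup m' l = Poly_Mapping.lookup \<alpha> l" if "l < i" for l
        using arg_cong[OF \<open>?rest m' = ?rest \<alpha>\<close>, of "\<lambda>r. Poly_Mapping.lookup r l"] that ij
        by (simp add: lookup_update split: if_splits)
      then show ?thesis
        using \<open>Poly_Mapping.lookup m' i > ?a\<close> unfolding less_poly_mapping.rep_eq less_fun_def by auto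
    qed
    have "\<not> Poly_Mapping.lookup m i > ?a"
      using greater[of m] m lead by blast
    moreover have "\<not> Poly_Mapping.lookup m i < ?a"
    proof
      assume "Poly_Mapping.lookup m i < ?a"
      then have j: "Poly_Mapping.lookup m j > ?a"
        using m(2) by simp
      \<comment> \<open>Symmetry permits exchanging the exponents of i and j, which brings the
        larger one to i and contradicts maximality of \<alpha>.\<close>
      let ?m = "Poly_Mapping.update i (Poly_Mapping.lookup m j) (Poly_Mapping.update j (Poly_Mapping.lookup m i) m)"
      have "Poly_Mapping.lookup p ?m = Poly_Mapping.lookup p m"
        by (rule symmetric_lookup[OF sym permutes_bij[OF permutes_swap_id[of i UNIV j]]]) (auto simp: lookup_update transpose_def)
      moreover have "?rest ?m = ?rest \<alpha>"
        unfolding m(3)[symmetric] by (rule poly_mapping_eqI) (simp add: lookup_update)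
      moreover have "Poly_Mapping.lookup ?m i > ?a"
        using j by (simp add: lookup_update)
      ultimately show False
        using greater[of ?m] lead m(1) by simp
    qed
    ultimately have "Poly_Mapping.lookup m i = ?a" "Poly_Mapping.lookup m j = ?a"
      using m(2) by simp_all
    then have "Poly_Mapping.lookup m l = Poly_Mapping.lookup \<alpha> l" for l
      using arg_cong[OF m(3), of "\<lambda>r. Poly_Mapping.lookup r l"] eq
      by (auto simp: lookup_update split: if_splits)
    then show ?thesis
      by (intro poly_mapping_eqI)
  qed
  let ?P = "subst (\<lambda>c. [:Const c:]) ?\<phi> p"
  have "Poly_Mapping.lookup (coeff ?P (2 * ?a)) (?rest \<alpha>) =
      (\<Sum>m\<in>Poly_Mapping.keys p. if Poly_Mapping.lookup m i + Poly_Mapping.lookup m j = 2 * ?a \<and> ?rest m = ?rest \<alpha>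
       then Poly_Mapping.lookup p m * (- 1) ^ Poly_Mapping.lookup m j else 0)"
    unfolding subst_def coeff_sum lookup_sum coeff_term ..
  also have "\<dots> = (\<Sum>m\<in>Poly_Mapping.keys p. if m = \<alpha> then Poly_Mapping.lookup p \<alpha> * (- 1) ^ ?a else 0)"
    using only eq by (intro sum.cong refl) (auto simp: in_keys_iff)
  also have "\<dots> = Poly_Mapping.lookup p \<alpha> * (- 1) ^ ?a"
    using nz by (simp add: in_keys_iff)
  finally have "Poly_Mapping.lookup (coeff ?P (2 * ?a)) (?rest \<alpha>) \<noteq> 0"
    using nz by simp
  then have "coeff ?P (2 * ?a) \<noteq> 0"
    by (metis lookup_zero)
  then have "2 * ?a \<le> degree ?P"
    by (rule le_degree)
  moreover have "degree ?P = 0"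
    by (rule cancel[unfolded cancellation_property_def, rule_format]) (use ij in simp)
  ultimately show False
    using a by simp
qed

text \<open>The positive exponents are distinct, so sorting them gives a strict partition, and
  \<open>f0\<close> sends each part to the variable that carries it.\<close>

lemma strict_exponent:
  fixes \<alpha> :: "'n::finite \<Rightarrow>\<^sub>0 nat"
  assumes "\<And>i j. i \<noteq> j \<Longrightarrow> Poly_Mapping.lookup \<alpha> i = Poly_Mapping.lookup \<alpha> j \<Longrightarrow> Poly_Mapping.lookup \<alpha> i = 0"
  obtains lam f0 where "strict_partition lam" "inj_on f0 {..<length lam}" "exponent lam f0 = \<alpha>"
proof -
  let ?l = "Poly_Mapping.lookup \<alpha>"
  define S where "S = {i. ?l i > 0}"
  have inj: "inj_on ?l S"
  proof (rule inj_onI, rule ccontr)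
    fix i j assume "i \<in> S" "j \<in> S" "?l i = ?l j" "i \<noteq> j"
    then show False
      using assms[of i j] by (simp add: S_def)
  qed
  define lam where "lam = rev (sorted_list_of_set (?l ` S))"
  have set: "set lam = ?l ` S" and dist: "distinct lam"
    by (simp_all add: lam_def)
  define f0 where "f0 a = inv_into S ?l (lam ! a)" for a
  have f0: "f0 a \<in> S" "?l (f0 a) = lam ! a" if "a < length lam" for a
  proof -
    have "lam ! a \<in> ?l ` S"
      using that set nth_mem by blast
    then show "f0 a \<in> S" "?l (f0 a) = lam ! a"
      unfolding f0_def by (rule inv_into_into, rule f_inv_into_f)
  qed
  have inj0: "inj_on f0 {..<length lam}"
  proof (rule inj_onI)
    fix a b assume "a \<in> {..<length lam}" "b \<in> {..<length lam}" "f0 a = f0 b"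
    then show "a = b"
      using f0(2)[of a] f0(2)[of b] nth_eq_iff_index_eq[OF dist, of a b] by simp
  qed
  have image: "i \<in> f0 ` {..<length lam}" if "i \<in> S" for i
  proof -
    have "?l i \<in> set lam"
      using that set by blast
    then obtain a where a: "a < length lam" "lam ! a = ?l i"
      by (auto simp: in_set_conv_nth)
    then have "f0 a = i"
      using that f0[of a] inj_onD[OF inj, of "f0 a" i] by simp
    then show ?thesis
      using a(1) by blast
  qed
  have "exponent lam f0 = \<alpha>"
  proof (rule poly_mapping_eqI)
    fix i
    show "Poly_Mapping.lookup (exponent lam f0) i = ?l i"
    proof (cases "i \<in> f0 ` {..<length lam}")
      case True
      then obtain a where "a < length lam" "i = f0 a"
        by blast
      then show ?thesis
        by (simp add: lookup_exponent(1)[OF inj0] f0(2))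
    next
      case False
      then have "i \<notin> S"
        using image by blast
      then show ?thesis
        using lookup_exponent(2)[OF inj0 False] by (simp add: S_def)
    qed
  qed
  moreover have "strict_partition lam"
    unfolding strict_partition_def set by (auto simp: S_def lam_def sorted_wrt_rev)
  ultimately show ?thesis
    using inj0 that by blast
qed

section \<open>Uniqueness of the eigenfunctions\<close>

text \<open>Relative to the largest occurring exponent \<kappa>, exactly one term of the expansion
  has a nonzero limit, because distinct positive parts make the choice recoverable from its
  exponent. Hence the sum cannot vanish.\<close>

lemma Q_poly_nonzero:
  fixes f0 :: "nat \<Rightarrow> 'n::{finite,linorder}"
  assumes "strict_partition lam" "inj_on f0 {..<length lam}"
  shows "(Q_poly lam :: 'n mpoly) \<noteq> 0"
proof
  assume zero: "(Q_poly lam :: 'n mpoly) = 0"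
  let ?n = "length lam"
  define i0 where "i0 = f0 0"
  define I where "I = {f \<in> choices lam i0. inj_on f {..<?n}}"
  have dist: "distinct lam" and pos: "\<And>a. a < ?n \<Longrightarrow> lam ! a > 0"
    using assms(1) by (auto simp: strict_partition_def sorted_wrt_iff_nth_less distinct_conv_nth nat_neq_iff)
  obtain c where c: "\<And>f. c f \<noteq> 0"
    and Q: "to_fract (Q_poly lam) * eta_prod X UNIV =
      (\<Sum>f\<in>I. scalar (c f) * (Mon (exponent lam f) * eta_prod X (UNIV - f ` {..<?n})))"
    using to_fract_Q_poly_terms[OF assms(1), of i0] unfolding I_def by blast
  have fin: "finite I"
    unfolding I_def choices_def by (intro finite_subset[OF _ finite_PiE[of "{..<length (even_padding lam)}"]]) auto
  have "(\<lambda>a\<in>{..<length (even_padding lam)}. if a < ?n then f0 a else i0) \<in> I"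
    using assms(2) by (auto simp: I_def choices_def inj_on_def even_padding_def)
  then have ne: "I \<noteq> {}"
    by blast
  have inj: "f = g" if f: "f \<in> I" and g: "g \<in> I" and e: "exponent lam f = exponent lam g" for f g
  proof -
    have injf: "inj_on f {..<?n}" and injg: "inj_on g {..<?n}"
      and PiE: "f \<in> choices lam i0" "g \<in> choices lam i0"
      using f g by (auto simp: I_def)
    have small: "f a = g a" if a: "a < ?n" for a
    proof -
      have l: "Poly_Mapping.lookup (exponent lam g) (f a) = lam ! a"
        using lookup_exponent(1)[OF injf a] e by simp
      then have "f a \<in> g ` {..<?n}"
        using lookup_exponent(2)[OF injg, of "f a"] pos[OF a] by fastforce
      then obtain b where b: "b < ?n" "f a = g b"
        by blast
      then have "lam ! b = lam ! a"
        using lookup_exponent(1)[OF injg b(1)] l by simp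
      then show ?thesis
        using b a nth_eq_iff_index_eq[OF dist b(1) a] by simp
    qed
    show ?thesis
      using PiE unfolding choices_def
    proof (rule PiE_ext)
      fix a assume a: "a \<in> {..<length (even_padding lam)}"
      show "f a = g a"
        using small[of a] PiE_mem[OF PiE(1)[unfolded choices_def] a] PiE_mem[OF PiE(2)[unfolded choices_def] a]
        by (cases "a < ?n") simp_all
    qed
  qed
  define \<kappa> where "\<kappa> = Max (exponent lam ` I)"
  have "\<kappa> \<in> exponent lam ` I"
    unfolding \<kappa>_def using fin ne by (intro Max_in) auto
  then obtain h where h: "h \<in> I" "\<kappa> = exponent lam h"
    by blast
  have "has_lim (scalar (c f) * (Mon (exponent lam f) * eta_prod X (UNIV - f ` {..<?n})) / Mon \<kappa>)
      (if f = h then c h else 0)" if f: "f \<in> I" for f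
  proof -
    have "exponent lam f \<le> \<kappa>"
      unfolding \<kappa>_def using fin f by (intro Max_ge) auto
    then have "\<forall>m>\<kappa>. Poly_Mapping.lookup (Poly_Mapping.single (exponent lam f) (1 :: complex)) m = 0"
      by (auto simp: lookup_single when_def)
    from has_lim_polynomial[OF this]
    have lim: "has_lim (Mon (exponent lam f) / Mon \<kappa>)
        (Poly_Mapping.lookup (Poly_Mapping.single (exponent lam f) 1) \<kappa>)"
      unfolding Mon_def .
    have 1: "has_lim (Mon (exponent lam f) / Mon \<kappa>) (if f = h then 1 else 0)"
    proof -
      have "exponent lam f = exponent lam h \<longleftrightarrow> f = h"
        using inj[OF f h(1)] by blast
      with lim show ?thesis
        by (simp only: lookup_single when_def h(2))
    qed
    have "has_lim (scalar (c f) * (Mon (exponent lam f) / Mon \<kappa> * eta_prod X (UNIV - f ` {..<?n})))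
        (c f * ((if f = h then 1 else 0) * 1))"
      by (intro has_lim_scalar_mult has_lim_mult 1 has_lim_eta_prod)
    then show ?thesis
      by (simp split: if_splits)
  qed
  then have "has_lim (\<Sum>f\<in>I. scalar (c f) * (Mon (exponent lam f) * eta_prod X (UNIV - f ` {..<?n})) / Mon \<kappa>)
      (\<Sum>f\<in>I. if f = h then c h else 0)"
    by (rule has_lim_sum)
  moreover have "(\<Sum>f\<in>I. scalar (c f) * (Mon (exponent lam f) * eta_prod X (UNIV - f ` {..<?n})) / Mon \<kappa>) = scalar 0"
    unfolding sum_divide_distrib[symmetric] Q[symmetric] zero by simp
  ultimately have "has_lim (scalar 0 :: 'n ratfun) (c h)"
    using fin h(1) by simp
  then have "0 = c h"
    by (rule has_lim_unique[OF has_lim_scalar])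
  with c show False
    by metis
qed

text \<open>
  The eigenvalues determine the multiset of exponents of the leading monomial, so by symmetry every
  monomial with the same eigenvalues occurs.
\<close>

lemma lookup_nonzero_of_eigenvalues:
  fixes p :: "'n::{finite,linorder} mpoly"
  assumes "p \<noteq> 0" "symmetric_mpoly p"
    and eigen: "\<And>k. odd k \<Longrightarrow> Omega k (to_fract p) = scalar (eig (Poly_Mapping.lookup \<alpha>) k) * to_fract p"
  shows "Poly_Mapping.lookup p \<alpha> \<noteq> 0"
proof -
  obtain \<beta> where \<beta>: "Poly_Mapping.lookup p \<beta> \<noteq> 0" "\<forall>m>\<beta>. Poly_Mapping.lookup p m = 0"
    using leading_exponent[OF assms(1)] .
  let ?a = "Poly_Mapping.lookup \<alpha>" and ?b = "Poly_Mapping.lookup \<beta>"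
  have pos: "card {i. ?a i = v} = card {i. ?b i = v}" if "v > 0" for v
    using eigenvalue_leading[OF \<beta> _ eigen] that by (intro eig_separates)
  let ?V = "?a ` UNIV \<union> ?b ` UNIV \<union> {0}"
  \<comment> \<open>The eigenvalues do not see the exponent 0; its multiplicity follows because all
    multiplicities add up to the number of variables.\<close>
  have total: "card {i. f i = 0} + (\<Sum>v\<in>?V - {0}. card {i. f i = v}) = card (UNIV :: 'n set)" if "range f \<subseteq> ?V" for f :: "'n \<Rightarrow> nat"
  proof -
    have "(\<Sum>v\<in>?V. \<Sum>i\<in>{i. i \<in> UNIV \<and> f i = v}. 1) = (\<Sum>i\<in>(UNIV :: 'n set). 1 :: nat)"
      by (rule sum.group) (use that in auto)
    then show ?thesis
      using sum.remove[of ?V 0 "\<lambda>v. card {i. f i = v}"] by simp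
  qed
  have "card {i. ?a i = 0} + (\<Sum>v\<in>?V - {0}. card {i. ?a i = v}) =
      card {i. ?b i = 0} + (\<Sum>v\<in>?V - {0}. card {i. ?b i = v})"
  proof -
    have sub: "range ?a \<subseteq> ?V" "range ?b \<subseteq> ?V"
      by blast+
    show ?thesis
      by (simp only: total[OF sub(1)] total[OF sub(2)])
  qed
  moreover have "(\<Sum>v\<in>?V - {0}. card {i. ?a i = v}) = (\<Sum>v\<in>?V - {0}. card {i. ?b i = v})"
    by (intro sum.cong refl pos) auto
  ultimately have "card {i. ?a i = v} = card {i. ?b i = v}" for v
    using pos[of v] by (cases "v = 0") simp_all
  then have "image_mset ?a (mset_set UNIV) = image_mset ?b (mset_set UNIV)"
    by (intro multiset_eqI) (simp add: count_image_mset_eq_card_vimage)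
  then obtain \<pi> where \<pi>: "\<pi> permutes UNIV" "\<forall>i\<in>UNIV. ?a i = ?b (\<pi> i)"
    using image_mset_eq_implies_permutes[of UNIV ?a ?b] by auto
  have "Poly_Mapping.lookup p \<beta> = Poly_Mapping.lookup p \<alpha>"
    by (rule symmetric_lookup[OF assms(2) permutes_bij[OF \<pi>(1)]]) (use \<pi>(2) in simp)
  with \<beta>(1) show ?thesis
    by simp
qed

lemma Omega_diff_scalar:
  assumes "odd k"
  shows "Omega k (f - scalar d * g) = Omega k f - scalar d * Omega k g"
proof -
  let ?e = "eta_prod X UNIV"
  have "(f - scalar d * g) * ?e = f * ?e + scalar (- d) * (g * ?e)"
    by (simp add: scalar_minus algebra_simps)
  then have e: "conj_Omega k ((f - scalar d * g) * ?e) =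
      conj_Omega k (f * ?e) + scalar (- d) * conj_Omega k (g * ?e)"
    by (simp only: diff_op_plus[OF diff_op_conj_Omega] diff_op_scalar[OF diff_op_conj_Omega])
  show ?thesis
    unfolding Omega_conj[OF assms] e by (simp add: scalar_minus algebra_simps)
qed

text \<open>The difference p - d * q with vanishing coefficient at \<alpha> is again symmetric with
  the same eigenvalues; if nonzero, it would have a nonzero coefficient there.\<close>

lemma symmetric_eigenfunction_unique:
  fixes p q :: "'n::{finite,linorder} mpoly" and \<alpha> :: "'n \<Rightarrow>\<^sub>0 nat"
  assumes "symmetric_mpoly p" "symmetric_mpoly q" "q \<noteq> 0"
    and p: "\<And>k. odd k \<Longrightarrow> Omega k (to_fract p) = scalar (eig (Poly_Mapping.lookup \<alpha>) k) * to_fract p"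
    and q: "\<And>k. odd k \<Longrightarrow> Omega k (to_fract q) = scalar (eig (Poly_Mapping.lookup \<alpha>) k) * to_fract q"
  shows "\<exists>d. p = Const d * q"
proof -
  let ?l = "\<lambda>p. Poly_Mapping.lookup p \<alpha>"
  have ql: "?l q \<noteq> 0"
    using lookup_nonzero_of_eigenvalues[OF assms(3,2) q] .
  define d where "d = ?l p / ?l q"
  define r where "r = p - Const d * q"
  have "?l (Const d * q) = d * ?l q"
    using lookup_single_mult[of 0 d q \<alpha>] by (simp add: Const_def)
  then have "?l r = 0"
    using ql by (simp add: r_def lookup_minus d_def)
  moreover have "symmetric_mpoly r"
    using assms(1,2) unfolding symmetric_mpoly_def r_def by (simp add: Const.subst_diff Const.subst_mult)
  moreover have "Omega k (to_fract r) = scalar (eig (Poly_Mapping.lookup \<alpha>) k) * to_fract r" if "odd k" for k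
  proof -
    have r: "to_fract r = to_fract p - scalar d * to_fract q"
      by (simp add: r_def scalar_def)
    show ?thesis
      unfolding r Omega_diff_scalar[OF that] p[OF that] q[OF that] by (simp add: algebra_simps)
  qed
  ultimately have "r = 0"
    using lookup_nonzero_of_eigenvalues[of r \<alpha>] by blast
  then show ?thesis
    unfolding r_def by auto
qed

lemma symmetric_eigenfunction_eq_Q_poly:
  fixes p :: "'n::{finite,linorder} mpoly"
  assumes "p \<noteq> 0" "symmetric_mpoly p" "cancellation_property p"
    and eigen: "\<And>k. odd k \<Longrightarrow> eigenfunction (Omega k) (to_fract p)"
  shows "\<exists>lam c. strict_partition lam \<and> p = Const c * Q_poly lam"
proof -
  obtain \<alpha> where \<alpha>: "Poly_Mapping.lookup p \<alpha> \<noteq> 0" "\<forall>m>\<alpha>. Poly_Mapping.lookup p m = 0"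
    using leading_exponent[OF assms(1)] .
  have p: "Omega k (to_fract p) = scalar (eig (Poly_Mapping.lookup \<alpha>) k) * to_fract p" if odd: "odd k" for k
  proof -
    obtain c where c: "Omega k (to_fract p) = scalar c * to_fract p"
      using eigen[OF odd] unfolding eigenfunction_def scalar_def by blast
    with eigenvalue_leading[OF \<alpha> odd c] show ?thesis
      by simp
  qed
  have "Poly_Mapping.lookup \<alpha> i = 0" if "i \<noteq> j" "Poly_Mapping.lookup \<alpha> i = Poly_Mapping.lookup \<alpha> j" for i j
    using that leading_exponent_strict[OF assms(2,3) \<alpha>, of i j] leading_exponent_strict[OF assms(2,3) \<alpha>, of j i]
    by (cases i j rule: linorder_cases) simp_all
  then obtain lam f0 where lam: "strict_partition lam" "inj_on f0 {..<length lam}" "exponent lam f0 = \<alpha>"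
    by (rule strict_exponent)
  have "Omega k (to_fract (Q_poly lam :: 'n mpoly)) = scalar (eig (Poly_Mapping.lookup \<alpha>) k) * to_fract (Q_poly lam)" if "odd k" for k
    using Omega_Q_poly[OF lam(1,2) that] unfolding lam(3) .
  from symmetric_eigenfunction_unique[OF assms(2) symmetric_Q_poly Q_poly_nonzero[OF lam(1,2)] p this] lam(1)
  show ?thesis
    by blast
qed

theorem lemma1p2p3:
  shows
    "((\<lambda>f. inverse delta * f) \<circ> Omega 3 \<circ> (\<lambda>f. delta * f) =
        (\<lambda>f :: 'n::{finite,linorder} ratfun.
          (\<Sum>i\<in>UNIV. (euler i ^^ 3) f) - ((\<lambda>g. \<Sum>i\<in>UNIV. euler i g) ^^ 2) f)) \<and>
     (\<forall>lam. strict_partition lam \<longrightarrow>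
        (\<forall>k. odd k \<longrightarrow> eigenfunction (Omega k) (to_fract (Q_poly lam :: 'n mpoly)))) \<and>
     (\<forall>P :: 'n mpoly.
        P \<noteq> 0 \<and> symmetric_mpoly P \<and> cancellation_property P \<and>
        (\<forall>k. odd k \<longrightarrow> eigenfunction (Omega k) (to_fract P)) \<longrightarrow>
        (\<exists>lam c. strict_partition lam \<and> P = Const c * Q_poly lam))"
proof (intro conjI allI impI)
  show "(\<lambda>f. inverse delta * f) \<circ> Omega 3 \<circ> (\<lambda>f. delta * f) =
      (\<lambda>f :: 'n ratfun. (\<Sum>i\<in>UNIV. (euler i ^^ 3) f) - ((\<lambda>g. \<Sum>i\<in>UNIV. euler i g) ^^ 2) f)"
    (is "?L = ?R")
  proof (rule ext)
    fix f :: "'n ratfun"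
    have "?L f = inverse delta * (delta * conj_Omega 3 f)"
      by (simp add: Omega_conj_delta)
    also have "\<dots> = conj_Omega 3 f"
      by (simp add: mult.assoc[symmetric])
    also have "\<dots> = ?R f"
      by (rule conj_Omega_3)
    finally show "?L f = ?R f" .
  qed
next
  fix lam k
  assume "strict_partition lam" "odd (k :: nat)"
  then show "eigenfunction (Omega k) (to_fract (Q_poly lam :: 'n mpoly))"
    by (rule eigenfunction_Q_poly)
next
  fix P :: "'n mpoly"
  assume "P \<noteq> 0 \<and> symmetric_mpoly P \<and> cancellation_property P \<and>
    (\<forall>k. odd k \<longrightarrow> eigenfunction (Omega k) (to_fract P))"
  then show "\<exists>lam c. strict_partition lam \<and> P = Const c * Q_poly lam"
    by (intro symmetric_eigenfunction_eq_Q_poly) blast+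
qed

end
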